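(* The dimensions of the relative cochain spaces $C^{m}_{GF}(\mathfrak{ham}_4^0,Sp(4,\mathbb{R}))_6$ of weight $6$ in degrees $m=0,1,2,3,4,5,6$ are $0,0,1,1,0,4,4$ respectively. The Euler characteristic number of weight $6$ is $(-1)^0\cdot 0+(-1)^2\cdot 1+(-1)^3\cdot 1+(-1)^5\cdot 4+(-1)^6\cdot 4=0$.
   Context: On $\mathbb{R}^4$ with coordinates $x_1,x_2,x_3,x_4$ use the Poisson bracket $\{f,g\}=\frac{\partial f}{\partial x_1}\frac{\partial g}{\partial x_4}+\frac{\partial f}{\partial x_2}\frac{\partial g}{\partial x_3}-\frac{\partial f}{\partial x_3}\frac{\partial g}{\partial x_2}-\frac{\partial f}{\partial x_4}\frac{\partial g}{\partial x_1}$. Let $\mathfrak{ham}_4^0$ be the Lie algebra of Hamiltonian vector fields with polynomial potentials vanishing at the origin, identified with the Lie algebra, under $\{\cdot,\cdot\}$, of real polynomials all of whose homogeneous components have degree $\ge 2$. Let $\mathfrak{S}_\ell$ be the dual space of the space of homogeneous polynomials of degree $\ell$. Nonzero elements of $\mathfrak{S}_\ell$ have weight $\ell-2$, and nonzero elements of $\mathfrak{S}_{\ell_1}\wedge\cdots\wedge\mathfrak{S}_{\ell_s}$ have weight $\sum_i(\ell_i-2)$. The degree $m$, weight $w$ cochain space is $$C^m_{GF}(\mathfrak{ham}_4^0)_w=\bigoplus \Lambda^{k_2}\mathfrak{S}_2\wedge\Lambda^{k_3}\mathfrak{S}_3\wedge\cdots\wedge\Lambda^{k_s}\mathfrak{S}_s,$$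 the sum being over all finite sequences of non-negative integers $(k_2,k_3,\dots)$ with $\sum_i k_i=m$ and $\sum_i k_i(i-2)=w$. The coboundary operator $d$ is the (degree $+1$) antiderivation determined on $1$-cochains by $(d z)(f,g)=-\langle z,\{f,g\}\rangle$; it preserves weight. The relative cochain space $C^m_{GF}(\mathfrak{ham}_4^0,Sp(4,\mathbb{R}))_w$ consists of those $\sigma\in C^m_{GF}(\mathfrak{ham}_4^0)_w$ with $i_{\hat J(\xi)}\sigma=0$ and $i_{\hat J(\xi)}d\sigma=0$ for all $\xi\in\mathfrak{sp}(4,\mathbb{R})$, where $J$ is the momentum mapping of the linear action of $Sp(4,\mathbb{R})$ on $\mathbb{R}^4$, so that $\hat J(\xi)$ ranges over all homogeneous quadratic polynomials, and $i$ denotes interior product. (Equivalently, it is the space of $Sp(4,\mathbb{R})$-invariant cochains in which $\mathfrak{S}_2$ does not appear.) The Euler characteristic number of weight $w$ is $\sum_m(-1)^m\dim C^m_{GF}(\mathfrak{ham}_4^0,Sp(4,\mathbb{R}))_w$. *)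

theory Defs
  imports "HOL-Analysis.Analysis" "HOL-Analysis.Finite_Function_Topology"
    "HOL-Library.Function_Algebras" "HOL-Library.Groups_Big_Fun"
begin

section \<open>Polynomials on \<open>\<real>\<^sup>4\<close> and the Poisson bracket\<close>

text \<open>The variables are indexed by the type \<open>4\<close>, whose elements are \<open>1, 2, 3, 4\<close> (with \<open>4 = 0\<close>).\<close>

type_synonym monom4 = "4 \<Rightarrow>\<^sub>0 nat"
type_synonym poly4 = "monom4 \<Rightarrow>\<^sub>0 real"

definition mdeg :: "monom4 \<Rightarrow> nat"
  where "mdeg m = (\<Sum>i\<in>UNIV. Poly_Mapping.lookup m i)"

definition pvar :: "4 \<Rightarrow> poly4"
  where "pvar i = Poly_Mapping.single (Poly_Mapping.single i 1) 1"

definition pd :: "4 \<Rightarrow> poly4 \<Rightarrow> poly4"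
  where "pd i p = (\<Sum>m\<in>Poly_Mapping.keys p. Poly_Mapping.single (m - Poly_Mapping.single i 1)
                     (real (Poly_Mapping.lookup m i) * Poly_Mapping.lookup p m))"

definition poisson :: "poly4 \<Rightarrow> poly4 \<Rightarrow> poly4"
  where "poisson f g = pd 1 f * pd 4 g + pd 2 f * pd 3 g - pd 3 f * pd 2 g - pd 4 f * pd 1 g"

lemma mdeg_add: "mdeg (m + n) = mdeg m + mdeg n"
  by (simp add: mdeg_def lookup_add sum.distrib)

lemma mdeg_single: "mdeg (Poly_Mapping.single i k) = k"
  by (simp add: mdeg_def lookup_single when_def)

lemma lookup_pd:
  "Poly_Mapping.lookup (pd i p) m
     = real (Poly_Mapping.lookup m i + 1) * Poly_Mapping.lookup p (m + Poly_Mapping.single i 1)"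
proof -
  let ?e = "Poly_Mapping.single i 1 :: monom4"
  have eq: "n - ?e = m \<longleftrightarrow> n = m + ?e" if "Poly_Mapping.lookup n i \<noteq> 0" for n
  proof
    assume "n - ?e = m"
    then show "n = m + ?e"
      using that by (auto intro!: poly_mapping_eqI simp: lookup_add lookup_minus lookup_single when_def)
  next
    assume "n = m + ?e"
    then show "n - ?e = m"
      by (auto intro!: poly_mapping_eqI simp: lookup_add lookup_minus lookup_single when_def)
  qed
  have "Poly_Mapping.lookup (pd i p) m
      = (\<Sum>n\<in>Poly_Mapping.keys p. if n = m + ?e then real (Poly_Mapping.lookup n i) * Poly_Mapping.lookup p n else 0)"
    unfolding pd_def lookup_sum
    by (rule sum.cong) (use eq in \<open>auto simp: lookup_single when_def lookup_add\<close>)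
  also have "\<dots> = real (Poly_Mapping.lookup (m + ?e) i) * Poly_Mapping.lookup p (m + ?e)"
    by (simp add: in_keys_iff)
  finally show ?thesis
    by (simp add: lookup_add)
qed

lemma pd_add: "pd i (p + q) = pd i p + pd i q"
  by (rule poly_mapping_eqI) (simp add: lookup_pd lookup_add algebra_simps)

lemma lookup_scaleR4: "Poly_Mapping.lookup (c *\<^sub>R p :: poly4) m = c * Poly_Mapping.lookup p m"
proof -
  have "finite {x. c * Poly_Mapping.lookup p x \<noteq> 0}"
    by (rule finite_subset[OF _ finite_lookup[of p]]) auto
  then show ?thesis
    by (simp add: scaleR_poly_mapping_def)
qed

lemma keys_scaleR4: "Poly_Mapping.keys (c *\<^sub>R p :: poly4) \<subseteq> Poly_Mapping.keys p"
  by (auto simp: in_keys_iff lookup_scaleR4)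

lemma keys_pd: "m \<in> Poly_Mapping.keys (pd i p) \<Longrightarrow> m + Poly_Mapping.single i 1 \<in> Poly_Mapping.keys p"
  by (auto simp: in_keys_iff lookup_pd)

lemma poisson_keys:
  assumes "m \<in> Poly_Mapping.keys (poisson f g)"
  obtains a b where "a \<in> Poly_Mapping.keys f" "b \<in> Poly_Mapping.keys g" "mdeg a + mdeg b = mdeg m + 2"
proof -
  have "\<exists>i j. m \<in> Poly_Mapping.keys (pd i f * pd j g)"
    using assms unfolding poisson_def
    by (auto dest!: keys_diff[THEN subsetD] keys_add[THEN subsetD])
  then obtain i j where "m \<in> Poly_Mapping.keys (pd i f * pd j g)"
    by blast
  then obtain a b where ab: "a \<in> Poly_Mapping.keys (pd i f)" "b \<in> Poly_Mapping.keys (pd j g)" "m = a + b"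
    using keys_mult[of "pd i f" "pd j g"] by auto
  show thesis
    by (rule that[OF keys_pd[OF ab(1)] keys_pd[OF ab(2)]]) (simp add: ab(3) mdeg_add mdeg_single)
qed


section \<open>The Lie algebra \<open>ham\<close>\<close>

typedef ham = "{p :: poly4. \<forall>m\<in>Poly_Mapping.keys p. 2 \<le> mdeg m}"
  morphisms poly_of_ham ham_of_poly
  by (rule exI[of _ 0]) simp

setup_lifting type_definition_ham

instantiation ham :: real_vector
begin

lift_definition zero_ham :: ham is 0 by simp
lift_definition plus_ham :: "ham \<Rightarrow> ham \<Rightarrow> ham" is "(+)"
  by (auto dest!: keys_add[THEN subsetD])
lift_definition uminus_ham :: "ham \<Rightarrow> ham" is uminus by simp
lift_definition minus_ham :: "ham \<Rightarrow> ham \<Rightarrow> ham" is "(-)"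
  by (auto dest!: keys_diff[THEN subsetD])
lift_definition scaleR_ham :: "real \<Rightarrow> ham \<Rightarrow> ham" is scaleR
  by (auto dest!: keys_scaleR4[THEN subsetD])

instance
  by standard (simp_all add: poly_of_ham_inject[symmetric] zero_ham.rep_eq plus_ham.rep_eq
      uminus_ham.rep_eq minus_ham.rep_eq scaleR_ham.rep_eq scaleR_add_left scaleR_add_right)

end

lift_definition bracket :: "ham \<Rightarrow> ham \<Rightarrow> ham" is poisson
proof -
  fix f g :: poly4 and m :: monom4
  assume f: "\<And>m. m \<in> Poly_Mapping.keys f \<Longrightarrow> 2 \<le> mdeg m"
    and g: "\<And>m. m \<in> Poly_Mapping.keys g \<Longrightarrow> 2 \<le> mdeg m"
    and "m \<in> Poly_Mapping.keys (poisson f g)"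
  then obtain a b where "a \<in> Poly_Mapping.keys f" "b \<in> Poly_Mapping.keys g"
    and m: "mdeg a + mdeg b = mdeg m + 2"
    by (elim poisson_keys)
  with f[of a] g[of b] show "2 \<le> mdeg m"
    by linarith
qed

definition homogeneous :: "nat \<Rightarrow> ham \<Rightarrow> bool"
  where "homogeneous l f \<longleftrightarrow> (\<forall>m\<in>Poly_Mapping.keys (poly_of_ham f). mdeg m = l)"


section \<open>The momentum mapping of \<open>Sp(4,\<real>)\<close>\<close>

text \<open>The matrix of the Poisson tensor: \<open>\<Omega> i j = {x\<^sub>i, x\<^sub>j}\<close>.\<close>

definition Omega :: "real^4^4"
  where "Omega = (\<chi> i j. if (i, j) \<in> {(1, 4), (2, 3)} then 1
                        else if (i, j) \<in> {(3, 2), (4, 1)} then - 1 else 0)"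

definition sp4 :: "(real^4^4) set"
  where "sp4 = {A. transpose A ** Omega + Omega ** A = 0}"

text \<open>\<open>J\<close> sends \<open>\<xi>\<close> to the quadratic polynomial \<open>x \<mapsto> (1/2) (\<xi> x)\<^sup>T \<Omega> x\<close>, the potential of the linear
  vector field \<open>{\<cdot>, J(\<xi>)} = (x \<mapsto> \<xi> x)\<close>, see \<open>poisson_momentum\<close>. Its range on \<open>sp(4)\<close> consists of all homogeneous
  quadratic polynomials, by \<open>momentum_image\<close>.\<close>

definition momentum_poly :: "real^4^4 \<Rightarrow> poly4"
  where "momentum_poly A = (\<Sum>i\<in>UNIV. \<Sum>j\<in>UNIV.
           Poly_Mapping.single (Poly_Mapping.single i 1 + Poly_Mapping.single j 1)
             ((transpose A ** Omega) $ i $ j / 2))"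

definition momentum :: "real^4^4 \<Rightarrow> ham"
  where "momentum A = ham_of_poly (momentum_poly A)"

lemma mdeg_momentum_poly:
  assumes "m \<in> Poly_Mapping.keys (momentum_poly A)"
  shows "mdeg m = 2"
proof -
  define c where "c i j = (transpose A ** Omega) $ i $ j / 2" for i j
  define t where "t i j = Poly_Mapping.single (Poly_Mapping.single i (1::nat) + Poly_Mapping.single j 1) (c i j)" for i j
  have "m \<in> Poly_Mapping.keys (\<Sum>i\<in>UNIV. \<Sum>j\<in>UNIV. t i j)"
    using assms by (simp only: momentum_poly_def t_def c_def)
  from keys_sum[THEN subsetD, OF this] obtain i where "m \<in> Poly_Mapping.keys (\<Sum>j\<in>UNIV. t i j)"
    by (elim UN_E)
  from keys_sum[THEN subsetD, OF this] obtain j where "m \<in> Poly_Mapping.keys (t i j)"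
    by (elim UN_E)
  then have "m = Poly_Mapping.single i 1 + Poly_Mapping.single j 1"
    by (simp add: t_def split: if_splits)
  then show ?thesis
    by (simp add: mdeg_add mdeg_single)
qed

lemma poly_of_momentum: "poly_of_ham (momentum A) = momentum_poly A"
  unfolding momentum_def by (rule ham_of_poly_inverse) (auto dest: mdeg_momentum_poly)

lemma pd_single: "pd k (Poly_Mapping.single m c)
    = Poly_Mapping.single (m - Poly_Mapping.single k 1) (real (Poly_Mapping.lookup m k) * c)"
  by (simp add: pd_def lookup_single)

lemma pd_sum: "pd k (sum f A) = (\<Sum>a\<in>A. pd k (f a))"
  by (rule poly_mapping_eqI) (simp add: lookup_pd lookup_sum sum_distrib_left)

lemma pd_pvar: "pd k (pvar i) = (if k = i then 1 else 0)"
  by (auto simp: pvar_def pd_single lookup_single when_def single_one)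

lemma Omega_mult: "(Omega ** A) $ 1 $ j = A $ 4 $ j" "(Omega ** A) $ 2 $ j = A $ 3 $ j"
  "(Omega ** A) $ 3 $ j = - (A $ 2 $ j)" "(Omega ** A) $ 4 $ j = - (A $ 1 $ j)"
  by (simp_all add: matrix_matrix_mult_def Omega_def sum_4)

lemma matrix_uminus_left: "(- A) ** B = - (A ** B)" for A B :: "real^4^4"
  by (simp add: vec_eq_iff matrix_matrix_mult_def sum_negf)

lemma matrix_uminus_right: "A ** (- B) = - (A ** B)" for A B :: "real^4^4"
  by (simp add: vec_eq_iff matrix_matrix_mult_def sum_negf)

lemma transpose_Omega: "transpose Omega = - Omega"
  by (simp add: vec_eq_iff forall_4 transpose_def Omega_def)

lemma Omega_Omega: "Omega ** (Omega ** A) = - A"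
  by (simp add: vec_eq_iff forall_4 Omega_mult)

lemma Omega_Omega1: "Omega ** Omega = - mat 1"
  using Omega_Omega[of "mat 1"] by simp

lemma pd_quadratic:
  "pd k (Poly_Mapping.single (Poly_Mapping.single i 1 + Poly_Mapping.single j 1) c)
     = (if k = i then Poly_Mapping.single (Poly_Mapping.single j 1) c else 0)
       + (if k = j then Poly_Mapping.single (Poly_Mapping.single i 1) c else 0)"
proof -
  define e where "e i = (Poly_Mapping.single i 1 :: monom4)" for i
  have lk: "Poly_Mapping.lookup (e a + e b) k = (if k = a then 1 else 0) + (if k = b then 1 else 0)" for a b
    by (simp add: e_def lookup_add lookup_single when_def eq_commute[of k])
  have d: "e a + e b - e a = e b" "e a + e b - e b = e a" for a b
    by (simp_all only: add_diff_cancel_left' add_diff_cancel_right')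
  have "pd k (Poly_Mapping.single (e i + e j) c)
      = (if k = i then Poly_Mapping.single (e j) c else 0) + (if k = j then Poly_Mapping.single (e i) c else 0)"
  proof (cases "k = i")
    case i: True
    show ?thesis
    proof (cases "k = j")
      case True
      have "Poly_Mapping.single (e k) c + Poly_Mapping.single (e k) c = Poly_Mapping.single (e k) (2 * c)"
        by (simp only: single_add[symmetric] mult_2)
      then show ?thesis
        unfolding pd_single e_def[symmetric] lk i[symmetric] True[symmetric] d by simp
    next
      case False
      then show ?thesis
        unfolding pd_single e_def[symmetric] lk i[symmetric] d by simp
    qed
  next
    case False
    show ?thesis
    proof (cases "k = j")
      case True
      then show ?thesis
        unfolding pd_single e_def[symmetric] lk True[symmetric] d using False by simp
    next
      case F: False
      then show ?thesis
        unfolding pd_single e_def[symmetric] lk using False by simp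
    qed
  qed
  then show ?thesis by (simp only: e_def)
qed

lemma pd_momentum_poly:
  assumes "A \<in> sp4"
  shows "pd k (momentum_poly A) = (\<Sum>j\<in>UNIV. Poly_Mapping.single (Poly_Mapping.single j 1) (- (Omega ** A) $ k $ j))"
proof -
  define S where "S = transpose A ** Omega"
  have S: "S = - (Omega ** A)"
    using assms by (simp add: sp4_def S_def eq_neg_iff_add_eq_0)
  have "transpose S = - (Omega ** A)"
    by (simp only: S_def matrix_transpose_mul transpose_Omega transpose_transpose matrix_uminus_left)
  then have "transpose S = S"
    by (simp only: S)
  then have "transpose S $ k $ i = S $ k $ i" for i k
    by simp
  then have sym: "S $ i $ k = S $ k $ i" for i k
    by (simp add: transpose_def)
  have "pd k (momentum_poly A)
      = (\<Sum>i\<in>UNIV. \<Sum>j\<in>UNIV. if k = i then Poly_Mapping.single (Poly_Mapping.single j 1) (S $ i $ j / 2) else 0)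
        + (\<Sum>i\<in>UNIV. \<Sum>j\<in>UNIV. if k = j then Poly_Mapping.single (Poly_Mapping.single i 1) (S $ i $ j / 2) else 0)"
    by (simp only: momentum_poly_def S_def pd_sum pd_quadratic sum.distrib)
  also have "(\<Sum>i\<in>UNIV. \<Sum>j\<in>UNIV. if k = i then Poly_Mapping.single (Poly_Mapping.single j 1) (S $ i $ j / 2) else 0)
      = (\<Sum>j\<in>UNIV. \<Sum>i\<in>UNIV. if k = i then Poly_Mapping.single (Poly_Mapping.single j (1::nat)) (S $ i $ j / 2) else 0)"
    by (rule sum.swap)
  also have "\<dots> = (\<Sum>j\<in>UNIV. Poly_Mapping.single (Poly_Mapping.single j 1) (S $ k $ j / 2))"
    by (simp only: sum.delta sum.delta' finite UNIV_I if_True)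
  also have "(\<Sum>i\<in>UNIV. \<Sum>j\<in>UNIV. if k = j then Poly_Mapping.single (Poly_Mapping.single i 1) (S $ i $ j / 2) else 0)
      = (\<Sum>i\<in>UNIV. Poly_Mapping.single (Poly_Mapping.single i (1::nat)) (S $ k $ i / 2))"
    by (simp only: sum.delta sum.delta' finite UNIV_I if_True sym)
  also have "(\<Sum>j\<in>UNIV. Poly_Mapping.single (Poly_Mapping.single j (1::nat)) (S $ k $ j / 2))
        + (\<Sum>i\<in>UNIV. Poly_Mapping.single (Poly_Mapping.single i 1) (S $ k $ i / 2))
      = (\<Sum>j\<in>UNIV. Poly_Mapping.single (Poly_Mapping.single j 1) (S $ k $ j))"
    by (simp only: sum.distrib[symmetric] single_add[symmetric] field_sum_of_halves)
  finally show ?thesis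
    by (simp only: S uminus_vec_def vec_lambda_beta vector_uminus_component)
qed

lemma poisson_momentum:
  assumes "A \<in> sp4"
  shows "poisson (pvar i) (momentum_poly A) = (\<Sum>j\<in>UNIV. Poly_Mapping.single (Poly_Mapping.single j 1) (A $ i $ j))"
proof -
  have "\<forall>i. poisson (pvar i) (momentum_poly A) = (\<Sum>j\<in>UNIV. Poly_Mapping.single (Poly_Mapping.single j 1) (A $ i $ j))"
    unfolding forall_4 poisson_def pd_pvar pd_momentum_poly[OF assms]
    by (simp add: Omega_mult single_uminus sum_negf)
  then show ?thesis ..
qed

lemma mdeg_0_iff: "mdeg m = 0 \<longleftrightarrow> m = 0"
  by (auto simp: mdeg_def poly_mapping_eq_iff fun_eq_iff)

lemma mdeg_SucE:
  assumes "mdeg m = Suc k"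
  obtains a m' where "m = m' + Poly_Mapping.single a 1" "mdeg m' = k"
proof -
  obtain a where a: "Poly_Mapping.lookup m a \<noteq> 0"
    using assms by (auto simp: mdeg_def dest!: sum_SucD)
  have m: "m = (m - Poly_Mapping.single a 1) + Poly_Mapping.single a 1"
    using a by (auto intro!: poly_mapping_eqI simp: lookup_add lookup_minus lookup_single when_def)
  moreover have "mdeg (m - Poly_Mapping.single a 1) = k"
    using arg_cong[OF m, of mdeg] assms by (simp add: mdeg_add mdeg_single del: diff_add)
  ultimately show thesis by (rule that)
qed

lemma single_add_single_eq_iff:
  fixes a b i j :: 4
  shows "Poly_Mapping.single i (1::nat) + Poly_Mapping.single j 1 = Poly_Mapping.single a 1 + Poly_Mapping.single b 1
     \<longleftrightarrow> (i, j) \<in> {(a, b), (b, a)}" (is "?l = ?r \<longleftrightarrow> _")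
proof
  assume "?l = ?r"
  then have eq: "Poly_Mapping.lookup ?l k = Poly_Mapping.lookup ?r k" for k
    by simp
  from eq[of i] eq[of j] eq[of a] eq[of b] show "(i, j) \<in> {(a, b), (b, a)}"
    by (auto simp: lookup_add lookup_single when_def split: if_splits)
qed (auto simp: add.commute)

lemma momentum_image: "momentum ` sp4 = {q. homogeneous 2 q}"
proof (intro equalityI subsetI)
  fix q assume "q \<in> {q. homogeneous 2 q}"
  then have q: "mdeg m = 2" if "m \<in> Poly_Mapping.keys (poly_of_ham q)" for m
    using that by (auto simp: homogeneous_def)
  define c where "c = Poly_Mapping.lookup (poly_of_ham q)"
  define S where "S = (\<chi> i j. (if i = j then 2 else 1) * c (Poly_Mapping.single i 1 + Poly_Mapping.single j 1))"
  define A where "A = Omega ** S"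
  have "transpose S = S"
    by (auto simp: vec_eq_iff transpose_def S_def add.commute)
  moreover have "(S ** Omega) ** Omega = - S"
    by (simp only: matrix_mul_assoc[symmetric] Omega_Omega1 matrix_uminus_right matrix_mul_rid)
  ultimately have S: "transpose A ** Omega = S"
    by (simp add: A_def matrix_transpose_mul transpose_Omega matrix_uminus_left matrix_uminus_right)
  then have "A \<in> sp4"
    by (simp add: sp4_def Omega_Omega A_def)
  moreover have "Poly_Mapping.lookup (momentum_poly A) m = c m" for m
  proof (cases "mdeg m = 2")
    case False
    then have "m \<notin> Poly_Mapping.keys (momentum_poly A)" "m \<notin> Poly_Mapping.keys (poly_of_ham q)"
      using mdeg_momentum_poly q by blast+
    then show ?thesis
      by (simp add: in_keys_iff c_def)
  next
    case True
    then obtain a m' where 1: "m = m' + Poly_Mapping.single a 1" "mdeg m' = Suc 0"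
      by (auto simp: numeral_2_eq_2 elim: mdeg_SucE)
    from 1(2) obtain b m'' where 2: "m' = m'' + Poly_Mapping.single b 1" "mdeg m'' = 0"
      by (rule mdeg_SucE)
    have m: "m = Poly_Mapping.single b 1 + Poly_Mapping.single a 1"
      using 1(1) 2 by (simp add: mdeg_0_iff)
    have "Poly_Mapping.lookup (momentum_poly A) m
        = (\<Sum>i\<in>UNIV. \<Sum>j\<in>UNIV. if (i, j) \<in> {(b, a), (a, b)} then S $ i $ j / 2 else 0)"
      unfolding momentum_poly_def S lookup_sum lookup_single when_def m single_add_single_eq_iff ..
    also have "\<dots> = (\<Sum>p\<in>UNIV. if p \<in> {(b, a), (a, b)} then S $ fst p $ snd p / 2 else 0)"
      unfolding UNIV_Times_UNIV[symmetric] sum.cartesian_product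
      by (rule sum.cong[OF refl]) (simp only: case_prod_beta prod.collapse)
    also have "\<dots> = (\<Sum>p\<in>{(b, a), (a, b)}. S $ fst p $ snd p / 2)"
      by (rule sum.mono_neutral_cong_right) auto
    also have "\<dots> = c m"
    proof (cases "a = b")
      case True
      then show ?thesis
        by (simp add: S_def m)
    next
      case False
      then have "(b, a) \<noteq> (a, b)" by simp
      then show ?thesis
        using False by (simp add: S_def m add.commute[of "Poly_Mapping.single a (Suc 0)"])
    qed
    finally show ?thesis .
  qed
  then have "momentum_poly A = poly_of_ham q"
    by (intro poly_mapping_eqI) (simp add: c_def)
  then have "q = momentum A"
    by (simp add: momentum_def poly_of_ham_inverse)
  ultimately show "q \<in> momentum ` sp4"
    by blast
qed (auto simp: homogeneous_def poly_of_momentum dest: mdeg_momentum_poly)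


section \<open>Cochains\<close>

instantiation "fun" :: (type, real_vector) real_vector
begin

definition scaleR_fun_def: "scaleR c f = (\<lambda>x. scaleR c (f x))"

instance
  by standard (auto simp: scaleR_fun_def fun_eq_iff algebra_simps)

end

lemma scaleR_fun_apply [simp]: "(c *\<^sub>R f) x = c *\<^sub>R f x"
  by (simp add: scaleR_fun_def)

text \<open>A cochain of degree \<open>m\<close> is represented by its value on lists of arguments; it vanishes on lists
  whose length is not \<open>m\<close>, so that the cochains of all degrees live in one vector space.\<close>

type_synonym cochain = "ham list \<Rightarrow> real"

definition unit_cochain :: cochain
  where "unit_cochain fs = (if fs = [] then 1 else 0)"

definition one_cochain :: "(ham \<Rightarrow> real) \<Rightarrow> cochain"
  where "one_cochain z fs = (if length fs = 1 then z (hd fs) else 0)"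

text \<open>The exterior product is the sum over shuffles: \<open>I\<close> is the set of positions of the arguments
  given to \<open>\<alpha>\<close>, and the sign is that of the corresponding shuffle.\<close>

definition wedge :: "cochain \<Rightarrow> cochain \<Rightarrow> cochain"
  where "wedge \<alpha> \<beta> fs = (\<Sum>I\<in>Pow {..<length fs}.
           (- 1) ^ card {(i, j). i \<in> I \<and> j \<in> {..<length fs} - I \<and> j < i} * \<alpha> (nths fs I) * \<beta> (nths fs (- I)))"

definition wedge_list :: "(ham \<Rightarrow> real) list \<Rightarrow> cochain"
  where "wedge_list zs = foldr (\<lambda>z. wedge (one_cochain z)) zs unit_cochain"

definition interior_product :: "ham \<Rightarrow> cochain \<Rightarrow> cochain"
  where "interior_product f \<sigma> fs = \<sigma> (f # fs)"

text \<open>This is the antiderivation determined on \<open>1\<close>-cochains by \<open>(d z)(f, g) = - \<langle>z, {f, g}\<rangle>\<close>: see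
  \<open>coboundary_linear\<close>, \<open>coboundary_unit\<close>, \<open>coboundary_one_cochain\<close> and \<open>coboundary_wedge\<close>.\<close>

definition coboundary :: "cochain \<Rightarrow> cochain"
  where "coboundary \<sigma> fs = (\<Sum>(i, j)\<in>{(i, j). i < j \<and> j < length fs}.
           (- 1) ^ (i + j) * \<sigma> (bracket (fs ! i) (fs ! j) # nths fs (- {i, j})))"

text \<open>\<open>S\<^sub>l\<close>, the dual of the homogeneous polynomials of degree \<open>l\<close>: functionals are extended by zero to
  the other homogeneous components of \<open>ham\<close>.\<close>

definition dual_hom :: "nat \<Rightarrow> (ham \<Rightarrow> real) set"
  where "dual_hom l = {z. linear z \<and> (\<forall>k f. k \<noteq> l \<longrightarrow> homogeneous k f \<longrightarrow> z f = 0)}"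

text \<open>A list \<open>ks\<close> stands for the sequence \<open>(k\<^sub>2, k\<^sub>3, \<dots>)\<close>, i.e. \<open>ks ! i\<close> is \<open>k\<^bsub>i+2\<^esub>\<close> and its weight is
  \<open>i\<close>. Sequences that differ only by trailing zeros give the same block, hence \<open>cochains m w\<close>, written
  as a sum of subspaces, is the direct sum over the sequences without trailing zeros.\<close>

definition factor_degrees :: "nat list \<Rightarrow> nat list"
  where "factor_degrees ks = concat (map (\<lambda>i. replicate (ks ! i) (i + 2)) [0..<length ks])"

definition ext_block :: "nat list \<Rightarrow> cochain set"
  where "ext_block ks = span {wedge_list zs | zs. list_all2 (\<lambda>z l. z \<in> dual_hom l) zs (factor_degrees ks)}"

definition cochains :: "nat \<Rightarrow> nat \<Rightarrow> cochain set"
  where "cochains m w = span (\<Union>{ext_block ks | ks.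
           sum_list ks = m \<and> (\<Sum>i<length ks. ks ! i * i) = w})"

definition rel_cochains :: "nat \<Rightarrow> nat \<Rightarrow> cochain set"
  where "rel_cochains m w = {\<sigma> \<in> cochains m w. \<forall>\<xi>\<in>sp4.
           interior_product (momentum \<xi>) \<sigma> = 0 \<and> interior_product (momentum \<xi>) (coboundary \<sigma>) = 0}"

text \<open>Only finitely many terms are nonzero, by \<open>rel_cochains_trivial\<close> below, and the dimensions are
  finite, by \<open>rel_cochains_finite_dim\<close>.\<close>

definition euler_number :: "nat \<Rightarrow> int"
  where "euler_number w = Sum_any (\<lambda>m. (- 1) ^ m * int (dim (rel_cochains m w)))"


subsection \<open>The coboundary operator is an antiderivation\<close>

definition sgn_cochain :: "cochain \<Rightarrow> cochain"
  where "sgn_cochain \<alpha> fs = (- 1) ^ length fs * \<alpha> fs"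

lemma wedge_Nil: "wedge \<alpha> \<beta> [] = \<alpha> [] * \<beta> []"
  by (simp add: wedge_def)

lemma wedge_Cons:
  "wedge \<alpha> \<beta> (f # fs)
     = wedge (interior_product f \<alpha>) \<beta> fs + wedge (sgn_cochain \<alpha>) (interior_product f \<beta>) fs"
proof -
  define n where "n = length fs"
  define inv where "inv m I = {(i, j). i \<in> I \<and> j \<in> {..<m} - I \<and> j < i}" for m and I :: "nat set"
  define T where "T I = (- 1) ^ card (inv (Suc n) I) * \<alpha> (nths (f # fs) I) * \<beta> (nths (f # fs) (- I))" for I
  have fin: "finite (inv m I)" if "I \<subseteq> {..<m}" for m I
    by (rule finite_subset[of _ "{..<m} \<times> {..<m}"]) (use that in \<open>auto simp: inv_def\<close>)
  have card_inv: "card (map_prod Suc Suc ` X) = card X" for X :: "(nat \<times> nat) set"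
    by (rule card_image) (auto simp: inj_on_def)
  let ?A = "(\<lambda>I. insert 0 (Suc ` I)) ` Pow {..<n}" and ?B = "(\<lambda>I. Suc ` I) ` Pow {..<n}"
  have "Pow {..<Suc n} = ?A \<union> ?B"
    unfolding lessThan_Suc_eq_insert_0 Pow_insert image_Pow_surj[OF refl, symmetric]
    by (auto simp: image_image)
  moreover have "?A \<inter> ?B = {}"
    by auto
  ultimately have "sum T (Pow {..<Suc n}) = sum T ?A + sum T ?B"
    by (simp add: sum.union_disjoint)
  also have "sum T ?A = (\<Sum>I\<in>Pow {..<n}. T (insert 0 (Suc ` I)))"
    by (rule sum.reindex[unfolded o_def]) (auto simp: inj_on_def dest!: insert_ident[THEN iffD1, rotated 2])
  also have "sum T ?B = (\<Sum>I\<in>Pow {..<n}. T (Suc ` I))"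
    by (rule sum.reindex[unfolded o_def]) (auto simp: inj_on_def inj_image_eq_iff)
  also have "(\<Sum>I\<in>Pow {..<n}. T (insert 0 (Suc ` I))) = wedge (interior_product f \<alpha>) \<beta> fs"
    unfolding wedge_def n_def[symmetric]
  proof (rule sum.cong[OF refl])
    fix I assume I: "I \<in> Pow {..<n}"
    have "inv (Suc n) (insert 0 (Suc ` I)) = map_prod Suc Suc ` inv n I"
    proof (intro equalityI subsetI)
      fix x assume x: "x \<in> inv (Suc n) (insert 0 (Suc ` I))"
      then obtain i j where ij: "x = (i, j)" "j < i" "j \<noteq> 0" "i \<in> Suc ` I" "j < Suc n" "j \<notin> Suc ` I"
        by (auto simp: inv_def)
      then obtain i' j' where "i = Suc i'" "j = Suc j'" by (metis imageE not0_implies_Suc)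
      with ij show "x \<in> map_prod Suc Suc ` inv n I"
        by (intro image_eqI[of _ _ "(i', j')"]) (auto simp: inv_def)
    qed (auto simp: inv_def)
    then have "card (inv (Suc n) (insert 0 (Suc ` I))) = card (inv n I)"
      by (simp add: card_inv)
    moreover have "{j. \<forall>x\<in>I. j \<noteq> x} = {x. x \<notin> I}"
      by auto
    ultimately show "T (insert 0 (Suc ` I)) = (- 1) ^ card {(i, j). i \<in> I \<and> j \<in> {..<n} - I \<and> j < i}
        * interior_product f \<alpha> (nths fs I) * \<beta> (nths fs (- I))"
      by (simp add: T_def nths_Cons interior_product_def inv_def image_iff Compl_eq)
  qed
  also have "(\<Sum>I\<in>Pow {..<n}. T (Suc ` I)) = wedge (sgn_cochain \<alpha>) (interior_product f \<beta>) fs"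
    unfolding wedge_def n_def[symmetric]
  proof (rule sum.cong[OF refl])
    fix I assume I: "I \<in> Pow {..<n}"
    have inv_eq: "inv (Suc n) (Suc ` I) = (\<lambda>i. (Suc i, 0)) ` I \<union> map_prod Suc Suc ` inv n I"
    proof (intro equalityI subsetI)
      fix x assume "x \<in> inv (Suc n) (Suc ` I)"
      then obtain i j where ij: "x = (i, j)" "j < i" "i \<in> Suc ` I" "j < Suc n" "j \<notin> Suc ` I"
        by (auto simp: inv_def)
      then show "x \<in> (\<lambda>i. (Suc i, 0)) ` I \<union> map_prod Suc Suc ` inv n I"
      proof (cases j)
        case (Suc j')
        from ij obtain i' where "i = Suc i'" by auto
        with ij Suc show ?thesis
          by (intro UnI2 image_eqI[of _ _ "(i', j')"]) (auto simp: inv_def)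
      qed auto
    qed (auto simp: inv_def)
    have "finite I" using I finite_subset by auto
    have "card (inv (Suc n) (Suc ` I)) = card ((\<lambda>i. (Suc i, 0::nat)) ` I) + card (map_prod Suc Suc ` inv n I)"
      unfolding inv_eq using I fin \<open>finite I\<close> by (intro card_Un_disjoint) auto
    also have "\<dots> = card I + card (inv n I)"
      by (simp add: card_image inj_on_def card_inv)
    finally have c: "card (inv (Suc n) (Suc ` I)) = card I + card (inv n I)" .
    have "{i. i < n \<and> i \<in> I} = I" using I by auto
    then have "length (nths fs I) = card I"
      by (simp add: length_nths n_def)
    moreover have "{j. \<forall>x\<in>I. j \<noteq> x} = {x. x \<notin> I}"
      by auto
    ultimately show "T (Suc ` I) = (- 1) ^ card {(i, j). i \<in> I \<and> j \<in> {..<n} - I \<and> j < i}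
        * sgn_cochain \<alpha> (nths fs I) * interior_product f \<beta> (nths fs (- I))"
      unfolding T_def c
      by (simp add: nths_Cons interior_product_def inv_def image_iff Compl_eq sgn_cochain_def power_add)
  qed
  finally show ?thesis
    by (simp add: wedge_def T_def inv_def n_def)
qed

lemma wedge_add_left: "wedge (\<alpha> + \<alpha>') \<beta> = wedge \<alpha> \<beta> + wedge \<alpha>' \<beta>"
  by (auto simp: fun_eq_iff wedge_def algebra_simps sum.distrib)

lemma wedge_add_right: "wedge \<alpha> (\<beta> + \<beta>') = wedge \<alpha> \<beta> + wedge \<alpha> \<beta>'"
  by (auto simp: fun_eq_iff wedge_def algebra_simps sum.distrib)

lemma wedge_scaleR_left: "wedge (c *\<^sub>R \<alpha>) \<beta> = c *\<^sub>R wedge \<alpha> \<beta>"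
  by (auto simp: fun_eq_iff wedge_def sum_distrib_left mult_ac)

lemma wedge_scaleR_right: "wedge \<alpha> (c *\<^sub>R \<beta>) = c *\<^sub>R wedge \<alpha> \<beta>"
  by (auto simp: fun_eq_iff wedge_def sum_distrib_left mult_ac)

lemma wedge_diff_left: "wedge (\<alpha> - \<alpha>') \<beta> = wedge \<alpha> \<beta> - wedge \<alpha>' \<beta>"
  using wedge_add_left[of "\<alpha> - \<alpha>'" \<alpha>' \<beta>] by simp

lemma wedge_diff_right: "wedge \<alpha> (\<beta> - \<beta>') = wedge \<alpha> \<beta> - wedge \<alpha> \<beta>'"
  using wedge_add_right[of \<alpha> "\<beta> - \<beta>'" \<beta>'] by simp

lemma wedge_minus_left: "wedge (- \<alpha>) \<beta> = - wedge \<alpha> \<beta>"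
  using wedge_scaleR_left[of "-1" \<alpha> \<beta>] by simp

lemma sgn_sgn_cochain: "sgn_cochain (sgn_cochain \<alpha>) = \<alpha>"
  by (simp add: fun_eq_iff sgn_cochain_def flip: power_add mult.assoc)

definition choose1 :: "(ham \<Rightarrow> cochain) \<Rightarrow> cochain"
  where "choose1 G fs = (\<Sum>j<length fs. (- 1) ^ j * G (fs ! j) (nths fs (- {j})))"

definition choose2 :: "(ham \<Rightarrow> ham \<Rightarrow> cochain) \<Rightarrow> cochain"
  where "choose2 F fs = (\<Sum>(i, j)\<in>{(i, j). i < j \<and> j < length fs}.
           (- 1) ^ (i + j) * F (fs ! i) (fs ! j) (nths fs (- {i, j})))"

lemma coboundary_choose2: "coboundary \<sigma> = choose2 (\<lambda>u v. interior_product (bracket u v) \<sigma>)"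
  by (simp add: fun_eq_iff coboundary_def choose2_def interior_product_def)

lemma choose1_Nil: "choose1 G [] = 0"
  by (simp add: choose1_def)

lemma choose2_Nil: "choose2 F [] = 0"
  by (simp add: choose2_def)

lemma choose1_Cons: "choose1 G (f # fs) = G f fs - choose1 (\<lambda>u. interior_product f (G u)) fs"
proof -
  have "nths (f # fs) (- {0}) = fs"
    by (simp add: nths_Cons nths_all)
  then show ?thesis
    by (simp add: choose1_def sum.lessThan_Suc_shift nths_Cons interior_product_def sum_negf Compl_eq
             del: sum.lessThan_Suc)
qed

lemma choose2_Cons:
  "choose2 F (f # fs) = choose2 (\<lambda>u v. interior_product f (F u v)) fs - choose1 (F f) fs"
proof -
  define n where "n = length fs"
  define T where "T = (\<lambda>(i, j). (- 1) ^ (i + j) * F ((f # fs) ! i) ((f # fs) ! j) (nths (f # fs) (- {i, j})))"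
  let ?P = "\<lambda>n. {(i, j). i < j \<and> j < n} :: (nat \<times> nat) set"
  have eq: "?P (Suc n) = (\<lambda>j. (0, Suc j)) ` {..<n} \<union> map_prod Suc Suc ` ?P n"
  proof (intro equalityI subsetI)
    fix x assume "x \<in> ?P (Suc n)"
    then obtain i j where x: "x = (i, Suc j)" "i < Suc j" "j < n"
      by (auto elim: less_natE)
    then show "x \<in> (\<lambda>j. (0, Suc j)) ` {..<n} \<union> map_prod Suc Suc ` ?P n"
    proof (cases i)
      case (Suc i')
      with x show ?thesis by (intro UnI2 image_eqI[of _ _ "(i', j)"]) auto
    qed auto
  qed auto
  have fin: "finite (?P n)" for n
    by (rule finite_subset[of _ "{..<n} \<times> {..<n}"]) auto
  have "choose2 F (f # fs) = sum T (?P (Suc n))"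
    by (simp add: choose2_def T_def n_def)
  also have "\<dots> = sum T ((\<lambda>j. (0, Suc j)) ` {..<n}) + sum T (map_prod Suc Suc ` ?P n)"
    unfolding eq using fin by (intro sum.union_disjoint) auto
  also have "sum T ((\<lambda>j. (0, Suc j)) ` {..<n}) = (\<Sum>j<n. T (0, Suc j))"
    by (rule sum.reindex[unfolded o_def]) (auto simp: inj_on_def)
  also have "\<dots> = - choose1 (F f) fs"
    by (simp add: T_def choose1_def n_def nths_Cons Compl_eq sum_negf)
  also have "sum T (map_prod Suc Suc ` ?P n) = (\<Sum>p\<in>?P n. T (map_prod Suc Suc p))"
    by (rule sum.reindex[unfolded o_def]) (auto simp: inj_on_def)
  also have "\<dots> = choose2 (\<lambda>u v. interior_product f (F u v)) fs"
    unfolding choose2_def n_def[symmetric]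
    by (rule sum.cong) (auto simp: T_def nths_Cons interior_product_def Compl_eq)
  finally show ?thesis by simp
qed

lemma interior_choose1: "interior_product f (choose1 G) = G f - choose1 (\<lambda>u. interior_product f (G u))"
  by (simp add: fun_eq_iff interior_product_def choose1_Cons)

lemma interior_choose2:
  "interior_product f (choose2 F) = choose2 (\<lambda>u v. interior_product f (F u v)) - choose1 (F f)"
  by (simp add: fun_eq_iff interior_product_def choose2_Cons)

lemma interior_wedge:
  "interior_product f (wedge \<alpha> \<beta>)
     = wedge (interior_product f \<alpha>) \<beta> + wedge (sgn_cochain \<alpha>) (interior_product f \<beta>)"
  by (simp add: fun_eq_iff interior_product_def wedge_Cons)

lemma interior_sgn: "interior_product f (sgn_cochain \<alpha>) = - sgn_cochain (interior_product f \<alpha>)"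
  by (simp add: fun_eq_iff interior_product_def sgn_cochain_def)

lemma sgn_choose1: "sgn_cochain (choose1 G) = - choose1 (\<lambda>u. sgn_cochain (G u))"
proof
  fix fs :: "ham list"
  have "length (nths fs (- {j})) = length fs - 1" if "j < length fs" for j
  proof -
    have "{i. i < length fs \<and> i \<in> - {j}} = {..<length fs} - {j}" by auto
    then show ?thesis using that by (simp add: length_nths)
  qed
  moreover have "(- 1) ^ length fs = - ((- 1) ^ (length fs - 1) :: real)" if "j < length fs" for j
    using that by (cases "length fs") auto
  ultimately show "sgn_cochain (choose1 G) fs = (- choose1 (\<lambda>u. sgn_cochain (G u))) fs"
    by (auto simp: sgn_cochain_def choose1_def sum_distrib_left sum_negf[symmetric] intro!: sum.cong)
qed

lemma length_nths_2:
  assumes "i < j" "j < length fs"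
  shows "length (nths fs (- {i, j})) = length fs - 2"
proof -
  have "{k. k < length fs \<and> k \<in> - {i, j}} = {..<length fs} - {i, j}" by auto
  then show ?thesis
    using assms by (simp add: length_nths card_Diff_subset)
qed

lemma sgn_choose2: "sgn_cochain (choose2 F) = choose2 (\<lambda>u v. sgn_cochain (F u v))"
proof
  fix fs :: "ham list"
  have "(- 1) ^ length (nths fs (- {i, j})) = ((- 1) ^ length fs :: real)" if "i < j" "j < length fs" for i j
  proof -
    have e: "length fs = Suc (Suc (length fs - 2))"
      using that by linarith
    have "(- 1) ^ length fs = ((- 1) ^ (length fs - 2) :: real)"
      by (subst e) simp
    then show ?thesis using that by (simp add: length_nths_2)
  qed
  then show "sgn_cochain (choose2 F) fs = choose2 (\<lambda>u v. sgn_cochain (F u v)) fs"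
    by (auto simp: sgn_cochain_def choose2_def sum_distrib_left intro!: sum.cong)
qed

lemma choose1_add: "choose1 (\<lambda>u. G u + H u) = choose1 G + choose1 H"
  by (simp add: fun_eq_iff choose1_def algebra_simps sum.distrib)

lemma choose1_minus: "choose1 (\<lambda>u. - G u) = - choose1 G"
  by (simp add: fun_eq_iff choose1_def sum_negf)

lemma choose2_add: "choose2 (\<lambda>u v. F u v + H u v) = choose2 F + choose2 H"
  by (simp add: fun_eq_iff choose2_def algebra_simps sum.distrib case_prod_beta)

lemma choose1_wedge_left: "wedge (choose1 G) \<beta> fs = choose1 (\<lambda>u. wedge (G u) \<beta>) fs"
proof (induction fs arbitrary: G \<beta>)
  case (Cons f fs)
  then show ?case
    by (simp add: wedge_Cons choose1_Cons interior_choose1 sgn_choose1 wedge_diff_left wedge_minus_left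
        interior_wedge choose1_add)
qed (simp add: wedge_Nil choose1_Nil)

lemma choose1_wedge_right: "wedge (sgn_cochain \<alpha>) (choose1 G) fs = choose1 (\<lambda>u. wedge \<alpha> (G u)) fs"
proof (induction fs arbitrary: G \<alpha>)
  case (Cons f fs)
  from Cons[of "sgn_cochain \<alpha>"] Cons[of "interior_product f \<alpha>"] show ?case
    by (simp add: wedge_Cons choose1_Cons interior_choose1 wedge_diff_right wedge_minus_left
        interior_wedge choose1_add interior_sgn sgn_sgn_cochain)
qed (simp add: wedge_Nil choose1_Nil)

lemma choose2_wedge_left: "wedge (choose2 F) \<beta> fs = choose2 (\<lambda>u v. wedge (F u v) \<beta>) fs"
proof (induction fs arbitrary: F \<beta>)
  case (Cons f fs)
  then show ?case
    by (simp add: wedge_Cons choose2_Cons interior_choose2 sgn_choose2 wedge_diff_left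
        interior_wedge choose2_add choose1_wedge_left)
qed (simp add: wedge_Nil choose2_Nil)

lemma choose2_wedge_right: "wedge \<alpha> (choose2 F) fs = choose2 (\<lambda>u v. wedge \<alpha> (F u v)) fs"
proof (induction fs arbitrary: F \<alpha>)
  case (Cons f fs)
  then show ?case
    by (simp add: wedge_Cons choose2_Cons interior_choose2 wedge_diff_right
        interior_wedge choose2_add choose1_wedge_right)
qed (simp add: wedge_Nil choose2_Nil)

lemma coboundary_wedge_sgn:
  "coboundary (wedge \<alpha> \<beta>) = wedge (coboundary \<alpha>) \<beta> + wedge (sgn_cochain \<alpha>) (coboundary \<beta>)"
  unfolding coboundary_choose2
  by (simp add: fun_eq_iff choose2_wedge_left choose2_wedge_right interior_wedge choose2_add)

lemma coboundary_wedge: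
  assumes "\<And>fs. length fs \<noteq> p \<Longrightarrow> \<alpha> fs = 0"
  shows "coboundary (wedge \<alpha> \<beta>) = wedge (coboundary \<alpha>) \<beta> + (- 1) ^ p *\<^sub>R wedge \<alpha> (coboundary \<beta>)"
proof -
  have "sgn_cochain \<alpha> fs = ((- 1) ^ p *\<^sub>R \<alpha>) fs" for fs
    using assms[of fs] by (cases "length fs = p") (simp_all add: sgn_cochain_def)
  then have "sgn_cochain \<alpha> = (- 1) ^ p *\<^sub>R \<alpha>"
    by blast
  then show ?thesis
    by (simp add: coboundary_wedge_sgn wedge_scaleR_left)
qed

lemma coboundary_one_cochain: "coboundary (one_cochain z) [f, g] = - z (bracket f g)"
proof -
  have "{(i, j). i < j \<and> j < Suc (Suc 0)} = {(0, 1)}"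
    by auto
  then show ?thesis
    by (simp add: coboundary_def one_cochain_def nths_Cons)
qed

lemma coboundary_one_cochain_eq_0: "length fs \<noteq> 2 \<Longrightarrow> coboundary (one_cochain z) fs = 0"
  by (auto simp: coboundary_def one_cochain_def length_nths_2 intro!: sum.neutral
      dest!: arg_cong[of _ "[]" length])

lemma coboundary_unit: "coboundary unit_cochain = 0"
  by (auto simp: fun_eq_iff coboundary_def unit_cochain_def)

lemma coboundary_linear: "linear coboundary"
  by (rule linearI)
     (auto simp: fun_eq_iff coboundary_def sum.distrib algebra_simps sum_distrib_left case_prod_beta)


subsection \<open>Finite dimensionality\<close>

definition mono_ham :: "monom4 \<Rightarrow> ham"
  where "mono_ham m = ham_of_poly (Poly_Mapping.single m 1)"

definition coef :: "monom4 \<Rightarrow> ham \<Rightarrow> real"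
  where "coef m f = Poly_Mapping.lookup (poly_of_ham f) m"

lemma poly_of_mono_ham: "2 \<le> mdeg m \<Longrightarrow> poly_of_ham (mono_ham m) = Poly_Mapping.single m 1"
  unfolding mono_ham_def by (rule ham_of_poly_inverse) simp

lemma homogeneous_mono_ham: "2 \<le> mdeg m \<Longrightarrow> homogeneous (mdeg m) (mono_ham m)"
  by (simp add: homogeneous_def poly_of_mono_ham)

lemma poly_of_ham_sum: "poly_of_ham (sum f A) = (\<Sum>a\<in>A. poly_of_ham (f a))"
  by (induction A rule: infinite_finite_induct) (simp_all add: zero_ham.rep_eq plus_ham.rep_eq)

lemma ham_expand:
  "f = (\<Sum>m\<in>Poly_Mapping.keys (poly_of_ham f). coef m f *\<^sub>R mono_ham m)" (is "f = ?r")
proof -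
  have ge: "2 \<le> mdeg m" if "m \<in> Poly_Mapping.keys (poly_of_ham f)" for m
    using poly_of_ham[of f] that by simp
  have "Poly_Mapping.lookup (poly_of_ham f) n = Poly_Mapping.lookup (poly_of_ham ?r) n" for n
  proof -
    have "Poly_Mapping.lookup (poly_of_ham ?r) n
        = (\<Sum>m\<in>Poly_Mapping.keys (poly_of_ham f). if m = n then coef m f else 0)"
      unfolding poly_of_ham_sum lookup_sum
      by (rule sum.cong) (simp_all add: scaleR_ham.rep_eq lookup_scaleR4 poly_of_mono_ham ge lookup_single when_def)
    also have "\<dots> = Poly_Mapping.lookup (poly_of_ham f) n"
      by (simp add: coef_def in_keys_iff)
    finally show ?thesis ..
  qed
  then show ?thesis
    by (metis poly_mapping_eqI poly_of_ham_inject)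
qed

lemma finite_mdeg_le: "finite {m. mdeg m \<le> N}"
proof (rule finite_imageD)
  have "Poly_Mapping.lookup m i \<le> N" if "mdeg m \<le> N" for m i
    using that member_le_sum[of i UNIV "Poly_Mapping.lookup m"] unfolding mdeg_def by simp
  then have "Poly_Mapping.lookup ` {m. mdeg m \<le> N} \<subseteq> (PiE UNIV (\<lambda>_. {..N}))"
    by auto
  then show "finite (Poly_Mapping.lookup ` {m. mdeg m \<le> N})"
    by (rule finite_subset) (simp add: finite_PiE)
qed (simp add: inj_on_def poly_mapping_eqI)

lemma dual_hom_expand:
  assumes "z \<in> dual_hom l" "2 \<le> l"
  shows "z = (\<Sum>m | mdeg m = l. z (mono_ham m) *\<^sub>R coef m)"
proof
  fix f
  have lin: "linear z" and z: "k \<noteq> l \<Longrightarrow> homogeneous k f \<Longrightarrow> z f = 0" for k f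
    using assms by (auto simp: dual_hom_def)
  let ?K = "Poly_Mapping.keys (poly_of_ham f)" and ?D = "{m. mdeg m = l}"
  have fin: "finite ?D"
    by (rule finite_subset[OF _ finite_mdeg_le[of l]]) auto
  have "z f = z (\<Sum>m\<in>?K. coef m f *\<^sub>R mono_ham m)"
    using ham_expand[of f] by simp
  also have "\<dots> = (\<Sum>m\<in>?K. coef m f * z (mono_ham m))"
    by (simp add: linear_sum[OF lin] linear_cmul[OF lin])
  also have "\<dots> = (\<Sum>m\<in>?K \<inter> ?D. coef m f * z (mono_ham m))"
  proof (rule sum.mono_neutral_right)
    show "\<forall>m\<in>?K - ?K \<inter> ?D. coef m f * z (mono_ham m) = 0"
    proof
      fix m assume m: "m \<in> ?K - ?K \<inter> ?D"
      then have "2 \<le> mdeg m" using poly_of_ham[of f] by simp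
      then show "coef m f * z (mono_ham m) = 0"
        using m z[OF _ homogeneous_mono_ham] by simp
    qed
  qed auto
  also have "\<dots> = (\<Sum>m\<in>?D. coef m f * z (mono_ham m))"
    by (rule sum.mono_neutral_left[OF fin]) (auto simp: coef_def in_keys_iff)
  also have "\<dots> = (\<Sum>m\<in>?D. z (mono_ham m) *\<^sub>R coef m) f"
    using fin by induction (simp_all add: algebra_simps)
  finally show "z f = (\<Sum>m\<in>?D. z (mono_ham m) *\<^sub>R coef m) f" .
qed

lemma linear_one_cochain: "linear one_cochain"
  by (rule linearI) (auto simp: fun_eq_iff one_cochain_def)

lemma linear_wedge_left: "linear (\<lambda>\<alpha>. wedge \<alpha> \<beta>)"
  by (rule linearI) (simp_all add: wedge_add_left wedge_scaleR_left)

lemma linear_wedge_right: "linear (wedge \<alpha>)"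
  by (rule linearI) (simp_all add: wedge_add_right wedge_scaleR_right)

lemma wedge_list_Nil: "wedge_list [] = unit_cochain"
  and wedge_list_Cons: "wedge_list (z # zs) = wedge (one_cochain z) (wedge_list zs)"
  by (simp_all add: wedge_list_def)

lemma wedge_list_span:
  assumes "list_all2 (\<lambda>z l. z \<in> dual_hom l) zs ls" "\<forall>l\<in>set ls. 2 \<le> l"
  shows "wedge_list zs \<in> span ((\<lambda>ms. wedge_list (map coef ms)) ` {ms. map mdeg ms = ls})"
  using assms
proof (induction zs ls rule: list_all2_induct)
  case Nil
  show ?case by (rule span_base) auto
next
  case (Cons z zs l ls)
  let ?S = "\<lambda>ls. (\<lambda>ms. wedge_list (map coef ms)) ` {ms. map mdeg ms = ls}"
  have IH: "wedge_list zs \<in> span (?S ls)"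
    using Cons by simp
  have z: "z = (\<Sum>m | mdeg m = l. z (mono_ham m) *\<^sub>R coef m)"
    using Cons by (intro dual_hom_expand) auto
  have "wedge (one_cochain (coef m)) (wedge_list zs) \<in> span (?S (l # ls))" if "mdeg m = l" for m
  proof -
    have "wedge (one_cochain (coef m)) (wedge_list zs) \<in> wedge (one_cochain (coef m)) ` span (?S ls)"
      using IH by blast
    also have "\<dots> = span (wedge (one_cochain (coef m)) ` ?S ls)"
      by (rule linear_span_image[OF linear_wedge_right, symmetric])
    also have "\<dots> \<subseteq> span (?S (l # ls))"
    proof (rule span_mono, rule image_subsetI)
      fix x assume "x \<in> ?S ls"
      then obtain ms where "x = wedge_list (map coef ms)" "map mdeg ms = ls" by auto
      then show "wedge (one_cochain (coef m)) x \<in> ?S (l # ls)"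
        using that by (intro image_eqI[of _ _ "m # ms"]) (auto simp: wedge_list_Cons)
    qed
    finally show ?thesis .
  qed
  moreover have "wedge_list (z # zs)
      = (\<Sum>m | mdeg m = l. z (mono_ham m) *\<^sub>R wedge (one_cochain (coef m)) (wedge_list zs))"
    unfolding wedge_list_Cons
    by (subst z) (simp add: linear_sum[OF linear_one_cochain] linear_cmul[OF linear_one_cochain]
        linear_sum[OF linear_wedge_left] wedge_scaleR_left)
  ultimately show ?case
    by (auto intro!: span_sum span_mul)
qed

lemma factor_degrees_bounds:
  assumes "l \<in> set (factor_degrees ks)"
  shows "2 \<le> l" "l \<le> (\<Sum>i<length ks. ks ! i * i) + 2"
proof -
  obtain i where i: "i < length ks" "l = i + 2" "ks ! i \<noteq> 0"
    using assms by (auto simp: factor_degrees_def)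
  have "i \<le> ks ! i * i" using i(3) by simp
  also have "\<dots> \<le> (\<Sum>i<length ks. ks ! i * i)"
    using i(1) by (intro member_le_sum) auto
  finally show "2 \<le> l" "l \<le> (\<Sum>i<length ks. ks ! i * i) + 2"
    using i(2) by auto
qed

lemma length_factor_degrees: "length (factor_degrees ks) = sum_list ks"
  by (simp add: factor_degrees_def length_concat o_def map_nth)

lemma weight_factor_degrees: "(\<Sum>l\<leftarrow>factor_degrees ks. int l - 2) = int (\<Sum>i<length ks. ks ! i * i)"
proof -
  have "(\<Sum>l\<leftarrow>concat (map (\<lambda>i. replicate (ks ! i) (i + 2)) xs). int l - 2) = (\<Sum>i\<leftarrow>xs. int (ks ! i * i))" for xs
    by (induction xs) (simp_all add: sum_list_replicate)
  then show ?thesis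
    by (simp add: factor_degrees_def interv_sum_list_conv_sum_set_nat atLeast0LessThan)
qed

lemma cochains_induct [consumes 1, case_names span]:
  assumes "\<sigma> \<in> cochains m w" and "subspace {\<sigma>. P \<sigma>}"
    and "\<And>zs ls. list_all2 (\<lambda>z l. z \<in> dual_hom l) zs ls \<Longrightarrow> length ls = m
        \<Longrightarrow> (\<Sum>l\<leftarrow>ls. int l - 2) = int w \<Longrightarrow> \<forall>l\<in>set ls. 2 \<le> l \<and> l \<le> w + 2 \<Longrightarrow> P (wedge_list zs)"
  shows "P \<sigma>"
proof -
  have "ext_block ks \<subseteq> {\<sigma>. P \<sigma>}" if ks: "sum_list ks = m" "(\<Sum>i<length ks. ks ! i * i) = w" for ks
    unfolding ext_block_def
  proof (rule span_minimal[OF _ assms(2)], safe)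
    fix zs assume "list_all2 (\<lambda>z l. z \<in> dual_hom l) zs (factor_degrees ks)"
    then show "P (wedge_list zs)"
      using ks factor_degrees_bounds[of _ ks]
      by (intro assms(3)) (auto simp: length_factor_degrees weight_factor_degrees)
  qed
  then have "cochains m w \<subseteq> {\<sigma>. P \<sigma>}"
    unfolding cochains_def by (intro span_minimal[OF _ assms(2)]) blast
  with assms(1) show ?thesis by blast
qed

lemma cochains_finite_dim: "\<exists>B. finite B \<and> cochains m w \<subseteq> span B"
proof (intro exI conjI subsetI)
  let ?M = "{ms. set ms \<subseteq> {n. mdeg n \<le> w + 2} \<and> length ms = m}"
  let ?B = "(\<lambda>ms. wedge_list (map coef ms)) ` ?M"
  show "finite ?B"
    by (intro finite_imageI finite_lists_length_eq finite_mdeg_le)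
  fix \<sigma> assume "\<sigma> \<in> cochains m w"
  then show "\<sigma> \<in> span ?B"
  proof (induction rule: cochains_induct)
    show "subspace {\<sigma>. \<sigma> \<in> span ?B}" by (simp add: subspace_span)
    fix zs ls
    assume zs: "list_all2 (\<lambda>z l. z \<in> dual_hom l) zs ls" and ls: "length ls = m"
      and le: "\<forall>l\<in>set ls. 2 \<le> l \<and> l \<le> w + 2"
    have "{ms. map mdeg ms = ls} \<subseteq> ?M"
      using ls le by auto
    then show "wedge_list zs \<in> span ?B"
      using wedge_list_span[OF zs] le span_mono[OF image_mono] by blast
  qed
qed

lemma rel_cochains_finite_dim: "\<exists>B. finite B \<and> rel_cochains m w \<subseteq> span B"
  using cochains_finite_dim[of m w] unfolding rel_cochains_def by blast

lemma subspace_rel_cochains: "subspace (rel_cochains m w)"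
proof -
  have lin: "linear (\<lambda>\<sigma>. interior_product f (coboundary \<sigma>))" "linear (interior_product f)" for f
    by (auto intro!: linearI simp: fun_eq_iff interior_product_def linear_add[OF coboundary_linear]
        linear_cmul[OF coboundary_linear])
  show ?thesis
    unfolding subspace_def rel_cochains_def cochains_def
    by (auto simp: linear_0[OF lin(1)] linear_0[OF lin(2)] linear_add[OF lin(1)] linear_add[OF lin(2)]
        linear_cmul[OF lin(1)] linear_cmul[OF lin(2)] span_zero span_add span_mul)
qed


subsection \<open>Relative cochains of degree greater than the weight vanish\<close>

definition multilinear :: "cochain \<Rightarrow> bool"
  where "multilinear \<sigma> \<longleftrightarrow> (\<forall>xs ys. linear (\<lambda>f. \<sigma> (xs @ f # ys)))"

definition alternating :: "cochain \<Rightarrow> bool"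
  where "alternating \<sigma> \<longleftrightarrow> (\<forall>xs f g ys. \<sigma> (xs @ f # g # ys) = - \<sigma> (xs @ g # f # ys))"

definition has_weight :: "int \<Rightarrow> cochain \<Rightarrow> bool"
  where "has_weight w \<sigma> \<longleftrightarrow> (\<forall>fs ls. list_all2 homogeneous ls fs \<longrightarrow> \<sigma> fs \<noteq> 0 \<longrightarrow> (\<Sum>l\<leftarrow>ls. int l - 2) = w)"

definition has_degree :: "nat \<Rightarrow> cochain \<Rightarrow> bool"
  where "has_degree m \<sigma> \<longleftrightarrow> (\<forall>fs. length fs \<noteq> m \<longrightarrow> \<sigma> fs = 0)"

lemma wedge_unit: "wedge unit_cochain \<beta> fs = \<beta> fs"
proof (induction fs arbitrary: \<beta>)
  case (Cons f fs)
  have "interior_product f unit_cochain = 0" "sgn_cochain unit_cochain = unit_cochain"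
    by (auto simp: fun_eq_iff interior_product_def unit_cochain_def sgn_cochain_def)
  then show ?case
    by (simp add: wedge_Cons linear_0[OF linear_wedge_left] Cons interior_product_def)
qed (simp add: wedge_Nil unit_cochain_def)

lemma wedge_one_Nil: "wedge (one_cochain z) \<beta> [] = 0"
  by (simp add: wedge_Nil one_cochain_def)

lemma wedge_one_Cons:
  "wedge (one_cochain z) \<beta> (f # fs) = z f * \<beta> fs - wedge (one_cochain z) (interior_product f \<beta>) fs"
proof -
  have "interior_product f (one_cochain z) = z f *\<^sub>R unit_cochain"
    "sgn_cochain (one_cochain z) = - one_cochain z"
    by (auto simp: fun_eq_iff interior_product_def unit_cochain_def one_cochain_def sgn_cochain_def)
  then show ?thesis
    by (simp add: wedge_Cons wedge_scaleR_left wedge_minus_left wedge_unit)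
qed

lemma interior_product_linear:
  assumes "multilinear \<beta>"
  shows "interior_product (f + g) \<beta> = interior_product f \<beta> + interior_product g \<beta>"
    "interior_product (c *\<^sub>R f) \<beta> = c *\<^sub>R interior_product f \<beta>"
proof -
  have lin: "linear (\<lambda>f. \<beta> (f # ys))" for ys
    using assms by (auto simp: multilinear_def dest: spec[of _ "[]"])
  show "interior_product (f + g) \<beta> = interior_product f \<beta> + interior_product g \<beta>"
    "interior_product (c *\<^sub>R f) \<beta> = c *\<^sub>R interior_product f \<beta>"
    by (simp_all add: fun_eq_iff interior_product_def linear_add[OF lin] linear_cmul[OF lin])
qed

lemma multilinear_wedge_one:
  assumes "linear z" "multilinear \<beta>"
  shows "multilinear (wedge (one_cochain z) \<beta>)"
proof -
  have "linear (\<lambda>f. wedge (one_cochain z) \<beta> (xs @ f # ys))" for xs ys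
    using assms(2)
  proof (induction xs arbitrary: \<beta>)
    case Nil
    then show ?case
      by (intro linearI) (simp_all add: wedge_one_Cons interior_product_linear wedge_add_right wedge_scaleR_right
          linear_add[OF assms(1)] linear_cmul[OF assms(1)] algebra_simps)
  next
    case (Cons x xs)
    have lin: "linear (\<lambda>f. \<beta> (xs @ f # ys))"
      using Cons.prems by (simp add: multilinear_def)
    have "multilinear (interior_product x \<beta>)"
      unfolding multilinear_def interior_product_def
    proof (intro allI)
      show "linear (\<lambda>f. \<beta> (x # xs @ f # ys))" for xs ys
        using Cons.prems[unfolded multilinear_def, rule_format, of "x # xs" ys] by simp
    qed
    then have lin': "linear (\<lambda>f. wedge (one_cochain z) (interior_product x \<beta>) (xs @ f # ys))"
      by (rule Cons.IH)
    show ?case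
      by (intro linearI) (simp_all add: wedge_one_Cons linear_add[OF lin] linear_add[OF lin']
          linear_cmul[OF lin] linear_cmul[OF lin'] algebra_simps)
  qed
  then show ?thesis by (simp add: multilinear_def)
qed

lemma alternating_wedge_one:
  assumes "alternating \<beta>"
  shows "alternating (wedge (one_cochain z) \<beta>)"
proof -
  have "wedge (one_cochain z) \<beta> (xs @ f # g # ys) = - wedge (one_cochain z) \<beta> (xs @ g # f # ys)" for xs f g ys
    using assms
  proof (induction xs arbitrary: \<beta>)
    case Nil
    have sw: "\<beta> (f # g # fs) = - \<beta> (g # f # fs)" for fs
      using Nil.prems[unfolded alternating_def, rule_format, of "[]" f g fs] by simp
    have "interior_product g (interior_product f \<beta>) = - interior_product f (interior_product g \<beta>)"
      using sw by (auto simp: fun_eq_iff interior_product_def)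
    then show ?case
      by (simp add: wedge_one_Cons linear_neg[OF linear_wedge_right]) (simp only: interior_product_def)
  next
    case (Cons x xs)
    have "alternating (interior_product x \<beta>)"
      unfolding alternating_def interior_product_def
    proof (intro allI)
      show "\<beta> (x # xs @ f # g # ys) = - \<beta> (x # xs @ g # f # ys)" for xs f g ys
        using Cons.prems[unfolded alternating_def, rule_format, of "x # xs" f g ys] by simp
    qed
    note IH = Cons.IH[OF this]
    have "\<beta> (xs @ f # g # ys) = - \<beta> (xs @ g # f # ys)"
      using Cons.prems unfolding alternating_def by blast
    then show ?case
      unfolding append_Cons wedge_one_Cons IH by simp
  qed
  then show ?thesis unfolding alternating_def by blast
qed

lemma has_weight_wedge_one:
  assumes "z \<in> dual_hom l" "has_weight w \<beta>"
  shows "has_weight (w + (int l - 2)) (wedge (one_cochain z) \<beta>)"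
proof -
  have "(\<Sum>l\<leftarrow>ls. int l - 2) = w + (int l - 2)"
    if "list_all2 homogeneous ls fs" "wedge (one_cochain z) \<beta> fs \<noteq> 0" for fs ls
    using that assms(2)
  proof (induction ls fs arbitrary: w \<beta> rule: list_all2_induct)
    case Nil
    then show ?case by (simp add: wedge_one_Nil)
  next
    case (Cons k ls f fs)
    have w: "(\<Sum>l\<leftarrow>ls. int l - 2) = w" if "\<beta> fs \<noteq> 0"
      using Cons.prems(2) Cons.hyps that unfolding has_weight_def by blast
    from Cons.prems(1) consider "z f \<noteq> 0" "\<beta> fs \<noteq> 0"
      | "wedge (one_cochain z) (interior_product f \<beta>) fs \<noteq> 0"
      unfolding wedge_one_Cons by fastforce
    then show ?case
    proof cases
      case 1
      then have "k = l"
        using assms(1) Cons.hyps by (auto simp: dual_hom_def)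
      then show ?thesis
        using w[OF 1(2)] by simp
    next
      case 2
      have "has_weight (w - (int k - 2)) (interior_product f \<beta>)"
        unfolding has_weight_def interior_product_def
      proof (intro allI impI)
        fix gs js assume "list_all2 homogeneous js gs" "\<beta> (f # gs) \<noteq> 0"
        then have "(\<Sum>l\<leftarrow>k # js. int l - 2) = w"
          using Cons.prems(2) Cons.hyps unfolding has_weight_def by blast
        then show "(\<Sum>l\<leftarrow>js. int l - 2) = w - (int k - 2)" by simp
      qed
      from Cons.IH[OF 2 this] show ?thesis by simp
    qed
  qed
  then show ?thesis unfolding has_weight_def by blast
qed

lemma has_degree_wedge_one:
  assumes "has_degree m \<beta>"
  shows "has_degree (Suc m) (wedge (one_cochain z) \<beta>)"
proof -
  have "wedge (one_cochain z) \<beta> fs = 0" if "length fs \<noteq> Suc m" for fs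
    using that assms
  proof (induction fs arbitrary: m \<beta>)
    case (Cons f fs)
    have 1: "\<beta> fs = 0"
      using Cons.prems by (simp add: has_degree_def)
    show ?case
    proof (cases m)
      case 0
      then have "interior_product f \<beta> = 0"
        using Cons.prems by (simp add: has_degree_def interior_product_def fun_eq_iff)
      then show ?thesis using 1
        by (simp add: wedge_one_Cons linear_0[OF linear_wedge_right])
    next
      case (Suc k)
      then have "has_degree k (interior_product f \<beta>)"
        using Cons.prems by (simp add: has_degree_def interior_product_def)
      with Cons.IH[OF _ this] Cons.prems(1) Suc 1 show ?thesis
        by (simp add: wedge_one_Cons)
    qed
  qed (simp add: wedge_one_Nil)
  then show ?thesis by (simp add: has_degree_def)
qed

lemma cochains_properties:
  assumes "\<sigma> \<in> cochains m w"
  shows "multilinear \<sigma> \<and> alternating \<sigma> \<and> has_weight (int w) \<sigma> \<and> has_degree m \<sigma>"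
  using assms
proof (induction rule: cochains_induct)
  show "subspace {\<sigma>. multilinear \<sigma> \<and> alternating \<sigma> \<and> has_weight (int w) \<sigma> \<and> has_degree m \<sigma>}"
  proof (rule subspaceI, safe)
    fix x y :: cochain and c :: real
    show "multilinear 0"
      by (auto simp: multilinear_def intro!: linearI)
    show "multilinear (x + y)" if "multilinear x" "multilinear y"
      using that by (auto simp: multilinear_def intro: linear_compose_add)
    show "multilinear (c *\<^sub>R x)" if "multilinear x"
      unfolding multilinear_def scaleR_fun_apply
      by (intro allI linear_compose_scale_right that[unfolded multilinear_def, rule_format])
    show "alternating 0"
      by (simp add: alternating_def)
    show "alternating (x + y)" if "alternating x" "alternating y"
      unfolding alternating_def
    proof (intro allI)
      fix xs f g ys
      have "x (xs @ f # g # ys) = - x (xs @ g # f # ys)" "y (xs @ f # g # ys) = - y (xs @ g # f # ys)"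
        using that unfolding alternating_def by blast+
      then show "(x + y) (xs @ f # g # ys) = - (x + y) (xs @ g # f # ys)"
        by simp
    qed
    show "alternating (c *\<^sub>R x)" if "alternating x"
      unfolding alternating_def
    proof (intro allI)
      fix xs f g ys
      have "x (xs @ f # g # ys) = - x (xs @ g # f # ys)"
        using that unfolding alternating_def by blast
      then show "(c *\<^sub>R x) (xs @ f # g # ys) = - (c *\<^sub>R x) (xs @ g # f # ys)"
        by simp
    qed
    show "has_weight (int w) 0"
      by (simp add: has_weight_def)
    show "has_weight (int w) (x + y)" if "has_weight (int w) x" "has_weight (int w) y"
      using that unfolding has_weight_def by force
    show "has_weight (int w) (c *\<^sub>R x)" if "has_weight (int w) x"
      using that unfolding has_weight_def by simp
    show "has_degree m 0"
      by (simp add: has_degree_def)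
    show "has_degree m (x + y)" if "has_degree m x" "has_degree m y"
      using that unfolding has_degree_def by simp
    show "has_degree m (c *\<^sub>R x)" if "has_degree m x"
      using that unfolding has_degree_def by simp
  qed
  fix zs ls
  assume "list_all2 (\<lambda>z l. z \<in> dual_hom l) zs ls" "length ls = m" "(\<Sum>l\<leftarrow>ls. int l - 2) = int w"
  moreover have "multilinear (wedge_list zs) \<and> alternating (wedge_list zs)
      \<and> has_weight (\<Sum>l\<leftarrow>ls. int l - 2) (wedge_list zs) \<and> has_degree (length ls) (wedge_list zs)"
    if "list_all2 (\<lambda>z l. z \<in> dual_hom l) zs ls" for zs ls
    using that
  proof (induction zs ls rule: list_all2_induct)
    case Nil
    then show ?case
      by (auto simp: wedge_list_Nil multilinear_def alternating_def has_weight_def has_degree_def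
          unit_cochain_def split: if_splits intro!: linearI)
  next
    case (Cons z zs l ls)
    then have "linear z" by (simp add: dual_hom_def)
    with Cons show ?case
      using has_weight_wedge_one[of z l "\<Sum>l\<leftarrow>ls. int l - 2" "wedge_list zs"]
      by (auto simp: wedge_list_Cons add.commute intro: multilinear_wedge_one alternating_wedge_one has_degree_wedge_one)
  qed
  ultimately show "multilinear (wedge_list zs) \<and> alternating (wedge_list zs)
      \<and> has_weight (int w) (wedge_list zs) \<and> has_degree m (wedge_list zs)"
    by metis
qed

lemma rel_cochains_trivial:
  assumes "w < m"
  shows "rel_cochains m w = {0}"
proof -
  have "\<sigma> = 0" if \<sigma>: "\<sigma> \<in> rel_cochains m w" for \<sigma>
  proof -
    have "\<sigma> \<in> cochains m w"
      using \<sigma> by (simp add: rel_cochains_def)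
    from cochains_properties[OF this]
    have lin: "\<And>xs ys. linear (\<lambda>f. \<sigma> (xs @ f # ys))"
      and alt: "\<And>xs f g ys. \<sigma> (xs @ f # g # ys) = - \<sigma> (xs @ g # f # ys)"
      and wt: "\<And>fs ls. list_all2 homogeneous ls fs \<Longrightarrow> \<sigma> fs \<noteq> 0 \<Longrightarrow> (\<Sum>l\<leftarrow>ls. int l - 2) = int w"
      and deg: "\<And>fs. length fs \<noteq> m \<Longrightarrow> \<sigma> fs = 0"
      unfolding multilinear_def alternating_def has_weight_def has_degree_def by blast+
    have quad: "\<sigma> (xs @ q # ys) = 0" if q: "homogeneous 2 q" for xs q ys
    proof (induction xs arbitrary: ys rule: rev_induct)
      case Nil
      have "q \<in> momentum ` sp4"
        using q momentum_image by blast
      then have "interior_product q \<sigma> = 0"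
        using \<sigma> by (auto simp: rel_cochains_def)
      then show ?case
        by (simp add: interior_product_def fun_eq_iff)
    next
      case (snoc x xs)
      then show ?case
        using alt[of xs x q ys] by simp
    qed
    have mono: "\<sigma> (map mono_ham ns) = 0" if ge: "\<forall>n\<in>set ns. 2 \<le> mdeg n" for ns
    proof (cases "\<exists>n\<in>set ns. mdeg n = 2")
      case True
      then obtain n xs ys where "ns = xs @ n # ys" "mdeg n = 2"
        by (metis split_list)
      then show ?thesis
        using quad[of "mono_ham n" "map mono_ham xs" "map mono_ham ys"] homogeneous_mono_ham[of n] by simp
    next
      case False
      then have 3: "3 \<le> mdeg n" if "n \<in> set ns" for n
        using ge that by (metis Suc_leI le_neq_implies_less numeral_2_eq_2 numeral_3_eq_3)
      show ?thesis
      proof (rule ccontr)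
        assume nz: "\<sigma> (map mono_ham ns) \<noteq> 0"
        have "list_all2 homogeneous (map mdeg ns) (map mono_ham ns)"
          using ge by (auto simp: list_all2_conv_all_nth intro!: homogeneous_mono_ham)
        from wt[OF this nz] have "(\<Sum>n\<leftarrow>ns. int (mdeg n) - 2) = int w"
          by (simp add: o_def)
        moreover have "(\<Sum>n\<leftarrow>ns. 1) \<le> (\<Sum>n\<leftarrow>ns. int (mdeg n) - 2)"
          by (rule sum_list_mono) (use 3 in force)
        moreover have "(\<Sum>n\<leftarrow>ns. 1) = int (length ns)"
          by (simp add: sum_list_triv)
        moreover have "length ns = m"
          using deg[of "map mono_ham ns"] nz by auto
        ultimately show False
          using assms by linarith
      qed
    qed
    have "\<sigma> (map mono_ham ns @ fs) = 0" if "\<forall>n\<in>set ns. 2 \<le> mdeg n" for ns fs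
      using that
    proof (induction fs arbitrary: ns)
      case Nil
      then show ?case using mono by simp
    next
      case (Cons f fs)
      let ?K = "Poly_Mapping.keys (poly_of_ham f)"
      have "\<sigma> (map mono_ham ns @ f # fs) = \<sigma> (map mono_ham ns @ (\<Sum>n\<in>?K. coef n f *\<^sub>R mono_ham n) # fs)"
        using ham_expand[of f] by simp
      also have "\<dots> = (\<Sum>n\<in>?K. coef n f * \<sigma> (map mono_ham ns @ mono_ham n # fs))"
        by (simp add: linear_sum[OF lin] linear_cmul[OF lin])
      also have "\<dots> = 0"
      proof (rule sum.neutral, rule ballI)
        fix n assume "n \<in> ?K"
        then have "2 \<le> mdeg n" using poly_of_ham[of f] by simp
        then have "\<sigma> (map mono_ham (ns @ [n]) @ fs) = 0"
          using Cons.prems by (intro Cons.IH) auto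
        then show "coef n f * \<sigma> (map mono_ham ns @ mono_ham n # fs) = 0" by simp
      qed
      finally show ?case .
    qed
    from this[of "[]"] show "\<sigma> = 0"
      by (simp add: fun_eq_iff)
  qed
  then show ?thesis
    using subspace_0[OF subspace_rel_cochains[of m w]] by blast
qed

lemma euler_number_eq: "euler_number w = (\<Sum>m\<le>w. (- 1) ^ m * int (dim (rel_cochains m w)))"
  unfolding euler_number_def
proof (rule Sum_any.expand_superset)
  show "{m. (- 1) ^ m * int (dim (rel_cochains m w)) \<noteq> 0} \<subseteq> {..w}"
  proof
    fix m assume m: "m \<in> {m. (- 1) ^ m * int (dim (rel_cochains m w)) \<noteq> 0}"
    have "\<not> w < m"
    proof
      assume "w < m"
      then have "dim (rel_cochains m w) = 0"
        using real_vector.dim_eq_card[of "{}" "{0 :: cochain}"]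
        by (simp add: rel_cochains_trivial real_vector.independent_empty)
      with m show False by simp
    qed
    then show "m \<in> {..w}" by simp
  qed
qed simp

end

theory Submission
  imports Defs
begin

text \<open>
  A relative cochain contracts to zero with every quadratic potential, so it lives on monomials of
  degree at least three, and by Cartan's formula the condition on its coboundary says that the
  quadratic potentials, which form \<open>sp(4)\<close>, act on it by zero. The relative cochains of degree \<open>m\<close>
  and weight \<open>w\<close> are therefore the \<open>sp(4)\<close>-invariants in a finite-dimensional module
  (\<open>rel_cochains_eq_invariants\<close>), and the task is to find the dimension of a space of invariants.

  The Weyl character formula would express this dimension through weight multiplicities:
  with \<open>d(p, q)\<close> the dimension of the weight space of weight \<open>(p, q)\<close>,
  it is \<open>\<Sum> sgn(s) d(\<rho> - s \<rho>)\<close> over the eight elements \<open>s\<close> of the Weyl group, where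
  \<open>\<rho> = (2, 1)\<close>. This consequence (\<open>dim_invariants\<close>) is proved
  directly, by linear algebra. The module carries a positive definite inner product for which
  raising and lowering operators are adjoint; it comes from the inner product on polynomials for
  which multiplication by \<open>x\<^sub>i\<close> is adjoint to \<open>\<partial>\<^sub>i\<close>. Consequently the
  Casimir operator is a sum of squares and a vector in its kernel is invariant. For the subalgebra
  \<open>sl(2) \<times> sl(2)\<close> of the long roots, write \<open>A\<^sub>0\<close>, \<open>A\<^sub>2\<close> and
  \<open>B\<close> for the highest weight vectors of weights \<open>(0, 0)\<close>, \<open>(2, 0)\<close> and \<open>(1, 1)\<close>.
  The short root operators give maps \<open>A\<^sub>0 \<times> A\<^sub>2 \<rightarrow> B\<close> and back (the two halves of a Dirac operator) whose
  composites in both orders are the Casimir operator. Since the Casimir operator is injective on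
  nonzero weights, the first map is onto and its kernel is the space of invariants, so that space
  has dimension \<open>dim A\<^sub>0 + dim A\<^sub>2 - dim B\<close>; and elementary \<open>sl(2)\<close> theory
  expresses the three terms by weight multiplicities.

  The weight spaces have bases indexed by sets of monomials (\<open>dim_weight_space\<close>), since
  exterior products of coordinate functionals are determined by the set of factors. What remains is a finite count: how
  many sets of \<open>m\<close> monomials have cochain weight \<open>6\<close> and a prescribed torus
  weight. The generating function of these numbers is multiplied out one monomial at
  a time (\<open>weight_multiplicities\<close>).
\<close>

section \<open>Dimensions of finite-dimensional subspaces\<close>

lemma rank_nullity_on:
  fixes f :: "'a::real_vector \<Rightarrow> 'b::real_vector"
  assumes f: "linear f" and S: "subspace S" and fin: "finite X" "S \<subseteq> span X"
  shows "dim S = dim {x \<in> S. f x = 0} + dim (f ` S)"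
proof -
  let ?K = "{x \<in> S. f x = 0}"
  have K: "subspace ?K"
    using S by (auto simp: subspace_def linear_0[OF f] linear_add[OF f] linear_cmul[OF f])
  obtain B where B: "B \<subseteq> ?K" "independent B" "?K \<subseteq> span B" "card B = dim ?K"
    using basis_exists by blast
  obtain C where C: "B \<subseteq> C" "C \<subseteq> S" "independent C" "S \<subseteq> span C"
    using real_vector.maximal_independent_subset_extend[of B S] B by blast
  have finC: "finite C"
    using real_vector.independent_span_bound[OF fin(1) C(3)] C(2) fin(2) by blast
  have SC: "span C = S"
    using C S by (metis real_vector.span_subspace)
  have KB: "span B = ?K"
    using B K by (metis real_vector.span_subspace)
  let ?D = "C - B"
  have "x = 0" if x: "x \<in> span ?D" "f x = 0" for x
  proof -
    have "x \<in> S" using x(1) SC span_mono[of ?D C] by blast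
    then have "x \<in> span B" using x(2) KB by simp
    moreover have "finite B" using finC C(1) finite_subset by blast
    ultimately obtain v where v: "x = (\<Sum>c\<in>B. v c *\<^sub>R c)"
      by (auto simp: real_vector.span_finite)
    obtain u where u: "x = (\<Sum>c\<in>?D. u c *\<^sub>R c)"
      using x(1) finC by (auto simp: real_vector.span_finite)
    let ?w = "\<lambda>c. if c \<in> B then - v c else u c"
    have "(\<Sum>c\<in>C. ?w c *\<^sub>R c) = (\<Sum>c\<in>?D. ?w c *\<^sub>R c) + (\<Sum>c\<in>B. ?w c *\<^sub>R c)"
      using sum.subset_diff[OF C(1) finC] .
    also have "\<dots> = x - x"
      unfolding u v by (simp add: sum_negf u[symmetric] v[symmetric])
    finally have "?w c = 0" if "c \<in> C" for c
      using real_vector.independentD[OF C(3) finC, of ?w] that by simp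
    then have "u c = 0" if "c \<in> ?D" for c
      using that by force
    then show ?thesis by (simp add: u)
  qed
  then have inj: "inj_on f (span ?D)"
    by (simp add: linear_injective_on_subspace_0[OF f subspace_span])
  have ind: "independent (f ` ?D)"
    by (rule real_vector.linear_independent_injective_image[OF f _ inj])
      (rule real_vector.independent_mono[OF C(3)], auto)
  have "f ` S = span (f ` C)"
    using linear_span_image[OF f, of C] SC by simp
  also have "\<dots> = span (f ` ?D)"
  proof (rule antisym)
    show "span (f ` C) \<subseteq> span (f ` ?D)"
    proof (rule span_minimal[OF _ subspace_span], rule image_subsetI)
      fix c assume "c \<in> C"
      show "f c \<in> span (f ` ?D)"
      proof (cases "c \<in> B")
        case True
        then have "f c = 0" using B(1) by blast
        then show ?thesis by (simp add: span_zero)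
      qed (use \<open>c \<in> C\<close> in \<open>auto intro: span_base\<close>)
    qed
  qed (intro span_mono image_mono, auto)
  finally have "dim (f ` S) = card (f ` ?D)"
    using real_vector.dim_span_eq_card_independent[OF ind] by simp
  also have "\<dots> = card C - card B"
    using card_image[OF inj_on_subset[OF inj]] real_vector.span_superset card_Diff_subset[OF _ C(1)] finC C(1)
    by (metis finite_subset)
  finally show ?thesis
    using B(4) card_mono[OF finC C(1)] real_vector.dim_span_eq_card_independent[OF C(3)] SC by simp
qed

lemma dim_image_inj:
  fixes f :: "'a::real_vector \<Rightarrow> 'b::real_vector"
  assumes "linear f" "subspace S" "finite X" "S \<subseteq> span X" "\<And>x. x \<in> S \<Longrightarrow> f x = 0 \<Longrightarrow> x = 0"
  shows "dim (f ` S) = dim S"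
proof -
  have "{x \<in> S. f x = 0} = {0}"
    using assms by (auto simp: linear_0 subspace_0)
  then show ?thesis
    using rank_nullity_on[OF assms(1-4)] real_vector.dim_eq_card[of "{}" "{0::'a}"]
    by (simp add: real_vector.independent_empty)
qed

lemma subspace_eq_of_dim_eq:
  fixes S T :: "'a::real_vector set"
  assumes S: "subspace S" and T: "subspace T" and fin: "finite X" "T \<subseteq> span X"
    and "S \<subseteq> T" "dim S = dim T"
  shows "S = T"
proof -
  obtain B where B: "B \<subseteq> S" "independent B" "S \<subseteq> span B" "card B = dim S"
    using basis_exists by blast
  obtain C where C: "B \<subseteq> C" "C \<subseteq> T" "independent C" "T \<subseteq> span C"
    using real_vector.maximal_independent_subset_extend[of B T] B assms(5) by blast
  have finC: "finite C"
    using real_vector.independent_span_bound[OF fin(1) C(3)] C(2) fin(2) by blast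
  have "card C = dim T"
    using C T by (metis real_vector.dim_span_eq_card_independent real_vector.span_subspace)
  then have "B = C"
    using card_subset_eq[OF finC C(1)] B(4) assms(6) by simp
  then show ?thesis
    using B C S T by (metis real_vector.span_subspace)
qed

lemma surj_of_injective_endo:
  fixes f :: "'a::real_vector \<Rightarrow> 'a"
  assumes f: "linear f" and S: "subspace S" "finite X" "S \<subseteq> span X"
    and "f ` S \<subseteq> S" "\<And>x. x \<in> S \<Longrightarrow> f x = 0 \<Longrightarrow> x = 0"
  shows "f ` S = S"
  by (rule subspace_eq_of_dim_eq[OF linear_subspace_image[OF f S(1)] S assms(5) dim_image_inj[OF f S assms(6)]])

lemma dim_Times:
  fixes S :: "'a::real_vector set" and T :: "'b::real_vector set"
  assumes S: "subspace S" "finite X" "S \<subseteq> span X" and T: "subspace T" "finite Y" "T \<subseteq> span Y"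
  shows "dim (S \<times> T) = dim S + dim T" "\<exists>Z. finite Z \<and> S \<times> T \<subseteq> span Z"
proof -
  let ?Z = "(\<lambda>x. (x, 0)) ` X \<union> (\<lambda>y. (0, y)) ` Y"
  have l: "linear (\<lambda>x. (x, 0) :: 'a \<times> 'b)" "linear (\<lambda>y. (0, y) :: 'a \<times> 'b)"
    by (auto intro!: linearI)
  have "(x, y) \<in> span ?Z" if "x \<in> S" "y \<in> T" for x y
  proof -
    have "(x, 0) \<in> span ?Z" "(0, y) \<in> span ?Z"
      using linear_span_image[OF l(1), of X] linear_span_image[OF l(2), of Y] that S(3) T(3)
        span_mono[of "(\<lambda>x. (x, 0)) ` X" ?Z] span_mono[of "(\<lambda>y. (0, y)) ` Y" ?Z] by blast+
    then have "(x, 0) + (0, y) \<in> span ?Z"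
      by (rule span_add)
    then show ?thesis by simp
  qed
  then have Z: "S \<times> T \<subseteq> span ?Z" by auto
  moreover have fin: "finite ?Z" using S T by simp
  ultimately show "\<exists>Z. finite Z \<and> S \<times> T \<subseteq> span Z" by blast
  have "dim (S \<times> T) = dim {x \<in> S \<times> T. fst x = 0} + dim (fst ` (S \<times> T))"
    by (rule rank_nullity_on[OF linear_fst _ fin Z]) (simp add: subspace_Times S T)
  also have "{x \<in> S \<times> T. fst x = 0} = (\<lambda>y. (0, y)) ` T"
    using subspace_0[OF S(1)] by auto
  also have "dim \<dots> = dim T"
    by (rule dim_image_inj[OF l(2) T]) (simp add: zero_prod_def)
  also have "fst ` (S \<times> T) = S"
    using subspace_0[OF T(1)] by force
  finally show "dim (S \<times> T) = dim S + dim T" by simp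
qed

section \<open>Invariants of unitary modules over \<open>sp(4)\<close>\<close>

text \<open>Although only \<open>sp(4)\<close> matters in the end, the module structure is given for \<open>gl(4)\<close>: the
  matrix units \<open>E i j\<close> have a single uniform commutator rule, from which all relations in
  \<open>sp(4)\<close> follow by expansion. The axioms \<open>adjoint\<close> and \<open>ip_pos\<close> replace complete
  reducibility.\<close>

locale gl4_module =
  fixes H :: "'v::real_vector set" and E :: "4 \<Rightarrow> 4 \<Rightarrow> 'v \<Rightarrow> 'v" and ip :: "'v \<Rightarrow> 'v \<Rightarrow> real"
  assumes subspace_H: "subspace H"
    and finite_dim: "\<exists>X. finite X \<and> H \<subseteq> span X"
    and linear_E: "linear (E i j)"
    and E_closed: "v \<in> H \<Longrightarrow> E i j v \<in> H"
    and comm: "v \<in> H \<Longrightarrow> E i j (E k l v) = E k l (E i j v) + (if j = k then E i l v else 0) - (if l = i then E k j v else 0)"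
    and linear_ip: "linear (\<lambda>u. ip u v)"
    and ip_sym: "ip u v = ip v u"
    and ip_pos: "v \<in> H \<Longrightarrow> v \<noteq> 0 \<Longrightarrow> ip v v > 0"
    and adjoint: "u \<in> H \<Longrightarrow> v \<in> H \<Longrightarrow> ip (E i j u) v = ip u (E j i v)"
begin

text \<open>The standard basis of \<open>sp(4)\<close> for the symplectic form pairing \<open>1\<close> with \<open>4\<close> and \<open>2\<close> with
  \<open>3\<close>. With Cartan elements \<open>h1\<close> and \<open>h2\<close>, the long root vectors \<open>up1\<close>, \<open>dn1\<close>, \<open>up2\<close>, \<open>dn2\<close> have
  weights \<open>(2, 0)\<close>, \<open>(-2, 0)\<close>, \<open>(0, 2)\<close>, \<open>(0, -2)\<close>; the two letters in the names of the short root
  vectors \<open>pp\<close>, \<open>mm\<close>, \<open>pm\<close>, \<open>mp\<close> are the signs in their weights \<open>(\<plusminus>1, \<plusminus>1)\<close>.\<close>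

definition up1 :: "'v \<Rightarrow> 'v" where "up1 v = E 1 4 v"
definition dn1 :: "'v \<Rightarrow> 'v" where "dn1 v = E 4 1 v"
definition up2 :: "'v \<Rightarrow> 'v" where "up2 v = E 2 3 v"
definition dn2 :: "'v \<Rightarrow> 'v" where "dn2 v = E 3 2 v"
definition pp :: "'v \<Rightarrow> 'v" where "pp v = E 1 3 v + E 2 4 v"
definition mm :: "'v \<Rightarrow> 'v" where "mm v = E 3 1 v + E 4 2 v"
definition pm :: "'v \<Rightarrow> 'v" where "pm v = E 1 2 v - E 3 4 v"
definition mp :: "'v \<Rightarrow> 'v" where "mp v = E 2 1 v - E 4 3 v"
definition h1 :: "'v \<Rightarrow> 'v" where "h1 v = E 1 1 v - E 4 4 v"
definition h2 :: "'v \<Rightarrow> 'v" where "h2 v = E 2 2 v - E 3 3 v"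

lemmas op_defs = up1_def dn1_def up2_def dn2_def pp_def mm_def pm_def mp_def h1_def h2_def

lemmas E_simps = linear_add[OF linear_E] linear_diff[OF linear_E] linear_cmul[OF linear_E] linear_0[OF linear_E]

lemma linear_ops: "linear up1" "linear dn1" "linear up2" "linear dn2" "linear pp" "linear mm" "linear pm" "linear mp" "linear h1" "linear h2"
  by (rule linearI; simp add: op_defs E_simps algebra_simps)+

lemma ops_closed:
  assumes "v \<in> H"
  shows "up1 v \<in> H" "dn1 v \<in> H" "up2 v \<in> H" "dn2 v \<in> H" "pp v \<in> H" "mm v \<in> H" "pm v \<in> H" "mp v \<in> H" "h1 v \<in> H" "h2 v \<in> H"
  using assms by (simp_all add: op_defs subspace_add[OF subspace_H] subspace_diff[OF subspace_H] E_closed)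

text \<open>Used as a rewrite rule, the commutator relation would swap two operators forever. A rank on
  the matrix units restricts it to one direction, so that rewriting computes normally ordered
  products.\<close>

definition index_rank :: "4 \<Rightarrow> 4 \<Rightarrow> nat"
  where "index_rank i j = (let r = (\<lambda>k. if k = 1 then 1 else if k = 2 then 2 else if k = 3 then 3 else 0) in 4 * r i + r j)"

lemma comm_oriented:
  assumes "v \<in> H" "index_rank k l < index_rank i j"
  shows "E i j (E k l v) = E k l (E i j v) + (if j = k then E i l v else 0) - (if l = i then E k j v else 0)"
  using assms comm by blast

text \<open>The orientation of these rules matters: used from left to right they sort a product of
  generators without looping.\<close>

lemma sp4_comm:
  assumes v: "v \<in> H"
  shows "up1 (dn1 v) = dn1 (up1 v) + h1 v"
    "up2 (dn2 v) = dn2 (up2 v) + h2 v"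
    "up1 (up2 v) = up2 (up1 v)"
    "up1 (dn2 v) = dn2 (up1 v)"
    "up2 (dn1 v) = dn1 (up2 v)"
    "dn1 (dn2 v) = dn2 (dn1 v)"
    "up1 (pp v) = pp (up1 v)"
    "up1 (pm v) = pm (up1 v)"
    "up1 (mp v) = mp (up1 v) - pp v"
    "up1 (mm v) = mm (up1 v) + pm v"
    "up2 (pp v) = pp (up2 v)"
    "up2 (pm v) = pm (up2 v) - pp v"
    "up2 (mp v) = mp (up2 v)"
    "up2 (mm v) = mm (up2 v) + mp v"
    "dn1 (pp v) = pp (dn1 v) - mp v"
    "dn1 (pm v) = pm (dn1 v) + mm v"
    "dn1 (mp v) = mp (dn1 v)"
    "dn1 (mm v) = mm (dn1 v)"
    "dn2 (pp v) = pp (dn2 v) - pm v"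
    "dn2 (pm v) = pm (dn2 v)"
    "dn2 (mp v) = mp (dn2 v) + mm v"
    "dn2 (mm v) = mm (dn2 v)"
    "mm (pp v) = pp (mm v) - h1 v - h2 v"
    "pm (mp v) = mp (pm v) + h1 v - h2 v"
    "pm (pp v) = pp (pm v) + 2 *\<^sub>R up1 v"
    "mp (pp v) = pp (mp v) + 2 *\<^sub>R up2 v"
    "h1 (h2 v) = h2 (h1 v)"
    "mm (mp v) = mp (mm v) + 2 *\<^sub>R dn1 v"
    "mm (pm v) = pm (mm v) + 2 *\<^sub>R dn2 v"
  unfolding op_defs E_simps by (simp_all add: comm_oriented[OF v] E_simps algebra_simps scaleR_2 index_rank_def)

lemma sp4_weight:
  assumes v: "v \<in> H"
  shows "h1 (up1 v) = up1 (h1 v) + 2 *\<^sub>R up1 v"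
    "h1 (dn1 v) = dn1 (h1 v) - 2 *\<^sub>R dn1 v"
    "h1 (up2 v) = up2 (h1 v)"
    "h1 (dn2 v) = dn2 (h1 v)"
    "h1 (pp v) = pp (h1 v) + pp v"
    "h1 (mm v) = mm (h1 v) - mm v"
    "h1 (pm v) = pm (h1 v) + pm v"
    "h1 (mp v) = mp (h1 v) - mp v"
    "h2 (up1 v) = up1 (h2 v)"
    "h2 (dn1 v) = dn1 (h2 v)"
    "h2 (up2 v) = up2 (h2 v) + 2 *\<^sub>R up2 v"
    "h2 (dn2 v) = dn2 (h2 v) - 2 *\<^sub>R dn2 v"
    "h2 (pp v) = pp (h2 v) + pp v"
    "h2 (mm v) = mm (h2 v) - mm v"
    "h2 (pm v) = pm (h2 v) - pm v"
    "h2 (mp v) = mp (h2 v) + mp v"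
  unfolding op_defs E_simps by (simp_all add: comm_oriented[OF v] E_simps algebra_simps scaleR_2 index_rank_def)

lemmas op_simps = linear_ops[THEN linear_add] linear_ops[THEN linear_diff] linear_ops[THEN linear_cmul]
  linear_ops[THEN linear_0] linear_ops[THEN linear_neg]

lemmas ip_simps = linear_add[OF linear_ip] linear_diff[OF linear_ip] linear_cmul[OF linear_ip] linear_0[OF linear_ip]

lemma ip_right: "ip u (v + w) = ip u v + ip u w" "ip u (v - w) = ip u v - ip u w" "ip u (c *\<^sub>R v) = c * ip u v"
  using ip_simps by (simp_all add: ip_sym[of u])

lemma op_adjoint:
  assumes "u \<in> H" "v \<in> H"
  shows "ip (up1 u) v = ip u (dn1 v)" "ip (up2 u) v = ip u (dn2 v)" "ip (pp u) v = ip u (mm v)"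
    "ip (pm u) v = ip u (mp v)" "ip (dn1 u) v = ip u (up1 v)" "ip (dn2 u) v = ip u (up2 v)"
    "ip (mm u) v = ip u (pp v)" "ip (mp u) v = ip u (pm v)" "ip (h1 u) v = ip u (h1 v)" "ip (h2 u) v = ip u (h2 v)"
  by (simp_all add: op_defs ip_simps ip_right adjoint assms)

lemma ip_nonneg: "v \<in> H \<Longrightarrow> ip v v \<ge> 0"
  using ip_pos[of v] ip_simps(4)[of v] by (cases "v = 0") (auto simp: less_imp_le)

lemma ip_zeroD: "v \<in> H \<Longrightarrow> ip v v = 0 \<Longrightarrow> v = 0"
  using ip_pos[of v] by force

definition invariants :: "'v set"
  where "invariants = {v \<in> H. up1 v = 0 \<and> up2 v = 0 \<and> dn1 v = 0 \<and> dn2 v = 0 \<and> pp v = 0 \<and> mm v = 0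
    \<and> pm v = 0 \<and> mp v = 0 \<and> h1 v = 0 \<and> h2 v = 0}"

definition casimir :: "'v \<Rightarrow> 'v"
  where "casimir v = h1 (h1 v) + h2 (h2 v) + 2 *\<^sub>R (up1 (dn1 v) + dn1 (up1 v)) + 2 *\<^sub>R (up2 (dn2 v) + dn2 (up2 v))
    + pp (mm v) + mm (pp v) + pm (mp v) + mp (pm v)"

text \<open>By adjointness \<open>\<langle>\<Omega> v, v\<rangle>\<close> is a sum, with positive coefficients, of the squared norms of
  the generators applied to \<open>v\<close>.\<close>

lemma casimir_kernel:
  assumes v: "v \<in> H" and 0: "casimir v = 0"
  shows "v \<in> invariants"
proof -
  let ?n = "\<lambda>v. ip v v"
  have "ip (casimir v) v = ?n (h1 v) + ?n (h2 v) + 2 * (?n (dn1 v) + ?n (up1 v)) + 2 * (?n (dn2 v) + ?n (up2 v))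
      + ?n (mm v) + ?n (pp v) + ?n (mp v) + ?n (pm v)"
    using v by (simp add: casimir_def ip_simps ip_right op_adjoint ops_closed)
  also have "ip (casimir v) v = 0"
    by (simp add: 0 ip_simps)
  finally have "?n (h1 v) = 0 \<and> ?n (h2 v) = 0 \<and> ?n (dn1 v) = 0 \<and> ?n (up1 v) = 0 \<and> ?n (dn2 v) = 0 \<and> ?n (up2 v) = 0
      \<and> ?n (mm v) = 0 \<and> ?n (pp v) = 0 \<and> ?n (mp v) = 0 \<and> ?n (pm v) = 0"
    using ops_closed[OF v, THEN ip_nonneg] by (simp add: add_nonneg_eq_0_iff)
  then show ?thesis
    using v by (auto simp: invariants_def ops_closed intro!: ip_zeroD)
qed

definition weight_space :: "int \<Rightarrow> int \<Rightarrow> 'v set"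
  where "weight_space p q = {v \<in> H. h1 v = real_of_int p *\<^sub>R v \<and> h2 v = real_of_int q *\<^sub>R v}"

text \<open>The highest weight vectors of weight \<open>(p, q)\<close> for \<open>sl(2) \<times> sl(2)\<close>, the subalgebra generated
  by the long root vectors.\<close>

definition highest_space :: "int \<Rightarrow> int \<Rightarrow> 'v set"
  where "highest_space p q = {v \<in> weight_space p q. up1 v = 0 \<and> up2 v = 0}"

lemma weight_space_shift:
  assumes "v \<in> weight_space p q"
  shows "up1 v \<in> weight_space (p + 2) q" "dn1 v \<in> weight_space (p - 2) q" "up2 v \<in> weight_space p (q + 2)" "dn2 v \<in> weight_space p (q - 2)"
    "pp v \<in> weight_space (p + 1) (q + 1)" "mm v \<in> weight_space (p - 1) (q - 1)" "pm v \<in> weight_space (p + 1) (q - 1)" "mp v \<in> weight_space (p - 1) (q + 1)"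
  using assms by (auto simp: weight_space_def ops_closed sp4_weight op_simps scaleR_add_left scaleR_diff_left)

lemma subspace_weight_space: "subspace (weight_space p q)"
  using subspace_H by (auto simp: weight_space_def subspace_def op_simps algebra_simps)

lemma subspace_ker:
  assumes "linear f" "subspace S" shows "subspace {v \<in> S. f v = (0::'v)}"
  using assms by (auto simp: subspace_def linear_0 linear_add linear_cmul)

lemma subspace_highest_space: "subspace (highest_space p q)"
  using subspace_ker[OF linear_ops(3) subspace_ker[OF linear_ops(1) subspace_weight_space[of p q]]]
  by (simp add: highest_space_def conj_assoc)

lemma weight_space_H: "v \<in> weight_space p q \<Longrightarrow> v \<in> H" and highest_space_H: "v \<in> highest_space p q \<Longrightarrow> v \<in> H"
  by (simp_all add: weight_space_def highest_space_def)

text \<open>The \<open>sl(2)\<close> multiplicity argument in abstract form: if the lowering operator \<open>f\<close> followed by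
  the raising operator \<open>e\<close> is injective on the upper weight space \<open>T\<close>, then it is bijective there,
  so \<open>e\<close> maps the lower weight space \<open>S\<close> onto \<open>T\<close>.\<close>

lemma dim_ker_of_injective_comp:
  assumes "linear e" "linear f" "subspace S" "S \<subseteq> H" "subspace T" "T \<subseteq> H" "e ` S \<subseteq> T" "f ` T \<subseteq> S"
    and "\<And>v. v \<in> T \<Longrightarrow> e (f v) = 0 \<Longrightarrow> v = 0"
  shows "dim S = dim {v \<in> S. e v = 0} + dim T"
proof -
  obtain X where X: "finite X" "H \<subseteq> span X"
    using finite_dim by blast
  have "(e \<circ> f) ` T = T"
    by (rule surj_of_injective_endo[OF linear_compose[OF assms(2,1)] assms(5) X(1)]) (use assms X in \<open>auto simp: image_subset_iff\<close>)
  then have "T \<subseteq> e ` S"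
    using assms(8) by (metis image_comp image_mono)
  then have "e ` S = T"
    using assms(7) by blast
  moreover have "S \<subseteq> span X"
    using X(2) assms(4) by blast
  ultimately show ?thesis
    using rank_nullity_on[OF assms(1,3) X(1)] by simp
qed

text \<open>On a vector of positive weight, \<open>\<langle>up1 (dn1 v), v\<rangle> = |up1 v|\<^sup>2 + p |v|\<^sup>2\<close>.\<close>

lemma up1_dn1_injective:
  assumes v: "v \<in> weight_space p q" and "p > 0" "up1 (dn1 v) = 0"
  shows "v = 0"
proof -
  have H: "v \<in> H" using v by (rule weight_space_H)
  have "0 = ip (up1 (dn1 v)) v"
    by (simp add: assms(3) ip_simps)
  also have "\<dots> = ip (up1 v) (up1 v) + p * ip v v"
    using v H by (simp add: sp4_comm ip_simps op_adjoint ops_closed) (simp add: weight_space_def ip_simps ip_right)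
  finally have "p * ip v v \<le> 0" using ip_nonneg[OF ops_closed(1)[OF H]] by linarith
  then have "ip v v \<le> 0"
    using \<open>p > 0\<close> by (simp add: mult_le_0_iff)
  then show ?thesis
    using ip_pos[OF H] by force
qed

lemma up2_dn2_injective:
  assumes v: "v \<in> weight_space p q" and "q > 0" "up2 (dn2 v) = 0"
  shows "v = 0"
proof -
  have H: "v \<in> H" using v by (rule weight_space_H)
  have "0 = ip (up2 (dn2 v)) v"
    by (simp add: assms(3) ip_simps)
  also have "\<dots> = ip (up2 v) (up2 v) + q * ip v v"
    using v H by (simp add: sp4_comm ip_simps op_adjoint ops_closed) (simp add: weight_space_def ip_simps ip_right)
  finally have "q * ip v v \<le> 0" using ip_nonneg[OF ops_closed(3)[OF H]] by linarith
  then have "ip v v \<le> 0"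
    using \<open>q > 0\<close> by (simp add: mult_le_0_iff)
  then show ?thesis
    using ip_pos[OF H] by force
qed

text \<open>The \<open>sl(2)\<close> multiplicity formula is applied twice, first to \<open>up1\<close> on weight spaces and then to
  \<open>up2\<close> on the kernels of \<open>up1\<close>, which \<open>up2\<close> and \<open>dn2\<close> preserve because the two copies of \<open>sl(2)\<close>
  commute.\<close>

lemma dim_highest_space:
  assumes "p \<ge> 0" "q \<ge> 0"
  shows "int (dim (highest_space p q)) = int (dim (weight_space p q)) - int (dim (weight_space (p + 2) q)) - int (dim (weight_space p (q + 2)))
      + int (dim (weight_space (p + 2) (q + 2)))"
proof -
  define W where "W q = {v \<in> weight_space p q. up1 v = 0}" for q
  have 1: "dim (weight_space p q) = dim (W q) + dim (weight_space (p + 2) q)" for q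
    unfolding W_def
    by (rule dim_ker_of_injective_comp[OF linear_ops(1,2)])
      (use assms up1_dn1_injective[of _ "p + 2"] weight_space_shift(2)[of _ "p + 2" q] in
        \<open>auto simp: subspace_weight_space weight_space_H weight_space_shift\<close>)
  have sub: "subspace (W q)" for q
    unfolding W_def by (rule subspace_ker[OF linear_ops(1) subspace_weight_space])
  have "dim (W q) = dim {v \<in> W q. up2 v = 0} + dim (W (q + 2))"
    by (rule dim_ker_of_injective_comp[OF linear_ops(3,4) sub _ sub])
      (use assms up2_dn2_injective[of _ p "q + 2"] weight_space_shift(4)[of _ p "q + 2"] in
        \<open>auto simp: W_def weight_space_H weight_space_shift sp4_comm(4) sp4_comm(3) op_simps\<close>)
  also have "{v \<in> W q. up2 v = 0} = highest_space p q"
    by (auto simp: W_def highest_space_def)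
  finally show ?thesis
    using 1[of q] 1[of "q + 2"] by simp
qed

lemma highest_space_dn1: "v \<in> highest_space 0 q \<Longrightarrow> dn1 v = 0"
proof -
  assume v: "v \<in> highest_space 0 q"
  then have H: "v \<in> H" by (rule highest_space_H)
  have "ip (dn1 v) (dn1 v) = ip (up1 (dn1 v)) v"
    using H by (simp add: op_adjoint ops_closed)
  also have "\<dots> = 0"
    using v H by (simp add: sp4_comm) (simp add: highest_space_def weight_space_def ip_simps op_simps)
  finally show ?thesis
    using ip_zeroD ops_closed H by blast
qed

lemma highest_space_dn2: "v \<in> highest_space p 0 \<Longrightarrow> dn2 v = 0"
proof -
  assume v: "v \<in> highest_space p 0"
  then have H: "v \<in> H" by (rule highest_space_H)
  have "ip (dn2 v) (dn2 v) = ip (up2 (dn2 v)) v"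
    using H by (simp add: op_adjoint ops_closed)
  also have "\<dots> = 0"
    using v H by (simp add: sp4_comm) (simp add: highest_space_def weight_space_def ip_simps op_simps)
  finally show ?thesis
    using ip_zeroD ops_closed H by blast
qed

text \<open>The components of the two Dirac operators on highest weight vectors: \<open>pp\<close> and \<open>dirac2\<close> map
  the highest weight vectors of weights \<open>(0, 0)\<close> and \<open>(2, 0)\<close> to those of weight \<open>(1, 1)\<close>, and
  \<open>codirac0\<close>, \<open>codirac2\<close> map back. The coefficients of the correction terms are forced by the
  condition that \<open>up1\<close> and \<open>up2\<close> annihilate the results.\<close>

definition dirac2 :: "'v \<Rightarrow> 'v" where "dirac2 v = 2 *\<^sub>R mp v + pp (dn1 v)"
definition codirac0 :: "'v \<Rightarrow> 'v" where "codirac0 v = mm v - pm (dn1 v) - mp (dn2 v) - pp (dn1 (dn2 v))"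
definition codirac2 :: "'v \<Rightarrow> 'v" where "codirac2 v = pm v + pp (dn2 v)"

lemma linear_dirac2: "linear dirac2"
  by (rule linearI) (simp_all add: dirac2_def op_simps algebra_simps)

lemma linear_codirac: "linear codirac0" "linear codirac2"
  by (rule linearI; simp add: codirac0_def codirac2_def op_simps algebra_simps)+

lemma highest_spaceD:
  assumes "v \<in> highest_space p q"
  shows "v \<in> H" "up1 v = 0" "up2 v = 0" "h1 v = real_of_int p *\<^sub>R v" "h2 v = real_of_int q *\<^sub>R v"
  using assms by (auto simp: highest_space_def weight_space_def)

lemmas dirac_simps = dirac2_def codirac0_def codirac2_def casimir_def sp4_comm(1-5) sp4_comm(6)[symmetric] sp4_comm(7-29)
  sp4_weight op_simps ops_closed

lemma pp_highest_space: assumes "v \<in> highest_space 0 0" shows "pp v \<in> highest_space 1 1"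
  using highest_spaceD[OF assms] weight_space_shift(5)[of v 0 0] assms by (simp add: highest_space_def sp4_comm op_simps)

lemma dirac2_highest_space: assumes "v \<in> highest_space 2 0" shows "dirac2 v \<in> highest_space 1 1"
proof -
  have v: "v \<in> weight_space 2 0" using assms by (simp add: highest_space_def)
  have "pp (dn1 v) \<in> weight_space 1 1"
    using weight_space_shift(5)[OF weight_space_shift(2)[OF v]] by simp
  then have "dirac2 v \<in> weight_space 1 1"
    using weight_space_shift(8)[OF v] by (simp add: dirac2_def subspace_add subspace_scale subspace_weight_space)
  then show ?thesis
    using highest_spaceD[OF assms] by (simp add: highest_space_def dirac_simps)
qed

lemma codirac_highest_space:
  assumes "v \<in> highest_space 1 1"
  shows "codirac0 v \<in> highest_space 0 0" "codirac2 v \<in> highest_space 2 0"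
proof -
  have v: "v \<in> weight_space 1 1" using assms by (simp add: highest_space_def)
  have "pm (dn1 v) \<in> weight_space 0 0" "mp (dn2 v) \<in> weight_space 0 0" "pp (dn1 (dn2 v)) \<in> weight_space 0 0" "pp (dn2 v) \<in> weight_space 2 0"
    using weight_space_shift(7)[OF weight_space_shift(2)[OF v]] weight_space_shift(8)[OF weight_space_shift(4)[OF v]]
      weight_space_shift(5)[OF weight_space_shift(2)[OF weight_space_shift(4)[OF v]]] weight_space_shift(5)[OF weight_space_shift(4)[OF v]] by simp_all
  then have "codirac0 v \<in> weight_space 0 0" "codirac2 v \<in> weight_space 2 0"
    using weight_space_shift(6)[OF v] weight_space_shift(7)[OF v]
    by (simp_all add: codirac0_def codirac2_def subspace_add subspace_diff subspace_weight_space)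
  then show "codirac0 v \<in> highest_space 0 0" "codirac2 v \<in> highest_space 2 0"
    using highest_spaceD[OF assms] by (simp_all add: highest_space_def dirac_simps)
qed

text \<open>The square of the Dirac operator is the Casimir operator, with no additive constant. The highest
  weight vectors in play parametrize the occurrences of the highest weight \<open>\<mu> = (1, 0)\<close> in the
  tensor product with the spinors. The constant would be the difference of
  \<open>|\<rho>|\<^sup>2\<close> and \<open>|\<mu> + \<rho>\<^sub>K|\<^sup>2\<close>, where \<open>\<rho>\<^sub>K = (1, 1)\<close> belongs to \<open>sl(2) \<times> sl(2)\<close>,
  and \<open>\<mu> + \<rho>\<^sub>K = (2, 1) = \<rho>\<close>.\<close>

lemma codirac_dirac:
  shows "v \<in> highest_space 0 0 \<Longrightarrow> codirac0 (pp v) = casimir v" "v \<in> highest_space 0 0 \<Longrightarrow> codirac2 (pp v) = 0"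
    "v \<in> highest_space 2 0 \<Longrightarrow> codirac0 (dirac2 v) = 0" "v \<in> highest_space 2 0 \<Longrightarrow> codirac2 (dirac2 v) = casimir v"
  subgoal using highest_spaceD[of v 0 0] highest_space_dn1[of v 0] highest_space_dn2[of v 0] by (simp add: dirac_simps)
  subgoal using highest_spaceD[of v 0 0] highest_space_dn1[of v 0] highest_space_dn2[of v 0] by (simp add: dirac_simps)
  subgoal using highest_spaceD[of v 2 0] highest_space_dn2[of v 2] by (simp add: dirac_simps algebra_simps scaleR_2)
  subgoal using highest_spaceD[of v 2 0] highest_space_dn2[of v 2] by (simp add: dirac_simps algebra_simps scaleR_2)
  done

lemma dirac_codirac:
  assumes "v \<in> highest_space 1 1"
  shows "pp (codirac0 v) + dirac2 (codirac2 v) = casimir v"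
  using highest_spaceD[OF assms] by (simp add: dirac_simps algebra_simps scaleR_2)

lemma casimir_injective:
  assumes "v \<in> weight_space p q" "p \<noteq> 0" "casimir v = 0"
  shows "v = 0"
  using casimir_kernel[of v] assms by (auto simp: weight_space_def invariants_def)

text \<open>The right hand side is \<open>\<Sum> sgn(s) d(\<rho> - s \<rho>)\<close> over the Weyl group, with \<open>\<rho> = (2, 1)\<close>; the
  weight \<open>(1, -1)\<close>, for instance, is replaced by its reflection \<open>(1, 1)\<close>.
  It arises as \<open>dim A\<^sub>0 + dim A\<^sub>2 - dim B\<close>.\<close>

theorem dim_invariants:
  "int (dim invariants) = int (dim (weight_space 0 0)) - int (dim (weight_space 0 2)) - int (dim (weight_space 4 0)) + int (dim (weight_space 4 2))
     - int (dim (weight_space 1 1)) + int (dim (weight_space 3 1)) + int (dim (weight_space 1 3)) - int (dim (weight_space 3 3))"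
proof -
  obtain X where X: "finite X" "H \<subseteq> span X"
    using finite_dim by blast
  have sub: "highest_space p q \<subseteq> span X" for p q
    using X(2) highest_space_H by blast
  define D where "D = (\<lambda>(u, v). pp u + dirac2 v)"
  define S where "S = highest_space 0 0 \<times> highest_space 2 0"
  have D: "linear D"
    by (rule linearI) (auto simp: D_def op_simps linear_add[OF linear_dirac2] linear_cmul[OF linear_dirac2] algebra_simps)
  have "(\<lambda>v. D (codirac0 v, codirac2 v)) ` highest_space 1 1 = highest_space 1 1"
  proof (rule surj_of_injective_endo[OF _ subspace_highest_space X(1) sub])
    show "linear (\<lambda>v. D (codirac0 v, codirac2 v))"
      by (rule linear_compose[OF _ D, unfolded o_def], rule linearI)
        (simp_all add: linear_codirac[THEN linear_add] linear_codirac[THEN linear_cmul])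
    show "(\<lambda>v. D (codirac0 v, codirac2 v)) ` highest_space 1 1 \<subseteq> highest_space 1 1"
      by (auto simp: D_def codirac_highest_space pp_highest_space dirac2_highest_space subspace_add subspace_highest_space)
    show "v = 0" if "v \<in> highest_space 1 1" "D (codirac0 v, codirac2 v) = 0" for v
      using that casimir_injective[of v 1 1] by (simp add: D_def dirac_codirac) (simp add: highest_space_def)
  qed
  moreover have "(\<lambda>v. D (codirac0 v, codirac2 v)) ` highest_space 1 1 \<subseteq> D ` S"
    by (auto simp: S_def codirac_highest_space)
  moreover have "D ` S \<subseteq> highest_space 1 1"
    by (auto simp: S_def D_def pp_highest_space dirac2_highest_space subspace_add subspace_highest_space)
  ultimately have onto: "D ` S = highest_space 1 1"
    by blast
  \<comment> \<open>The codirac operators turn \<open>D (u, v) = 0\<close> into \<open>casimir u = 0\<close> and \<open>casimir v = 0\<close>.\<close>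
  have "{x \<in> S. D x = 0} = (\<lambda>u. (u, 0 :: 'v)) ` invariants"
  proof (intro equalityI subsetI)
    fix x assume "x \<in> {x \<in> S. D x = 0}"
    then obtain u v where x: "x = (u, v)" "u \<in> highest_space 0 0" "v \<in> highest_space 2 0" and 0: "pp u + dirac2 v = 0"
      by (auto simp: S_def D_def)
    have "casimir u = codirac0 (pp u + dirac2 v)" "casimir v = codirac2 (pp u + dirac2 v)"
      using codirac_dirac x by (simp_all add: linear_codirac[THEN linear_add])
    then have "casimir u = 0" "casimir v = 0"
      by (simp_all add: 0 linear_codirac[THEN linear_0])
    then have "u \<in> invariants" "v = 0"
      using casimir_kernel[OF highest_space_H[OF x(2)]] casimir_injective[of v 2 0] x(3) by (auto simp: highest_space_def)
    then show "x \<in> (\<lambda>u. (u, 0 :: 'v)) ` invariants" using x by blast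
  next
    fix x assume "x \<in> (\<lambda>u. (u, 0 :: 'v)) ` invariants"
    then show "x \<in> {x \<in> S. D x = 0}"
      by (auto simp: S_def D_def invariants_def highest_space_def weight_space_def linear_0[OF linear_dirac2] op_simps
          subspace_0[OF subspace_H])
  qed
  moreover have "dim ((\<lambda>u. (u, 0 :: 'v)) ` invariants) = dim invariants"
  proof (rule dim_image_inj[OF _ _ X(1)])
    show "subspace invariants"
      using subspace_H by (auto simp: invariants_def subspace_def op_simps)
  qed (use X in \<open>auto simp: invariants_def zero_prod_def intro!: linearI\<close>)
  moreover obtain Z where Z: "finite Z" "S \<subseteq> span Z"
    unfolding S_def using dim_Times(2)[OF subspace_highest_space X(1) sub subspace_highest_space X(1) sub] by blast
  moreover have "subspace S"
    unfolding S_def by (intro subspace_Times subspace_highest_space)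
  ultimately have "dim S = dim invariants + dim (highest_space 1 1)"
    using rank_nullity_on[OF D _ Z] by (simp only: onto)
  then have "int (dim invariants) = int (dim (highest_space 0 0)) + int (dim (highest_space 2 0)) - int (dim (highest_space 1 1))"
    using dim_Times(1)[OF subspace_highest_space X(1) sub subspace_highest_space X(1) sub, of 0 0 2 0] by (simp add: S_def)
  then show ?thesis
    by (simp add: dim_highest_space)
qed

end

section \<open>The derivations \<open>x\<^sub>i \<partial>\<^sub>j\<close> and their action on cochains\<close>

abbreviation unit_exp :: "4 \<Rightarrow> monom4" where "unit_exp i \<equiv> Poly_Mapping.single i 1"

lemma pvar_mult_single: "pvar i * Poly_Mapping.single n c = Poly_Mapping.single (n + unit_exp i) c"
  by (simp add: pvar_def mult_single add.commute)

lemma monom_diff_add: "Poly_Mapping.lookup n j \<noteq> 0 \<Longrightarrow> n - unit_exp j + unit_exp j = n"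
  by (auto intro!: poly_mapping_eqI simp: lookup_add lookup_minus lookup_single when_def)

lemma poly4_induct [case_names zero single add]:
  fixes p :: poly4
  assumes "P 0" "\<And>n c. P (Poly_Mapping.single n c)" "\<And>p q. P p \<Longrightarrow> P q \<Longrightarrow> P (p + q)"
  shows "P p"
proof -
  have "p = (\<Sum>n\<in>Poly_Mapping.keys p. Poly_Mapping.single n (Poly_Mapping.lookup p n))"
    by (rule poly_mapping_eqI) (simp add: lookup_sum lookup_single when_def in_keys_iff)
  moreover have "P (\<Sum>n\<in>A. Poly_Mapping.single n (Poly_Mapping.lookup p n))" for A
    by (induction A rule: infinite_finite_induct) (simp_all add: assms)
  ultimately show ?thesis by metis
qed

lemma pd_pvar_mult: "pd j (pvar k * p) = (if j = k then p else 0) + pvar k * pd j p"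
proof (induction p rule: poly4_induct)
  case zero
  then show ?case by (simp add: pd_def)
next
  case (single n c)
  have "n + unit_exp k - unit_exp j = n - unit_exp j + unit_exp k" if "Poly_Mapping.lookup n j \<noteq> 0"
    using that by (auto intro!: poly_mapping_eqI simp: lookup_add lookup_minus lookup_single when_def)
  then show ?case
    by (cases "Poly_Mapping.lookup n j = 0")
      (auto simp: pvar_mult_single pd_single lookup_add lookup_single when_def monom_diff_add algebra_simps single_add)
next
  case (add p q)
  then show ?case by (simp add: distrib_left pd_add)
qed

lemma pd_commute: "pd i (pd j p) = pd j (pd i p)"
  by (rule poly_mapping_eqI) (simp add: lookup_pd lookup_add lookup_single when_def ac_simps)

text \<open>The operators \<open>x\<^sub>i \<partial>\<^sub>j\<close> preserve the degree, and brackets with quadratic polynomials are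
  combinations of them (\<open>bracket_quadratic\<close>). They obey the relations of \<open>gl(4)\<close>, which spares a
  proof of the Jacobi identity for the Poisson bracket.\<close>

lift_definition mult_pd :: "4 \<Rightarrow> 4 \<Rightarrow> ham \<Rightarrow> ham" is "\<lambda>i j p. pvar i * pd j p"
proof -
  fix i j m and p :: poly4
  assume p: "\<And>m. m \<in> Poly_Mapping.keys p \<Longrightarrow> 2 \<le> mdeg m" and "m \<in> Poly_Mapping.keys (pvar i * pd j p)"
  then obtain n where "m = unit_exp i + n" "n \<in> Poly_Mapping.keys (pd j p)"
    using keys_mult[of "pvar i" "pd j p"] by (auto simp: pvar_def split: if_splits)
  with p[OF keys_pd] show "2 \<le> mdeg m"
    by (simp add: mdeg_add mdeg_single)
qed

lemma ham_eqI: "poly_of_ham f = poly_of_ham g \<Longrightarrow> f = g"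
  by (simp add: poly_of_ham_inject)

lemma pd_scaleR: "pd j (c *\<^sub>R p) = c *\<^sub>R pd j p"
  by (rule poly_mapping_eqI) (simp add: lookup_pd lookup_scaleR4)

lemma scaleR4_eq_mult: "c *\<^sub>R p = Poly_Mapping.single 0 c * (p :: poly4)"
proof (induction p rule: poly4_induct)
  case (single n d)
  then show ?case
    by (intro poly_mapping_eqI) (simp add: lookup_scaleR4 mult_single lookup_single when_def)
qed (simp_all add: distrib_left scaleR_add_right)

lemma mult_scaleR4: "q * (c *\<^sub>R p) = c *\<^sub>R (q * p :: poly4)"
  by (simp only: scaleR4_eq_mult mult.left_commute)

lemma linear_mult_pd: "linear (mult_pd i j)"
  by (rule linearI; rule ham_eqI)
    (simp_all add: mult_pd.rep_eq plus_ham.rep_eq scaleR_ham.rep_eq pd_add pd_scaleR distrib_left mult_scaleR4)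

lemma mult_pd_commutator:
  "mult_pd i j (mult_pd k l f) - mult_pd k l (mult_pd i j f) = (if j = k then mult_pd i l f else 0) - (if l = i then mult_pd k j f else 0)"
  by (rule ham_eqI) (auto simp: mult_pd.rep_eq minus_ham.rep_eq zero_ham.rep_eq pd_pvar_mult pd_commute[of j l] algebra_simps)

lemma mult_pd_mono_ham:
  assumes "2 \<le> mdeg n"
  shows "mult_pd i j (mono_ham n) = real (Poly_Mapping.lookup n j) *\<^sub>R mono_ham (n - unit_exp j + unit_exp i)"
proof (cases "Poly_Mapping.lookup n j = 0")
  case True
  then show ?thesis
    using assms by (intro ham_eqI) (simp add: mult_pd.rep_eq poly_of_mono_ham pd_single scaleR_ham.rep_eq zero_ham.rep_eq)
next
  case False
  then have "mdeg (n - unit_exp j + unit_exp i) = mdeg n"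
    using arg_cong[OF monom_diff_add[OF False], of mdeg] by (simp add: mdeg_add mdeg_single)
  then show ?thesis
    using assms
    by (intro ham_eqI, simp add: mult_pd.rep_eq poly_of_mono_ham pd_single scaleR_ham.rep_eq
        pvar_mult_single, intro poly_mapping_eqI, simp add: lookup_scaleR4 lookup_single when_def)
qed

text \<open>The sum, over all argument positions, of the cochain with \<open>D\<close> applied at that position. The
  recursion on the argument list makes induction with interior products immediate.\<close>

fun derivation_act :: "(ham \<Rightarrow> ham) \<Rightarrow> cochain \<Rightarrow> cochain" where
  "derivation_act D \<sigma> [] = 0"
| "derivation_act D \<sigma> (f # fs) = \<sigma> (D f # fs) + derivation_act D (interior_product f \<sigma>) fs"

lemma interior_apply: "interior_product f \<sigma> fs = \<sigma> (f # fs)"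
  by (simp add: interior_product_def)

lemma interior_simps:
  "interior_product f (\<sigma> + \<tau>) = interior_product f \<sigma> + interior_product f \<tau>"
  "interior_product f (\<sigma> - \<tau>) = interior_product f \<sigma> - interior_product f \<tau>"
  "interior_product f (- \<sigma>) = - interior_product f \<sigma>"
  "interior_product f (c *\<^sub>R \<sigma>) = c *\<^sub>R interior_product f \<sigma>"
  "interior_product f 0 = 0"
  by (simp_all add: fun_eq_iff interior_product_def)

lemma linear_derivation_act: "linear (derivation_act D)"
proof (rule linearI; rule ext)
  fix \<sigma> \<tau> :: cochain and c :: real and fs
  show "derivation_act D (\<sigma> + \<tau>) fs = (derivation_act D \<sigma> + derivation_act D \<tau>) fs"
    by (induction fs arbitrary: \<sigma> \<tau>) (simp_all add: interior_simps)
  show "derivation_act D (c *\<^sub>R \<sigma>) fs = (c *\<^sub>R derivation_act D \<sigma>) fs"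
    by (induction fs arbitrary: \<sigma>) (simp_all add: interior_simps algebra_simps)
qed

lemmas derivation_act_simps = linear_derivation_act[THEN linear_add] linear_derivation_act[THEN linear_diff] linear_derivation_act[THEN linear_neg]
  linear_derivation_act[THEN linear_cmul] linear_derivation_act[THEN linear_0]

lemma interior_derivation_act: "interior_product f (derivation_act D \<sigma>) = interior_product (D f) \<sigma> + derivation_act D (interior_product f \<sigma>)"
  by (simp add: fun_eq_iff interior_product_def)

lemma derivation_act_nonzeroE:
  assumes "derivation_act D \<sigma> fs \<noteq> 0"
  obtains xs f ys where "fs = xs @ f # ys" "\<sigma> (xs @ D f # ys) \<noteq> 0"
proof -
  have "\<exists>xs f ys. fs = xs @ f # ys \<and> \<sigma> (xs @ D f # ys) \<noteq> 0"
    using assms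
  proof (induction fs arbitrary: \<sigma>)
    case (Cons x fs)
    from Cons.prems consider "\<sigma> (D x # fs) \<noteq> 0" | "derivation_act D (interior_product x \<sigma>) fs \<noteq> 0"
      by fastforce
    then show ?case
    proof cases
      case 1
      then show ?thesis by (metis append_Nil)
    next
      case 2
      from Cons.IH[OF this] show ?thesis
        unfolding interior_apply by (metis append_Cons)
    qed
  qed simp
  then show thesis using that by blast
qed

lemma multilinear_interior:
  assumes "multilinear \<sigma>"
  shows "multilinear (interior_product f \<sigma>)"
  unfolding multilinear_def interior_product_def
proof (intro allI)
  show "linear (\<lambda>g. \<sigma> (f # xs @ g # ys))" for xs ys
    using assms[unfolded multilinear_def, rule_format, of "f # xs" ys] by simp
qed

lemma alternating_interior:
  assumes "alternating \<sigma>"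
  shows "alternating (interior_product h \<sigma>)"
  unfolding alternating_def interior_product_def
proof (intro allI)
  show "\<sigma> (h # xs @ f # g # ys) = - \<sigma> (h # xs @ g # f # ys)" for xs f g ys
    using assms[unfolded alternating_def, rule_format, of "h # xs" f g ys] by simp
qed

lemma multilinear_headD: "multilinear \<sigma> \<Longrightarrow> linear (\<lambda>f. \<sigma> (f # fs))"
  by (auto simp: multilinear_def dest: spec[of _ "[]"])

lemma linear_interior:
  assumes "multilinear \<sigma>"
  shows "linear (\<lambda>f. interior_product f \<sigma>)"
  by (rule linearI) (simp_all add: interior_product_linear assms)

text \<open>Terms in which the two derivations hit different arguments cancel. The order is reversed
  because precomposition is contravariant.\<close>

lemma derivation_act_commutator:
  assumes "multilinear \<sigma>" and D: "\<And>f. D' (D f) - D (D' f) = C f"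
  shows "derivation_act D (derivation_act D' \<sigma>) fs - derivation_act D' (derivation_act D \<sigma>) fs = derivation_act C \<sigma> fs"
  using assms(1)
proof (induction fs arbitrary: \<sigma>)
  case (Cons f fs)
  have "\<sigma> (D' (D f) # fs) - \<sigma> (D (D' f) # fs) = \<sigma> (C f # fs)"
    using linear_diff[OF multilinear_headD[OF Cons.prems, of fs], of "D' (D f)" "D (D' f)"] by (simp only: D)
  with Cons.IH[OF multilinear_interior[OF Cons.prems, of f]] show ?case
    by (simp add: interior_derivation_act derivation_act_simps)
qed simp

lemma derivation_act_linear_arg:
  assumes "multilinear \<sigma>"
  shows "derivation_act (\<lambda>f. D f + D' f) \<sigma> fs = derivation_act D \<sigma> fs + derivation_act D' \<sigma> fs"
    "derivation_act (\<lambda>f. D f - D' f) \<sigma> fs = derivation_act D \<sigma> fs - derivation_act D' \<sigma> fs"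
    "derivation_act (\<lambda>f. c *\<^sub>R D f) \<sigma> fs = c * derivation_act D \<sigma> fs"
    "derivation_act (\<lambda>f. 0) \<sigma> fs = 0"
proof -
  have "derivation_act (\<lambda>f. D f + D' f) \<sigma> fs = derivation_act D \<sigma> fs + derivation_act D' \<sigma> fs
      \<and> derivation_act (\<lambda>f. D f - D' f) \<sigma> fs = derivation_act D \<sigma> fs - derivation_act D' \<sigma> fs
      \<and> derivation_act (\<lambda>f. c *\<^sub>R D f) \<sigma> fs = c * derivation_act D \<sigma> fs \<and> derivation_act (\<lambda>f. 0) \<sigma> fs = 0"
    using assms
  proof (induction fs arbitrary: \<sigma>)
    case (Cons f fs)
    note lin = multilinear_headD[OF Cons.prems, of fs]
    show ?case
      using Cons.IH[OF multilinear_interior[OF Cons.prems, of f]] linear_add[OF lin, of "D f" "D' f"]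
        linear_diff[OF lin, of "D f" "D' f"] linear_cmul[OF lin, of c "D f"] linear_0[OF lin]
      by (simp add: algebra_simps)
  qed simp
  then show "derivation_act (\<lambda>f. D f + D' f) \<sigma> fs = derivation_act D \<sigma> fs + derivation_act D' \<sigma> fs"
    "derivation_act (\<lambda>f. D f - D' f) \<sigma> fs = derivation_act D \<sigma> fs - derivation_act D' \<sigma> fs"
    "derivation_act (\<lambda>f. c *\<^sub>R D f) \<sigma> fs = c * derivation_act D \<sigma> fs" "derivation_act (\<lambda>f. 0) \<sigma> fs = 0"
    by blast+
qed

lemma alternating_derivation_act:
  assumes "alternating \<sigma>"
  shows "alternating (derivation_act D \<sigma>)"
proof -
  have "derivation_act D \<sigma> (xs @ f # g # ys) = - derivation_act D \<sigma> (xs @ g # f # ys)" for xs f g ys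
    using assms
  proof (induction xs arbitrary: \<sigma>)
    case Nil
    have sw: "\<sigma> (f # g # fs) = - \<sigma> (g # f # fs)" for f g fs
      using Nil.prems[unfolded alternating_def, rule_format, of "[]" f g fs] by simp
    have "interior_product g (interior_product f \<sigma>) = - interior_product f (interior_product g \<sigma>)"
      using sw[of f g] by (auto simp: fun_eq_iff interior_product_def)
    then show ?case
      using sw[of "D f" g] sw[of "D g" f] by (simp add: derivation_act_simps interior_apply)
  next
    case (Cons x xs)
    have "\<sigma> (D x # xs @ f # g # ys) = - \<sigma> (D x # xs @ g # f # ys)"
      using Cons.prems[unfolded alternating_def, rule_format, of "D x # xs" f g ys] by simp
    then show ?case
      using Cons.IH[OF alternating_interior[OF Cons.prems]] by simp
  qed
  then show ?thesis unfolding alternating_def by blast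
qed

lemma multilinear_derivation_act:
  assumes "linear D" "multilinear \<sigma>"
  shows "multilinear (derivation_act D \<sigma>)"
proof -
  have "linear (\<lambda>f. derivation_act D \<sigma> (xs @ f # ys))" for xs ys
    using assms(2)
  proof (induction xs arbitrary: \<sigma>)
    case Nil
    have "linear (\<lambda>f. \<sigma> (D f # ys))"
      using linear_compose[OF assms(1) multilinear_headD[OF Nil]] by (simp add: o_def)
    moreover have "linear (\<lambda>f. derivation_act D (interior_product f \<sigma>) ys)"
      by (rule linearI) (simp_all add: linear_interior[OF Nil, THEN linear_add] linear_interior[OF Nil, THEN linear_cmul] derivation_act_simps)
    ultimately show ?case by (simp add: linear_compose_add)
  next
    case (Cons x xs)
    have "linear (\<lambda>f. \<sigma> ((D x # xs) @ f # ys))"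
      using Cons.prems[unfolded multilinear_def, rule_format, of "D x # xs" ys] .
    then show ?case
      using Cons.IH[OF multilinear_interior[OF Cons.prems]] by (simp add: linear_compose_add)
  qed
  then show ?thesis unfolding multilinear_def by blast
qed

text \<open>The sign in \<open>choose1\<close> is the sign of moving the argument at position \<open>j\<close> to the front.\<close>

lemma choose1_eq_derivation_act:
  assumes "alternating \<sigma>"
  shows "choose1 (\<lambda>u. interior_product (D u) \<sigma>) fs = derivation_act D \<sigma> fs"
  using assms
proof (induction fs arbitrary: \<sigma>)
  case (Cons f fs)
  have "interior_product f (interior_product (D u) \<sigma>) = - interior_product (D u) (interior_product f \<sigma>)" for u
    using Cons.prems[unfolded alternating_def, rule_format, of "[]" "D u" f]
    by (simp add: fun_eq_iff interior_product_def)
  then have "choose1 (\<lambda>u. interior_product f (interior_product (D u) \<sigma>)) fs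
      = (- choose1 (\<lambda>u. interior_product (D u) (interior_product f \<sigma>))) fs"
    by (simp only: choose1_minus)
  also have "\<dots> = - derivation_act D (interior_product f \<sigma>) fs"
    using Cons.IH[OF alternating_interior[OF Cons.prems]] by (simp only: fun_Compl_def)
  finally show ?case
    by (simp only: choose1_Cons derivation_act.simps diff_minus_eq_add) (simp only: interior_product_def)
qed (simp add: choose1_Nil)

text \<open>For \<open>i\<^sub>q \<sigma> = 0\<close>, Cartan's formula reduces \<open>i\<^sub>q d \<sigma>\<close> to the Lie derivative along \<open>q\<close>.
  Of the pairs summed in the coboundary only those containing the new argument \<open>q\<close> survive.\<close>

lemma cartan_formula:
  assumes "alternating \<sigma>" "interior_product q \<sigma> = 0"
  shows "interior_product q (coboundary \<sigma>) = - derivation_act (bracket q) \<sigma>"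
proof -
  have "interior_product q (interior_product g \<sigma>) = 0" for g
  proof
    fix fs
    have "\<sigma> (g # q # fs) = - \<sigma> (q # g # fs)"
      using assms(1)[unfolded alternating_def, rule_format, of "[]" g q fs] by simp
    then show "interior_product q (interior_product g \<sigma>) fs = 0 fs"
      using fun_cong[OF assms(2), of "g # fs"] by (simp add: interior_product_def)
  qed
  then have "choose2 (\<lambda>u v. interior_product q (interior_product (bracket u v) \<sigma>)) = 0"
    by (simp add: fun_eq_iff choose2_def)
  then show ?thesis
    using choose1_eq_derivation_act[OF assms(1), of "bracket q"]
    by (auto simp: coboundary_choose2 interior_choose2 fun_eq_iff)
qed

section \<open>Monomial bases of spaces of cochains\<close>

lemma sum_fun_apply: "(sum g A) x = (\<Sum>a\<in>A. g a x)"
  by (induction A rule: infinite_finite_induct) simp_all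

lemma alternatingD: "alternating \<sigma> \<Longrightarrow> \<sigma> (xs @ f # g # ys) = - \<sigma> (xs @ g # f # ys)"
  unfolding alternating_def by blast

lemma alternating_not_distinct:
  assumes "alternating \<sigma>" "\<not> distinct fs"
  shows "\<sigma> fs = 0"
proof -
  have "\<sigma> (xs @ y # ys @ y # zs) = 0" for xs y ys zs
  proof (induction ys arbitrary: xs)
    case Nil
    show ?case using alternatingD[OF assms(1), of xs y y zs] by simp
  next
    case (Cons z ys)
    show ?case
      using alternatingD[OF assms(1), of xs y z "ys @ y # zs"] Cons[of "xs @ [z]"] by simp
  qed
  with not_distinct_decomp[OF assms(2)] show ?thesis by force
qed

lemma alternating_move:
  assumes "alternating \<sigma>" "\<sigma> (x # as @ bs) = 0"
  shows "\<sigma> (as @ x # bs) = 0"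
  using assms(2)
proof (induction as arbitrary: bs rule: rev_induct)
  case (snoc a as)
  then show ?case
    using alternatingD[OF assms(1), of as a x bs] by simp
qed simp

lemma alternating_perm:
  assumes "alternating \<sigma>" "mset xs = mset ys" "\<sigma> xs = 0"
  shows "\<sigma> ys = 0"
  using assms
proof (induction xs arbitrary: ys \<sigma>)
  case (Cons x xs)
  have "x \<in> set ys"
    using Cons.prems(2) by (metis list.set_intros(1) mset_eq_setD)
  then obtain as bs where ys: "ys = as @ x # bs" by (meson split_list)
  have "interior_product x \<sigma> (as @ bs) = 0"
  proof (rule Cons.IH)
    show "alternating (interior_product x \<sigma>)"
      by (rule alternating_interior[OF Cons.prems(1)])
    show "mset xs = mset (as @ bs)"
      using Cons.prems(2) ys by simp
    show "interior_product x \<sigma> xs = 0"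
      using Cons.prems(3) by (simp add: interior_product_def)
  qed
  then show ?case
    unfolding ys using alternating_move[OF Cons.prems(1)] by (simp add: interior_product_def)
qed simp

text \<open>Every potential is a combination of monomials, so a multilinear cochain vanishes as soon as it
  does so on lists of monomials.\<close>

lemma multilinear_mono_zero:
  assumes "multilinear \<sigma>" "length fs = k"
    and "\<And>ns. \<forall>n\<in>set ns. 2 \<le> mdeg n \<Longrightarrow> length ns = k \<Longrightarrow> \<sigma> (map mono_ham ns) = 0"
  shows "\<sigma> fs = 0"
  using assms
proof (induction fs arbitrary: \<sigma> k)
  case Nil
  then show ?case using Nil(3)[of "[]"] by simp
next
  case (Cons f fs)
  have "interior_product f \<sigma> fs = 0"
  proof (rule Cons.IH[OF multilinear_interior[OF Cons.prems(1)] refl])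
    fix ns assume ns: "\<forall>n\<in>set ns. 2 \<le> mdeg n" "length ns = length fs"
    let ?K = "Poly_Mapping.keys (poly_of_ham f)"
    note lin = multilinear_headD[OF Cons.prems(1)]
    have "\<sigma> (f # map mono_ham ns) = \<sigma> ((\<Sum>n\<in>?K. coef n f *\<^sub>R mono_ham n) # map mono_ham ns)"
      using ham_expand[of f] by simp
    also have "\<dots> = (\<Sum>n\<in>?K. coef n f * \<sigma> (map mono_ham (n # ns)))"
      by (simp add: linear_sum[OF lin] linear_cmul[OF lin])
    also have "\<dots> = 0"
    proof (rule sum.neutral, rule ballI)
      fix n assume "n \<in> ?K"
      then have "2 \<le> mdeg n" using poly_of_ham[of f] by simp
      then have "\<sigma> (map mono_ham (n # ns)) = 0"
        using ns Cons.prems(2) by (intro Cons.prems(3)) auto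
      then show "coef n f * \<sigma> (map mono_ham (n # ns)) = 0" by simp
    qed
    finally show "interior_product f \<sigma> (map mono_ham ns) = 0"
      by (simp add: interior_product_def)
  qed
  then show ?case by (simp add: interior_product_def)
qed

definition monomials :: "monom4 list \<Rightarrow> bool"
  where "monomials ns \<longleftrightarrow> (\<forall>n\<in>set ns. 2 \<le> mdeg n)"

lemma multilinear_eqI:
  assumes "multilinear \<sigma>" "multilinear \<tau>" "\<And>ns. monomials ns \<Longrightarrow> \<sigma> (map mono_ham ns) = \<tau> (map mono_ham ns)"
  shows "\<sigma> = \<tau>"
proof -
  have "multilinear (\<sigma> - \<tau>)"
    using assms(1,2) by (auto simp: multilinear_def intro: linear_compose_sub)
  then have "(\<sigma> - \<tau>) fs = 0" for fs
    by (rule multilinear_mono_zero[OF _ refl]) (simp add: assms(3) monomials_def)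
  then show ?thesis by (simp add: fun_eq_iff)
qed

lemma mono_ham_inj: "2 \<le> mdeg m \<Longrightarrow> 2 \<le> mdeg n \<Longrightarrow> mono_ham m = mono_ham n \<longleftrightarrow> m = n"
  by (metis poly_of_mono_ham keys_single zero_neq_one singleton_inject)

lemma distinct_map_mono_ham: "monomials ns \<Longrightarrow> distinct (map mono_ham ns) \<longleftrightarrow> distinct ns"
  by (auto simp: distinct_map inj_on_def mono_ham_inj monomials_def)

lemma linear_coef: "linear (coef n)"
  by (rule linearI) (simp_all add: coef_def plus_ham.rep_eq scaleR_ham.rep_eq lookup_add lookup_scaleR4)

lemma coef_mono_ham: "2 \<le> mdeg n \<Longrightarrow> coef m (mono_ham n) = (if n = m then 1 else 0)"
  by (simp add: coef_def poly_of_mono_ham lookup_single when_def)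

text \<open>Cochains supported on the monomial lists whose set of entries belongs to \<open>\<T>\<close>. An alternating
  cochain vanishes on lists with repetitions, so a list may be replaced by its set.\<close>

definition cochain_space :: "monom4 set set \<Rightarrow> cochain set"
  where "cochain_space \<T> = {\<sigma>. multilinear \<sigma> \<and> alternating \<sigma>
    \<and> (\<forall>ns. monomials ns \<longrightarrow> \<sigma> (map mono_ham ns) \<noteq> 0 \<longrightarrow> set ns \<in> \<T>)}"

lemma subspace_multilinear: "subspace {\<sigma>. multilinear \<sigma>}"
proof (rule subspaceI, safe)
  fix \<sigma> \<tau> :: cochain and c :: real
  show "multilinear 0"
    by (auto simp: multilinear_def intro!: linearI)
  show "multilinear (\<sigma> + \<tau>)" if "multilinear \<sigma>" "multilinear \<tau>"
    using that by (auto simp: multilinear_def intro: linear_compose_add)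
  show "multilinear (c *\<^sub>R \<sigma>)" if "multilinear \<sigma>"
    unfolding multilinear_def scaleR_fun_apply
    by (intro allI linear_compose_scale_right that[unfolded multilinear_def, rule_format])
qed

lemma subspace_alternating: "subspace {\<sigma>. alternating \<sigma>}"
proof (rule subspaceI, safe)
  fix \<sigma> \<tau> :: cochain and c :: real
  show "alternating 0"
    by (simp add: alternating_def)
  show "alternating (\<sigma> + \<tau>)" if "alternating \<sigma>" "alternating \<tau>"
    unfolding alternating_def
  proof (intro allI)
    fix xs f g ys
    show "(\<sigma> + \<tau>) (xs @ f # g # ys) = - (\<sigma> + \<tau>) (xs @ g # f # ys)"
      using alternatingD[OF that(1), of xs f g ys] alternatingD[OF that(2), of xs f g ys] by simp
  qed
  show "alternating (c *\<^sub>R \<sigma>)" if "alternating \<sigma>"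
    unfolding alternating_def
  proof (intro allI)
    fix xs f g ys
    show "(c *\<^sub>R \<sigma>) (xs @ f # g # ys) = - (c *\<^sub>R \<sigma>) (xs @ g # f # ys)"
      using alternatingD[OF that, of xs f g ys] by simp
  qed
qed

lemma subspace_cochain_space: "subspace (cochain_space \<T>)"
proof -
  have "subspace {\<sigma> :: cochain. \<forall>ns. monomials ns \<longrightarrow> \<sigma> (map mono_ham ns) \<noteq> 0 \<longrightarrow> set ns \<in> \<T>}"
  proof (rule subspaceI, safe)
    fix \<sigma> \<tau> :: cochain and ns
    assume "\<forall>ns. monomials ns \<longrightarrow> \<sigma> (map mono_ham ns) \<noteq> 0 \<longrightarrow> set ns \<in> \<T>"
      "\<forall>ns. monomials ns \<longrightarrow> \<tau> (map mono_ham ns) \<noteq> 0 \<longrightarrow> set ns \<in> \<T>"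
      "monomials ns" "(\<sigma> + \<tau>) (map mono_ham ns) \<noteq> 0"
    then show "set ns \<in> \<T>"
      by (cases "\<sigma> (map mono_ham ns) = 0") auto
  qed auto
  from subspace_inter[OF subspace_multilinear subspace_inter[OF subspace_alternating this]]
  show ?thesis
    by (simp add: cochain_space_def Int_def)
qed

lemma cochain_space_distinct:
  assumes "\<sigma> \<in> cochain_space \<T>" "monomials ns" "\<sigma> (map mono_ham ns) \<noteq> 0"
  shows "distinct ns" "set ns \<in> \<T>"
  using assms alternating_not_distinct[of \<sigma> "map mono_ham ns"] by (auto simp: cochain_space_def distinct_map_mono_ham)

lemma cochain_space_mono: "\<S> \<subseteq> \<T> \<Longrightarrow> cochain_space \<S> \<subseteq> cochain_space \<T>"
  by (auto simp: cochain_space_def)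

text \<open>Expanding along the first factor: on monomials, \<open>coef m\<close> must consume an argument equal to
  \<open>m\<close>.\<close>

lemma wedge_coef_nonzero:
  assumes "wedge (one_cochain (coef m)) \<beta> (map mono_ham ns) \<noteq> 0" "monomials ns"
  shows "\<exists>xs ys. ns = xs @ m # ys \<and> \<beta> (map mono_ham (xs @ ys)) \<noteq> 0"
  using assms
proof (induction ns arbitrary: \<beta>)
  case (Cons n ns)
  from Cons.prems have n: "2 \<le> mdeg n" "monomials ns" by (auto simp: monomials_def)
  from Cons.prems(1) consider "n = m" "\<beta> (map mono_ham ns) \<noteq> 0"
    | "wedge (one_cochain (coef m)) (interior_product (mono_ham n) \<beta>) (map mono_ham ns) \<noteq> 0"
    using n by (fastforce simp: wedge_one_Cons coef_mono_ham split: if_splits)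
  then show ?case
  proof cases
    case 1
    then show ?thesis by (intro exI[of _ "[]"] exI[of _ ns]) simp
  next
    case 2
    from Cons.IH[OF this n(2)] obtain xs ys where
      "ns = xs @ m # ys" "interior_product (mono_ham n) \<beta> (map mono_ham (xs @ ys)) \<noteq> 0" by blast
    then show ?thesis
      by (intro exI[of _ "n # xs"] exI[of _ ys]) (simp add: interior_product_def)
  qed
qed (simp add: wedge_one_Nil)

definition dual_monomial :: "monom4 list \<Rightarrow> cochain"
  where "dual_monomial ms = wedge_list (map coef ms)"

lemma dual_monomial_nonzero:
  assumes "dual_monomial ms (map mono_ham ns) \<noteq> 0" "monomials ns"
  shows "mset ns = mset ms"
  using assms
proof (induction ms arbitrary: ns)
  case Nil
  then show ?case
    by (auto simp: dual_monomial_def wedge_list_Nil unit_cochain_def split: if_splits)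
next
  case (Cons m ms)
  then obtain xs ys where ns: "ns = xs @ m # ys" "dual_monomial ms (map mono_ham (xs @ ys)) \<noteq> 0"
    using wedge_coef_nonzero[of m "dual_monomial ms" ns] by (auto simp: dual_monomial_def wedge_list_Cons)
  then have "mset (xs @ ys) = mset ms"
    using Cons.prems(2) by (intro Cons.IH) (auto simp: monomials_def)
  then show ?case by (simp add: ns(1))
qed

lemma dual_monomial_self:
  assumes "monomials ms" "distinct ms"
  shows "dual_monomial ms (map mono_ham ms) = 1"
  using assms
proof (induction ms)
  case Nil
  then show ?case by (simp add: dual_monomial_def wedge_list_Nil unit_cochain_def)
next
  case (Cons m ms)
  have "wedge (one_cochain (coef m)) (interior_product (mono_ham m) (dual_monomial ms)) (map mono_ham ms) = 0"
    using wedge_coef_nonzero[of m _ ms] Cons.prems by (fastforce simp: monomials_def)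
  moreover have "2 \<le> mdeg m" "dual_monomial ms (map mono_ham ms) = 1"
    using Cons by (auto simp: monomials_def)
  ultimately show ?case
    by (simp add: dual_monomial_def wedge_list_Cons wedge_one_Cons coef_mono_ham)
qed

lemma dual_monomial_multilinear: "multilinear (dual_monomial ms)"
  and dual_monomial_alternating: "alternating (dual_monomial ms)"
proof -
  have "multilinear (dual_monomial ms) \<and> alternating (dual_monomial ms)"
  proof (induction ms)
    case Nil
    then show ?case
      by (auto simp: dual_monomial_def wedge_list_Nil multilinear_def alternating_def unit_cochain_def intro!: linearI)
  next
    case (Cons m ms)
    then show ?case
      using multilinear_wedge_one[OF linear_coef] alternating_wedge_one
      by (simp add: dual_monomial_def wedge_list_Cons)
  qed
  then show "multilinear (dual_monomial ms)" "alternating (dual_monomial ms)" by blast+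
qed

text \<open>Sorting by degree lets \<open>map mdeg (listing A)\<close> agree with \<open>factor_degrees\<close>, as is needed in
  \<open>cells_cochains\<close>.\<close>

definition listing :: "monom4 set \<Rightarrow> monom4 list"
  where "listing A = (SOME ns. set ns = A \<and> distinct ns \<and> sorted (map mdeg ns))"

lemma listing:
  assumes "finite A"
  shows "set (listing A) = A" "distinct (listing A)" "sorted (map mdeg (listing A))"
proof -
  obtain ns where "set ns = A" "distinct ns"
    using finite_distinct_list[OF assms] by blast
  then have "\<exists>ns. set ns = A \<and> distinct ns \<and> sorted (map mdeg ns)"
    by (intro exI[of _ "sort_key mdeg ns"]) simp
  from someI_ex[OF this] show "set (listing A) = A" "distinct (listing A)" "sorted (map mdeg (listing A))"
    unfolding listing_def by blast+
qed

locale monomial_sets =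
  fixes \<T> :: "monom4 set set"
  assumes finite_sets: "finite \<T>" and sets: "A \<in> \<T> \<Longrightarrow> finite A" "A \<in> \<T> \<Longrightarrow> n \<in> A \<Longrightarrow> 2 \<le> mdeg n"
begin

abbreviation "\<phi> A \<equiv> dual_monomial (listing A)"

lemma monomials_listing: "A \<in> \<T> \<Longrightarrow> monomials (listing A)"
  using sets listing(1) by (auto simp: monomials_def)

text \<open>The cochains \<open>\<phi> A\<close> and evaluation at the listings of the sets form dual bases.\<close>

lemma dual_monomial_listing:
  assumes "A \<in> \<T>" "B \<in> \<T>"
  shows "\<phi> B (map mono_ham (listing A)) = (if A = B then 1 else 0)"
proof (cases "A = B")
  case True
  then show ?thesis
    using dual_monomial_self[OF monomials_listing] listing(2) sets(1) assms by simp
next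
  case False
  then have "mset (listing A) \<noteq> mset (listing B)"
    using listing(1) sets(1) assms by (metis set_mset_mset)
  then show ?thesis
    using dual_monomial_nonzero[of "listing B" "listing A"] monomials_listing assms False by auto
qed

lemma cochain_space_eqI:
  assumes "\<sigma> \<in> cochain_space \<T>" "\<tau> \<in> cochain_space \<T>"
    and eq: "\<And>A. A \<in> \<T> \<Longrightarrow> \<sigma> (map mono_ham (listing A)) = \<tau> (map mono_ham (listing A))"
  shows "\<sigma> = \<tau>"
proof -
  let ?\<rho> = "\<sigma> - \<tau>"
  have \<rho>: "?\<rho> \<in> cochain_space \<T>"
    using assms(1,2) by (rule subspace_diff[OF subspace_cochain_space])
  have "?\<rho> (map mono_ham ns) = 0" if ns: "monomials ns" for ns
  proof (rule ccontr)
    assume nz: "?\<rho> (map mono_ham ns) \<noteq> 0"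
    note d = cochain_space_distinct[OF \<rho> ns nz]
    have "mset (map mono_ham (listing (set ns))) = mset (map mono_ham ns)"
      using d listing[of "set ns"] by (metis List.finite_set mset_map set_eq_iff_mset_eq_distinct)
    moreover have "?\<rho> (map mono_ham (listing (set ns))) = 0"
      using eq[OF d(2)] by simp
    moreover have "alternating ?\<rho>"
      using \<rho> by (simp only: cochain_space_def mem_Collect_eq)
    ultimately show False
      using alternating_perm nz by blast
  qed
  then show ?thesis
    using assms(1,2) by (intro multilinear_eqI) (auto simp: cochain_space_def)
qed

lemma dual_monomial_cochain_space:
  assumes "A \<in> \<T>"
  shows "\<phi> A \<in> cochain_space \<T>"
proof -
  have "set ns \<in> \<T>" if "monomials ns" "\<phi> A (map mono_ham ns) \<noteq> 0" for ns
    using dual_monomial_nonzero[OF that(2,1)] listing(1)[OF sets(1)[OF assms]] assms by (metis set_mset_mset)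
  then show ?thesis
    by (auto simp: cochain_space_def dual_monomial_multilinear dual_monomial_alternating)
qed

lemma cochain_space_span: "cochain_space \<T> = span (\<phi> ` \<T>)"
proof (rule antisym)
  show "span (\<phi> ` \<T>) \<subseteq> cochain_space \<T>"
    by (rule span_minimal[OF _ subspace_cochain_space]) (auto simp: dual_monomial_cochain_space)
  show "cochain_space \<T> \<subseteq> span (\<phi> ` \<T>)"
  proof
    fix \<sigma> assume \<sigma>: "\<sigma> \<in> cochain_space \<T>"
    let ?\<tau> = "\<Sum>A\<in>\<T>. \<sigma> (map mono_ham (listing A)) *\<^sub>R \<phi> A"
    have "\<sigma> = ?\<tau>"
    proof (rule cochain_space_eqI[OF \<sigma>])
      show "?\<tau> \<in> cochain_space \<T>"
        by (intro subspace_sum subspace_scale subspace_cochain_space dual_monomial_cochain_space)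
      show "\<sigma> (map mono_ham (listing B)) = ?\<tau> (map mono_ham (listing B))" if "B \<in> \<T>" for B
        using that finite_sets by (simp add: sum_fun_apply dual_monomial_listing if_distrib[of "(*) _"] cong: if_cong)
    qed
    moreover have "?\<tau> \<in> span (\<phi> ` \<T>)"
      by (intro span_sum span_scale span_base) auto
    ultimately show "\<sigma> \<in> span (\<phi> ` \<T>)" by simp
  qed
qed

lemma dim_cochain_space: "dim (cochain_space \<T>) = card \<T>"
proof -
  have inj: "inj_on \<phi> \<T>"
  proof (rule inj_onI)
    fix A B assume "A \<in> \<T>" "B \<in> \<T>" "\<phi> A = \<phi> B"
    then show "A = B"
      using dual_monomial_listing[of A A] dual_monomial_listing[of A B] by (auto split: if_splits)
  qed
  have "independent (\<phi> ` \<T>)"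
  proof (rule real_vector.independent_if_scalars_zero)
    show "finite (\<phi> ` \<T>)" using finite_sets by simp
    fix f x assume 0: "(\<Sum>x\<in>\<phi> ` \<T>. f x *\<^sub>R x) = 0" and "x \<in> \<phi> ` \<T>"
    then obtain A where A: "A \<in> \<T>" "x = \<phi> A" by blast
    have "0 = (\<Sum>B\<in>\<T>. f (\<phi> B) *\<^sub>R \<phi> B) (map mono_ham (listing A))"
      using 0 by (simp add: sum.reindex[OF inj] o_def)
    also have "\<dots> = f (\<phi> A)"
      using A(1) finite_sets by (simp add: sum_fun_apply dual_monomial_listing if_distrib[of "(*) _"] cong: if_cong)
    finally show "f x = 0" using A(2) by simp
  qed
  then show ?thesis
    by (simp add: cochain_space_span real_vector.dim_eq_card_independent card_image[OF inj])
qed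

end

section \<open>The invariant inner product\<close>

definition mono_fact :: "monom4 \<Rightarrow> real"
  where "mono_fact n = (\<Prod>i\<in>UNIV. fact (Poly_Mapping.lookup n i))"

lemma mono_fact_pos: "mono_fact n > 0"
  by (simp add: mono_fact_def prod_pos)

text \<open>The weights \<open>1/n!\<close> make \<open>x\<^sub>i \<partial>\<^sub>j\<close> and \<open>x\<^sub>j \<partial>\<^sub>i\<close> adjoint: both sides equal \<open>1/k!\<close>
  for the monomial \<open>k\<close> obtained from \<open>n\<close> by removing one factor \<open>x\<^sub>j\<close>.\<close>

lemma mono_fact_shift:
  assumes "i \<noteq> j" "Poly_Mapping.lookup n j \<noteq> 0"
  shows "real (Poly_Mapping.lookup n j) / mono_fact n
    = real (Poly_Mapping.lookup (n - unit_exp j + unit_exp i) i) / mono_fact (n - unit_exp j + unit_exp i)"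
proof -
  define k where "k = n - unit_exp j"
  have n: "n = k + unit_exp j"
    unfolding k_def using monom_diff_add[OF assms(2)] by simp
  have fact: "mono_fact (k + unit_exp i) = real (Suc (Poly_Mapping.lookup k i)) * mono_fact k" for i
  proof -
    have "mono_fact (k + unit_exp i) = (\<Prod>l\<in>UNIV. (if l = i then real (Suc (Poly_Mapping.lookup k i)) else 1)
        * fact (Poly_Mapping.lookup k l))"
      unfolding mono_fact_def by (rule prod.cong) (auto simp: lookup_add lookup_single when_def)
    then show ?thesis
      by (simp add: prod.distrib mono_fact_def del: of_nat_Suc)
  qed
  have "real (Poly_Mapping.lookup (k + unit_exp l) l) / mono_fact (k + unit_exp l) = 1 / mono_fact k" for l
    unfolding fact by (simp add: lookup_add lookup_single)
  then show ?thesis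
    unfolding k_def[symmetric] n[symmetric] using n by metis
qed

text \<open>The inner product of the values on lists of \<open>k\<close> monomials from \<open>M\<close>, where the list
  \<open>n\<^sub>1, \<dots>, n\<^sub>k\<close> has weight \<open>1/(n\<^sub>1! \<cdots> n\<^sub>k!)\<close>. The recursion peels off
  one argument at a time by interior products.\<close>

primrec cochain_ip :: "monom4 set \<Rightarrow> nat \<Rightarrow> cochain \<Rightarrow> cochain \<Rightarrow> real" where
  "cochain_ip M 0 \<sigma> \<tau> = \<sigma> [] * \<tau> []"
| "cochain_ip M (Suc k) \<sigma> \<tau> = (\<Sum>n\<in>M. cochain_ip M k (interior_product (mono_ham n) \<sigma>) (interior_product (mono_ham n) \<tau>) / mono_fact n)"

lemma cochain_ip_sym: "cochain_ip M k \<sigma> \<tau> = cochain_ip M k \<tau> \<sigma>"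
  by (induction k arbitrary: \<sigma> \<tau>) (auto intro!: sum.cong)

lemma linear_cochain_ip: "linear (\<lambda>\<sigma>. cochain_ip M k \<sigma> \<tau>)"
proof (rule linearI)
  fix \<sigma> \<rho> :: cochain and c :: real
  show "cochain_ip M k (\<sigma> + \<rho>) \<tau> = cochain_ip M k \<sigma> \<tau> + cochain_ip M k \<rho> \<tau>"
    by (induction k arbitrary: \<sigma> \<rho> \<tau>) (simp_all add: distrib_right interior_simps add_divide_distrib sum.distrib)
  show "cochain_ip M k (c *\<^sub>R \<sigma>) \<tau> = c *\<^sub>R cochain_ip M k \<sigma> \<tau>"
    by (induction k arbitrary: \<sigma> \<tau>) (simp_all add: interior_simps sum_distrib_left)
qed

lemma cochain_ip_nonneg: "cochain_ip M k \<sigma> \<sigma> \<ge> 0"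
  by (induction k arbitrary: \<sigma>) (simp_all add: sum_nonneg mono_fact_pos less_imp_le)

lemma cochain_ip_zeroD:
  assumes "finite M" "cochain_ip M k \<sigma> \<sigma> = 0" "set ns \<subseteq> M" "length ns = k"
  shows "\<sigma> (map mono_ham ns) = 0"
  using assms(2-)
proof (induction k arbitrary: \<sigma> ns)
  case (Suc k)
  then obtain n ns' where ns: "ns = n # ns'" "n \<in> M" "set ns' \<subseteq> M" "length ns' = k"
    by (cases ns) auto
  have "cochain_ip M k (interior_product (mono_ham n) \<sigma>) (interior_product (mono_ham n) \<sigma>) / mono_fact n = 0"
    using Suc.prems(1) ns(2) assms(1) mono_fact_pos
    by (simp add: sum_nonneg_eq_0_iff cochain_ip_nonneg less_imp_le)
  then have "cochain_ip M k (interior_product (mono_ham n) \<sigma>) (interior_product (mono_ham n) \<sigma>) = 0"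
    using mono_fact_pos[of n] by simp
  from Suc.IH[OF this ns(3,4)] show ?case
    by (simp add: ns(1) interior_product_def)
qed simp

lemma mdeg_shift: "Poly_Mapping.lookup n j \<noteq> 0 \<Longrightarrow> mdeg (n - unit_exp j + unit_exp i) = mdeg n"
  using arg_cong[OF monom_diff_add, of n j mdeg] by (simp add: mdeg_add mdeg_single)

text \<open>The substitution of \<open>n - e\<^sub>j + e\<^sub>i\<close> for \<open>n\<close>. It is a bijection between the monomials
  divisible by \<open>x\<^sub>j\<close> and those divisible by \<open>x\<^sub>i\<close>; the others contribute zero.\<close>

lemma sum_monomial_shift:
  fixes g :: "monom4 \<Rightarrow> monom4 \<Rightarrow> real" and N :: nat
  defines "M \<equiv> {n. 2 \<le> mdeg n \<and> mdeg n \<le> N}"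
  shows "(\<Sum>n\<in>M. real (Poly_Mapping.lookup n j) / mono_fact n * g (n - unit_exp j + unit_exp i) n)
    = (\<Sum>n\<in>M. real (Poly_Mapping.lookup n i) / mono_fact n * g n (n - unit_exp i + unit_exp j))"
proof (cases "i = j")
  case True
  then show ?thesis
    by (intro sum.cong[OF refl]) (metis monom_diff_add mult_zero_left div_0 of_nat_0)
next
  case False
  have fin: "finite M"
    unfolding M_def by (rule finite_subset[OF _ finite_mdeg_le[of N]]) auto
  have inv: "n - unit_exp j + unit_exp i - unit_exp i + unit_exp j = n" if "Poly_Mapping.lookup n j \<noteq> 0" for n i j
    using monom_diff_add[OF that] by simp
  have pos: "Poly_Mapping.lookup (n - unit_exp j + unit_exp i) i \<noteq> 0" for n i j
    by (simp add: lookup_add lookup_single)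
  have "(\<Sum>n\<in>M. real (Poly_Mapping.lookup n j) / mono_fact n * g (n - unit_exp j + unit_exp i) n)
      = (\<Sum>n\<in>{n\<in>M. Poly_Mapping.lookup n j \<noteq> 0}. real (Poly_Mapping.lookup n j) / mono_fact n * g (n - unit_exp j + unit_exp i) n)"
    by (rule sum.mono_neutral_right) (auto simp: fin)
  also have "\<dots> = (\<Sum>n\<in>{n\<in>M. Poly_Mapping.lookup n i \<noteq> 0}. real (Poly_Mapping.lookup n i) / mono_fact n * g n (n - unit_exp i + unit_exp j))"
  proof (rule sum.reindex_bij_witness[of _ "\<lambda>n. n - unit_exp i + unit_exp j" "\<lambda>n. n - unit_exp j + unit_exp i"])
    fix n assume n: "n \<in> {n \<in> M. Poly_Mapping.lookup n j \<noteq> 0}"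
    then show "n - unit_exp j + unit_exp i - unit_exp i + unit_exp j = n" "n - unit_exp j + unit_exp i \<in> {n \<in> M. Poly_Mapping.lookup n i \<noteq> 0}"
      using inv[of n j i] pos[of n j i] mdeg_shift[of n j i] by (auto simp: M_def)
    show "real (Poly_Mapping.lookup (n - unit_exp j + unit_exp i) i) / mono_fact (n - unit_exp j + unit_exp i) *
        g (n - unit_exp j + unit_exp i) (n - unit_exp j + unit_exp i - unit_exp i + unit_exp j)
      = real (Poly_Mapping.lookup n j) / mono_fact n * g (n - unit_exp j + unit_exp i) n"
      using n inv[of n j i] mono_fact_shift[OF False, of n] by simp
  next
    fix n assume n: "n \<in> {n \<in> M. Poly_Mapping.lookup n i \<noteq> 0}"
    then show "n - unit_exp i + unit_exp j - unit_exp j + unit_exp i = n" "n - unit_exp i + unit_exp j \<in> {n \<in> M. Poly_Mapping.lookup n j \<noteq> 0}"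
      using inv[of n i j] pos[of n i j] mdeg_shift[of n i j] by (auto simp: M_def)
  qed
  also have "\<dots> = (\<Sum>n\<in>M. real (Poly_Mapping.lookup n i) / mono_fact n * g n (n - unit_exp i + unit_exp j))"
    by (rule sum.mono_neutral_left) (auto simp: fin)
  finally show ?thesis .
qed

lemmas cochain_ip_simps = linear_cochain_ip[THEN linear_add] linear_cochain_ip[THEN linear_cmul]

lemma cochain_ip_scale_right: "cochain_ip M k \<sigma> (c *\<^sub>R \<tau>) = c * cochain_ip M k \<sigma> \<tau>"
  by (simp only: cochain_ip_sym[of M k \<sigma>] cochain_ip_simps real_scaleR_def)

lemma cochain_ip_add_right: "cochain_ip M k \<sigma> (\<tau> + \<rho>) = cochain_ip M k \<sigma> \<tau> + cochain_ip M k \<sigma> \<rho>"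
  by (simp only: cochain_ip_sym[of M k \<sigma>] cochain_ip_simps)

lemma interior_mult_pd:
  assumes "multilinear \<sigma>" "2 \<le> mdeg n"
  shows "interior_product (mult_pd i j (mono_ham n)) \<sigma>
    = real (Poly_Mapping.lookup n j) *\<^sub>R interior_product (mono_ham (n - unit_exp j + unit_exp i)) \<sigma>"
  by (simp add: mult_pd_mono_ham assms interior_product_linear)

text \<open>Induction on the degree: the derivation either hits the first argument, where
  \<open>sum_monomial_shift\<close> applies, or one of the others, where the induction hypothesis does.\<close>

lemma cochain_ip_adjoint:
  assumes "multilinear \<sigma>" "multilinear \<tau>"
  shows "cochain_ip {n. 2 \<le> mdeg n \<and> mdeg n \<le> N} k (derivation_act (mult_pd i j) \<sigma>) \<tau>
    = cochain_ip {n. 2 \<le> mdeg n \<and> mdeg n \<le> N} k \<sigma> (derivation_act (mult_pd j i) \<tau>)"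
  using assms
proof (induction k arbitrary: \<sigma> \<tau>)
  case (Suc k)
  let ?M = "{n. 2 \<le> mdeg n \<and> mdeg n \<le> N}"
  let ?g = "\<lambda>a b. cochain_ip ?M k (interior_product (mono_ham a) \<sigma>) (interior_product (mono_ham b) \<tau>)"
  let ?r = "\<Sum>n\<in>?M. cochain_ip ?M k (derivation_act (mult_pd i j) (interior_product (mono_ham n) \<sigma>)) (interior_product (mono_ham n) \<tau>) / mono_fact n"
  have "cochain_ip ?M (Suc k) (derivation_act (mult_pd i j) \<sigma>) \<tau>
      = (\<Sum>n\<in>?M. real (Poly_Mapping.lookup n j) / mono_fact n * ?g (n - unit_exp j + unit_exp i) n) + ?r"
    by (simp add: interior_derivation_act interior_mult_pd Suc.prems cochain_ip_simps add_divide_distrib flip: sum.distrib)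
  also have "\<dots> = (\<Sum>n\<in>?M. real (Poly_Mapping.lookup n i) / mono_fact n * ?g n (n - unit_exp i + unit_exp j)) + ?r"
    by (rule arg_cong[where f = "\<lambda>x. x + ?r"], rule sum_monomial_shift[where g = ?g])
  also have "?r = (\<Sum>n\<in>?M. cochain_ip ?M k (interior_product (mono_ham n) \<sigma>) (derivation_act (mult_pd j i) (interior_product (mono_ham n) \<tau>)) / mono_fact n)"
    by (simp only: Suc.IH[OF multilinear_interior[OF Suc.prems(1)] multilinear_interior[OF Suc.prems(2)]])
  also have "(\<Sum>n\<in>?M. real (Poly_Mapping.lookup n i) / mono_fact n * ?g n (n - unit_exp i + unit_exp j)) + \<dots>
      = cochain_ip ?M (Suc k) \<sigma> (derivation_act (mult_pd j i) \<tau>)"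
    by (simp add: interior_derivation_act interior_mult_pd Suc.prems cochain_ip_add_right cochain_ip_scale_right add_divide_distrib flip: sum.distrib)
  finally show ?case .
qed simp

section \<open>Horizontal cochains as an \<open>sp(4)\<close>-module\<close>

text \<open>The sets of monomials indexing the basis of the cochains of degree \<open>m\<close> and weight \<open>w\<close> in which
  \<open>S\<^sub>2\<close> does not appear, and the subsets of the basis of torus weight \<open>(p, q)\<close>.\<close>

definition cells :: "nat \<Rightarrow> nat \<Rightarrow> monom4 set set"
  where "cells m w = {A. finite A \<and> card A = m \<and> (\<forall>n\<in>A. 3 \<le> mdeg n) \<and> (\<Sum>n\<in>A. mdeg n - 2) = w}"

definition wt1 :: "monom4 \<Rightarrow> int" where "wt1 n = int (Poly_Mapping.lookup n 1) - int (Poly_Mapping.lookup n 4)"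
definition wt2 :: "monom4 \<Rightarrow> int" where "wt2 n = int (Poly_Mapping.lookup n 2) - int (Poly_Mapping.lookup n 3)"

definition wcells :: "nat \<Rightarrow> nat \<Rightarrow> int \<Rightarrow> int \<Rightarrow> monom4 set set"
  where "wcells m w p q = {A \<in> cells m w. (\<Sum>n\<in>A. wt1 n) = p \<and> (\<Sum>n\<in>A. wt2 n) = q}"

lemma cells_mdeg: assumes "A \<in> cells m w" "n \<in> A" shows "3 \<le> mdeg n" "mdeg n \<le> w + 2"
proof -
  have "mdeg n - 2 \<le> (\<Sum>n\<in>A. mdeg n - 2)"
    using assms by (intro member_le_sum) (auto simp: cells_def)
  then show "3 \<le> mdeg n" "mdeg n \<le> w + 2"
    using assms by (auto simp: cells_def)
qed

lemma finite_cells: "finite (cells m w)"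
  by (rule finite_subset[of _ "Pow {n. mdeg n \<le> w + 2}"])
    (use cells_mdeg in \<open>auto simp: finite_mdeg_le\<close>)

interpretation cells: monomial_sets "cells m w" for m w
proof
  show "finite (cells m w)" by (rule finite_cells)
  show "finite A" if "A \<in> cells m w" for A
    using that by (simp add: cells_def)
  show "2 \<le> mdeg n" if "A \<in> cells m w" "n \<in> A" for A n
    using cells_mdeg(1)[OF that] by simp
qed

interpretation wcells: monomial_sets "wcells m w p q" for m w p q
proof
  show "finite (wcells m w p q)"
    by (rule finite_subset[OF _ finite_cells[of m w]]) (auto simp: wcells_def)
  show "finite A" if "A \<in> wcells m w p q" for A
    using that by (simp add: wcells_def cells_def)
  show "2 \<le> mdeg n" if "A \<in> wcells m w p q" "n \<in> A" for A n
    using that cells.sets(2)[of A m w n] by (simp add: wcells_def)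
qed

lemma set_in_cells:
  assumes "distinct ns"
  shows "set ns \<in> cells m w \<longleftrightarrow> length ns = m \<and> (\<forall>d\<in>set (map mdeg ns). 3 \<le> d) \<and> (\<Sum>d\<leftarrow>map mdeg ns. d - 2) = w"
  using assms by (simp add: cells_def distinct_card sum_list_distinct_conv_sum_set o_def)

text \<open>The indices are exchanged because the action on cochains is dual to that on polynomials.\<close>

abbreviation gl_act :: "4 \<Rightarrow> 4 \<Rightarrow> cochain \<Rightarrow> cochain" where "gl_act a b \<equiv> derivation_act (mult_pd b a)"

text \<open>The action replaces one monomial by another of the same degree, and membership in \<open>cells\<close>
  depends only on degrees.\<close>

lemma gl_act_cells:
  assumes \<sigma>: "\<sigma> \<in> cochain_space (cells m w)"
  shows "gl_act a b \<sigma> \<in> cochain_space (cells m w)"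
proof -
  have ml: "multilinear (gl_act a b \<sigma>)" and alt: "alternating (gl_act a b \<sigma>)" and "multilinear \<sigma>"
    using \<sigma> by (auto simp: cochain_space_def multilinear_derivation_act linear_mult_pd alternating_derivation_act)
  have "set ns \<in> cells m w" if ns: "monomials ns" and nz: "gl_act a b \<sigma> (map mono_ham ns) \<noteq> 0" for ns
  proof -
    obtain xs f ys where "map mono_ham ns = xs @ f # ys" and nz2: "\<sigma> (xs @ mult_pd b a f # ys) \<noteq> 0"
      using derivation_act_nonzeroE[OF nz] by blast
    then obtain us n vs where n: "ns = us @ n # vs" "xs = map mono_ham us" "f = mono_ham n" "ys = map mono_ham vs"
      by (auto simp: map_eq_append_conv map_eq_Cons_conv)
    let ?n' = "n - unit_exp a + unit_exp b"
    have lin: "linear (\<lambda>f. \<sigma> (xs @ f # ys))"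
      using \<open>multilinear \<sigma>\<close> unfolding multilinear_def by blast
    have "2 \<le> mdeg n" using ns n(1) by (simp add: monomials_def)
    then have "\<sigma> (xs @ mult_pd b a f # ys) = real (Poly_Mapping.lookup n a) * \<sigma> (map mono_ham (us @ ?n' # vs))"
      using linear_cmul[OF lin, of "real (Poly_Mapping.lookup n a)" "mono_ham ?n'"] n(2-) by (simp add: mult_pd_mono_ham)
    with nz2 have a: "Poly_Mapping.lookup n a \<noteq> 0" and nz3: "\<sigma> (map mono_ham (us @ ?n' # vs)) \<noteq> 0"
      by auto
    have "monomials (us @ ?n' # vs)"
      using ns n mdeg_shift[OF a, of b] by (auto simp: monomials_def)
    note d = cochain_space_distinct[OF \<sigma> this nz3]
    have eq: "map mdeg (us @ ?n' # vs) = map mdeg ns" "length (us @ ?n' # vs) = length ns"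
      using n mdeg_shift[OF a, of b] by simp_all
    have dist: "distinct ns"
      using alternating_not_distinct[OF alt, of "map mono_ham ns"] nz ns by (auto simp: distinct_map_mono_ham)
    show ?thesis
      using d(2) unfolding set_in_cells[OF d(1)] set_in_cells[OF dist] eq .
  qed
  then show ?thesis
    using ml alt by (simp add: cochain_space_def)
qed

lemma gl_act_commutator:
  assumes "multilinear \<sigma>"
  shows "gl_act i j (gl_act k l \<sigma>) = gl_act k l (gl_act i j \<sigma>) + (if j = k then gl_act i l \<sigma> else 0) - (if l = i then gl_act k j \<sigma> else 0)"
proof
  fix fs
  have "gl_act i j (gl_act k l \<sigma>) fs - gl_act k l (gl_act i j \<sigma>) fs
      = derivation_act (\<lambda>f. (if j = k then mult_pd l i f else 0) - (if l = i then mult_pd j k f else 0)) \<sigma> fs"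
    by (rule derivation_act_commutator[OF assms]) (auto simp: mult_pd_commutator)
  also have "\<dots> = derivation_act (\<lambda>f. if j = k then mult_pd l i f else 0) \<sigma> fs - derivation_act (\<lambda>f. if l = i then mult_pd j k f else 0) \<sigma> fs"
    by (rule derivation_act_linear_arg(2)[OF assms])
  also have "derivation_act (\<lambda>f. if j = k then mult_pd l i f else 0) \<sigma> fs = (if j = k then gl_act i l \<sigma> else 0) fs"
    using derivation_act_linear_arg(4)[OF assms] by simp
  also have "derivation_act (\<lambda>f. if l = i then mult_pd j k f else 0) \<sigma> fs = (if l = i then gl_act k j \<sigma> else 0) fs"
    using derivation_act_linear_arg(4)[OF assms] by simp
  finally show "gl_act i j (gl_act k l \<sigma>) fs
      = (gl_act k l (gl_act i j \<sigma>) + (if j = k then gl_act i l \<sigma> else 0) - (if l = i then gl_act k j \<sigma> else 0)) fs"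
    by simp
qed

lemma cells_length:
  assumes "\<sigma> \<in> cochain_space (cells m w)" "monomials ns" "\<sigma> (map mono_ham ns) \<noteq> 0"
  shows "length ns = m"
  using cochain_space_distinct[OF assms] set_in_cells by blast

interpretation horizontal: gl4_module "cochain_space (cells m w)" gl_act "cochain_ip {n. 2 \<le> mdeg n \<and> mdeg n \<le> w + 2} m" for m w
proof (rule gl4_module.intro)
  let ?H = "cochain_space (cells m w)" and ?M = "{n. 2 \<le> mdeg n \<and> mdeg n \<le> w + 2}"
  have ml: "multilinear \<sigma>" if "\<sigma> \<in> ?H" for \<sigma> using that by (simp add: cochain_space_def)
  show "subspace ?H" by (rule subspace_cochain_space)
  show "\<exists>X. finite X \<and> ?H \<subseteq> span X"
    using cells.cochain_space_span[of m w] finite_cells by (intro exI[of _ "(\<lambda>A. dual_monomial (listing A)) ` cells m w"]) simp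
  show "linear (gl_act i j)" for i j
    by (rule linear_derivation_act)
  show "gl_act i j v \<in> ?H" if "v \<in> ?H" for i j v using that by (rule gl_act_cells)
  show "gl_act i j (gl_act k l v) = gl_act k l (gl_act i j v) + (if j = k then gl_act i l v else 0) - (if l = i then gl_act k j v else 0)"
    if "v \<in> ?H" for v i j k l by (rule gl_act_commutator[OF ml[OF that]])
  show "linear (\<lambda>u. cochain_ip ?M m u v)" for v by (rule linear_cochain_ip)
  show "cochain_ip ?M m u v = cochain_ip ?M m v u" for u v by (rule cochain_ip_sym)
  show "cochain_ip ?M m (gl_act i j u) v = cochain_ip ?M m u (gl_act j i v)" if "u \<in> ?H" "v \<in> ?H" for u v i j
    by (rule cochain_ip_adjoint[OF ml[OF that(1)] ml[OF that(2)]])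
  show "cochain_ip ?M m v v > 0" if v: "v \<in> ?H" "v \<noteq> 0" for v
  proof (rule ccontr)
    assume "\<not> cochain_ip ?M m v v > 0"
    then have 0: "cochain_ip ?M m v v = 0" using cochain_ip_nonneg[of ?M m v] by simp
    have fin: "finite ?M" by (rule finite_subset[OF _ finite_mdeg_le[of "w + 2"]]) auto
    have "v (map mono_ham ns) = 0" if ns: "monomials ns" for ns
    proof (rule ccontr)
      assume nz: "v (map mono_ham ns) \<noteq> 0"
      have "set ns \<subseteq> ?M"
        using cells_mdeg[OF cochain_space_distinct(2)[OF v(1) ns nz]] by force
      then show False
        using cochain_ip_zeroD[OF fin 0 _ cells_length[OF v(1) ns nz]] nz by blast
    qed
    then have "v = 0"
      by (intro multilinear_eqI[OF ml[OF v(1)] ml[OF subspace_0[OF subspace_cochain_space]]]) simp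
    with v(2) show False by blast
  qed
qed

lemma derivation_act_diagonal:
  assumes "multilinear \<sigma>" "monomials ns"
  shows "derivation_act (mult_pd i i) \<sigma> (map mono_ham ns) = (\<Sum>n\<leftarrow>ns. real (Poly_Mapping.lookup n i)) * \<sigma> (map mono_ham ns)"
  using assms
proof (induction ns arbitrary: \<sigma>)
  case (Cons n ns)
  then have n: "2 \<le> mdeg n" "monomials ns" by (auto simp: monomials_def)
  have "mult_pd i i (mono_ham n) = real (Poly_Mapping.lookup n i) *\<^sub>R mono_ham n"
    using mult_pd_mono_ham[OF n(1), of i i] monom_diff_add[of n i] by (cases "Poly_Mapping.lookup n i = 0") simp_all
  then have "\<sigma> (mult_pd i i (mono_ham n) # map mono_ham ns) = real (Poly_Mapping.lookup n i) * \<sigma> (mono_ham n # map mono_ham ns)"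
    using linear_cmul[OF multilinear_headD[OF Cons.prems(1)]] by simp
  then show ?case
    using Cons.IH[OF multilinear_interior[OF Cons.prems(1)] n(2), of "mono_ham n"]
    by (simp add: interior_product_def[abs_def] algebra_simps)
qed simp

text \<open>Cartan elements act diagonally on monomials, so weight spaces can be read off from the support
  of a cochain.\<close>

lemma cartan_mono:
  assumes "multilinear \<sigma>" "monomials ns"
  shows "horizontal.h1 \<sigma> (map mono_ham ns) = real_of_int (\<Sum>n\<leftarrow>ns. wt1 n) * \<sigma> (map mono_ham ns)"
    "horizontal.h2 \<sigma> (map mono_ham ns) = real_of_int (\<Sum>n\<leftarrow>ns. wt2 n) * \<sigma> (map mono_ham ns)"
proof -
  have "real_of_int (\<Sum>n\<leftarrow>ns. int (f n) - int (g n)) = (\<Sum>n\<leftarrow>ns. real (f n)) - (\<Sum>n\<leftarrow>ns. real (g n))" for f g :: "monom4 \<Rightarrow> nat"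
    by (induction ns) simp_all
  then show "horizontal.h1 \<sigma> (map mono_ham ns) = real_of_int (\<Sum>n\<leftarrow>ns. wt1 n) * \<sigma> (map mono_ham ns)"
    "horizontal.h2 \<sigma> (map mono_ham ns) = real_of_int (\<Sum>n\<leftarrow>ns. wt2 n) * \<sigma> (map mono_ham ns)"
    unfolding horizontal.h1_def horizontal.h2_def wt1_def wt2_def
    by (simp_all only: minus_apply derivation_act_diagonal[OF assms] left_diff_distrib)
qed

lemma weight_space_eq_cochain_space: "horizontal.weight_space m w p q = cochain_space (wcells m w p q)"
proof (intro equalityI subsetI)
  fix \<sigma> assume \<sigma>: "\<sigma> \<in> horizontal.weight_space m w p q"
  then have H: "\<sigma> \<in> cochain_space (cells m w)"
    and h: "horizontal.h1 \<sigma> = real_of_int p *\<^sub>R \<sigma>" "horizontal.h2 \<sigma> = real_of_int q *\<^sub>R \<sigma>"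
    by (simp_all add: horizontal.weight_space_def)
  then have ml: "multilinear \<sigma>"
    by (simp add: cochain_space_def)
  have "set ns \<in> wcells m w p q" if ns: "monomials ns" and nz: "\<sigma> (map mono_ham ns) \<noteq> 0" for ns
  proof -
    note d = cochain_space_distinct[OF H ns nz]
    have "real_of_int (\<Sum>n\<leftarrow>ns. wt1 n) = real_of_int p" "real_of_int (\<Sum>n\<leftarrow>ns. wt2 n) = real_of_int q"
      using cartan_mono[OF ml ns] nz by (simp_all add: h)
    then show ?thesis
      using d by (simp only: of_int_eq_iff) (simp add: wcells_def sum_list_distinct_conv_sum_set)
  qed
  then show "\<sigma> \<in> cochain_space (wcells m w p q)"
    using H by (simp add: cochain_space_def)
next
  fix \<sigma> assume \<sigma>: "\<sigma> \<in> cochain_space (wcells m w p q)"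
  then have H: "\<sigma> \<in> cochain_space (cells m w)" and ml: "multilinear \<sigma>"
    using cochain_space_mono[of "wcells m w p q" "cells m w"] by (auto simp: wcells_def cochain_space_def)
  have mls: "multilinear (c *\<^sub>R \<sigma>)" for c
    using subspace_scale[OF subspace_multilinear] ml by simp
  have mlh: "multilinear (horizontal.h1 \<sigma>)" "multilinear (horizontal.h2 \<sigma>)"
    using horizontal.ops_closed(9,10)[OF H] by (simp_all add: cochain_space_def)
  have *: "(\<Sum>n\<leftarrow>ns. wt1 n) = p \<and> (\<Sum>n\<leftarrow>ns. wt2 n) = q \<or> \<sigma> (map mono_ham ns) = 0" if "monomials ns" for ns
    using cochain_space_distinct[OF \<sigma> that] by (auto simp: wcells_def sum_list_distinct_conv_sum_set)
  have "horizontal.h1 \<sigma> = real_of_int p *\<^sub>R \<sigma>" "horizontal.h2 \<sigma> = real_of_int q *\<^sub>R \<sigma>"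
    by (rule multilinear_eqI[OF mlh(1) mls] multilinear_eqI[OF mlh(2) mls], use * cartan_mono[OF ml] in force)+
  then show "\<sigma> \<in> horizontal.weight_space m w p q"
    using H by (simp add: horizontal.weight_space_def)
qed

lemma dim_weight_space: "dim (horizontal.weight_space m w p q) = card (wcells m w p q)"
  by (simp add: weight_space_eq_cochain_space wcells.dim_cochain_space)

section \<open>Relative cochains are the invariants\<close>

text \<open>With these, \<open>{x\<^sub>c, f} = dual_sign c * \<partial>f / \<partial>x\<^sub>(dual_index c)\<close>.\<close>

definition dual_index :: "4 \<Rightarrow> 4"
  where "dual_index c = (if c = 1 then 4 else if c = 2 then 3 else if c = 3 then 2 else 1)"

definition dual_sign :: "4 \<Rightarrow> real"
  where "dual_sign c = (if c = 1 \<or> c = 2 then 1 else - 1)"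

lemma mdeg_two: "mdeg (unit_exp a + unit_exp b) = 2"
  by (simp add: mdeg_add mdeg_single)

lemma bracket_quadratic:
  "bracket (mono_ham (unit_exp a + unit_exp b)) f = dual_sign b *\<^sub>R mult_pd a (dual_index b) f + dual_sign a *\<^sub>R mult_pd b (dual_index a) f"
proof -
  have pd: "pd k (poly_of_ham (mono_ham (unit_exp a + unit_exp b))) = (if k = a then pvar b else 0) + (if k = b then pvar a else 0)" for k a b
    by (simp only: poly_of_mono_ham mdeg_two order_refl pd_quadratic pvar_def)
  have "\<forall>a b. poly_of_ham (bracket (mono_ham (unit_exp a + unit_exp b)) f)
      = poly_of_ham (dual_sign b *\<^sub>R mult_pd a (dual_index b) f + dual_sign a *\<^sub>R mult_pd b (dual_index a) f)"
    unfolding forall_4 bracket.rep_eq plus_ham.rep_eq scaleR_ham.rep_eq mult_pd.rep_eq poisson_def pd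
    by (simp add: dual_index_def dual_sign_def algebra_simps)
  then show ?thesis by (intro ham_eqI) blast
qed

lemma linear_bracket_left: "linear (\<lambda>q. bracket q f)"
proof (rule linearI; rule ham_eqI)
  show "poly_of_ham (bracket (p + q) f) = poly_of_ham (bracket p f + bracket q f)" for p q
    by (simp add: bracket.rep_eq plus_ham.rep_eq poisson_def pd_add algebra_simps)
  have "(c *\<^sub>R p) * q = c *\<^sub>R (p * q)" for c and p q :: poly4
    by (simp only: scaleR4_eq_mult mult.assoc)
  then show "poly_of_ham (bracket (c *\<^sub>R p) f) = poly_of_ham (c *\<^sub>R bracket p f)" for c p
    by (simp add: bracket.rep_eq scaleR_ham.rep_eq poisson_def pd_scaleR scaleR_add_right scaleR_diff_right)
qed

lemma mdeg_2E:
  assumes "mdeg n = 2"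
  obtains a b where "n = unit_exp a + unit_exp b"
proof -
  obtain a n' where 1: "n = n' + unit_exp a" "mdeg n' = Suc 0"
    using assms by (auto simp: numeral_2_eq_2 elim: mdeg_SucE)
  then obtain b n'' where "n' = n'' + unit_exp b" "mdeg n'' = 0"
    using mdeg_SucE by metis
  with 1 that show thesis by (simp add: mdeg_0_iff)
qed

lemma homogeneous_2_expand:
  assumes "homogeneous 2 q" "linear F" "\<And>a b. F (mono_ham (unit_exp a + unit_exp b)) = 0"
  shows "F q = (0 :: 'a::real_vector)"
proof -
  let ?K = "Poly_Mapping.keys (poly_of_ham q)"
  have "F q = (\<Sum>n\<in>?K. coef n q *\<^sub>R F (mono_ham n))"
    using arg_cong[OF ham_expand[of q], of F] by (simp add: linear_sum[OF assms(2)] linear_cmul[OF assms(2)])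
  also have "\<dots> = 0"
  proof (rule sum.neutral, rule ballI)
    fix n assume "n \<in> ?K"
    then have "mdeg n = 2" using assms(1) by (simp add: homogeneous_def)
    then obtain a b where "n = unit_exp a + unit_exp b" by (rule mdeg_2E)
    with assms(3) show "coef n q *\<^sub>R F (mono_ham n) = 0" by simp
  qed
  finally show ?thesis .
qed

lemma linear_derivation_act_bracket:
  assumes "multilinear \<sigma>"
  shows "linear (\<lambda>q. derivation_act (bracket q) \<sigma>)"
proof (rule linearI; rule ext)
  fix p q fs and c :: real
  have "bracket (p + q) = (\<lambda>f. bracket p f + bracket q f)" "bracket (c *\<^sub>R p) = (\<lambda>f. c *\<^sub>R bracket p f)"
    using linear_add[OF linear_bracket_left] linear_cmul[OF linear_bracket_left] by auto
  then show "derivation_act (bracket (p + q)) \<sigma> fs = (derivation_act (bracket p) \<sigma> + derivation_act (bracket q) \<sigma>) fs"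
    "derivation_act (bracket (c *\<^sub>R p)) \<sigma> fs = (c *\<^sub>R derivation_act (bracket p) \<sigma>) fs"
    by (simp_all add: derivation_act_linear_arg[OF assms])
qed

lemma derivation_act_bracket_quadratic:
  assumes "multilinear \<sigma>"
  shows "derivation_act (bracket (mono_ham (unit_exp a + unit_exp b))) \<sigma> = dual_sign b *\<^sub>R gl_act (dual_index b) a \<sigma> + dual_sign a *\<^sub>R gl_act (dual_index a) b \<sigma>"
proof -
  have eq: "bracket (mono_ham (unit_exp a + unit_exp b)) = (\<lambda>f. dual_sign b *\<^sub>R mult_pd a (dual_index b) f + dual_sign a *\<^sub>R mult_pd b (dual_index a) f)"
    by (rule ext) (rule bracket_quadratic)
  show ?thesis
    unfolding eq by (rule ext) (simp add: derivation_act_linear_arg[OF assms])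
qed

text \<open>The brackets with the ten quadratic monomials act as the ten generators, up to scalars.\<close>

lemma invariants_iff:
  assumes "\<sigma> \<in> cochain_space (cells m w)"
  shows "\<sigma> \<in> horizontal.invariants m w \<longleftrightarrow> (\<forall>a b. derivation_act (bracket (mono_ham (unit_exp a + unit_exp b))) \<sigma> = 0)"
proof -
  have ml: "multilinear \<sigma>" using assms by (simp add: cochain_space_def)
  have dbl: "2 * v = 0 \<longleftrightarrow> v = 0" for v :: cochain
    by (metis add_cancel_right_right mult_2 scaleR_2 scaleR_eq_0_iff zero_neq_numeral)
  show ?thesis
    unfolding derivation_act_bracket_quadratic[OF ml] forall_4 horizontal.invariants_def
    using assms
    by (simp add: dual_index_def dual_sign_def horizontal.op_defs dbl neg_eq_iff_add_eq_0 add.commute[of "gl_act 4 2 \<sigma>"]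
        add.commute[of "gl_act 2 4 \<sigma>"])
      (rule iffI; elim conjE; intro conjI; (assumption | rule sym, assumption))
qed

lemma cochain_space_horizontal:
  assumes "\<sigma> \<in> cochain_space (cells m w)" "homogeneous 2 q"
  shows "interior_product q \<sigma> = 0"
proof (rule homogeneous_2_expand[OF assms(2)])
  have ml: "multilinear \<sigma>" using assms by (simp add: cochain_space_def)
  then show "linear (\<lambda>q. interior_product q \<sigma>)" by (rule linear_interior)
  fix a b
  show "interior_product (mono_ham (unit_exp a + unit_exp b)) \<sigma> = 0"
  proof (rule multilinear_eqI[OF multilinear_interior[OF ml]])
    show "multilinear (0 :: cochain)" using subspace_0[OF subspace_multilinear] by simp
    fix ns assume "monomials ns"
    then have "monomials ((unit_exp a + unit_exp b) # ns)" by (simp add: monomials_def mdeg_add mdeg_single)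
    from cochain_space_distinct(2)[OF assms(1) this] cells_mdeg(1)[of _ m w "unit_exp a + unit_exp b"]
    show "interior_product (mono_ham (unit_exp a + unit_exp b)) \<sigma> (map mono_ham ns) = 0 (map mono_ham ns)"
      by (auto simp: interior_product_def mdeg_add mdeg_single)
  qed
qed

lemma quadratic_iff_momentum: "homogeneous 2 q \<longleftrightarrow> (\<exists>\<xi>\<in>sp4. q = momentum \<xi>)"
  using momentum_image by blast

text \<open>A sorted list of degrees is determined by its multiplicities, which supply the exponents
  \<open>k\<^sub>2, k\<^sub>3, \<dots>\<close> of the block to which the basis cochain belongs.\<close>

lemma cells_cochains:
  assumes "A \<in> cells m w"
  shows "dual_monomial (listing A) \<in> cochains m w"
proof -
  let ?ns = "listing A"
  note A = cells.sets[OF assms] cells_mdeg[OF assms]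
  note l = listing[OF A(1)]
  define ls where "ls = map mdeg ?ns"
  have ls2: "2 \<le> d" if "d \<in> set ls" for d
    using that A(2) l(1) by (auto simp: ls_def)
  define N where "N = Suc (Max (insert 0 (set ls)))"
  define ks where "ks = map (\<lambda>i. count (mset ls) (i + 2)) [0..<N]"
  have "mset (factor_degrees ks) = mset ls"
  proof (rule multiset_eqI)
    fix d
    have "count (mset (concat (map (\<lambda>i. replicate (f i) (i + 2)) [0..<N]))) d = (if 2 \<le> d \<and> d - 2 < N then f (d - 2) else 0)" for f and N :: nat
      by (induction N) auto
    note subset_count = this
    have eq: "factor_degrees ks = concat (map (\<lambda>i. replicate (count (mset ls) (i + 2)) (i + 2)) [0..<length ks])"
      unfolding factor_degrees_def by (rule arg_cong[where f = concat]) (auto simp: ks_def)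
    show "count (mset (factor_degrees ks)) d = count (mset ls) d"
    proof (cases "d \<in> set ls")
      case True
      then have "d \<le> Max (insert 0 (set ls))" by simp
      then have "d - 2 < length ks" by (simp add: ks_def N_def)
      moreover have "d - 2 + 2 = d" using ls2[OF True] by simp
      ultimately show ?thesis using ls2[OF True] unfolding eq subset_count by (simp only: if_True simp_thms)
    next
      case False
      then have 0: "count (mset ls) d = 0" by (simp add: count_eq_zero_iff)
      have "2 \<le> d \<Longrightarrow> d - 2 + 2 = d" by simp
      with 0 show ?thesis unfolding eq subset_count by (simp only: split: if_splits) simp
    qed
  qed
  moreover have "sorted (factor_degrees ks)"
  proof -
    have "sorted (concat (map (\<lambda>i. replicate (f i) (i + 2)) [0..<N]))" for f and N :: nat
      by (induction N) (auto simp: sorted_append)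
    then show ?thesis by (simp add: factor_degrees_def)
  qed
  ultimately have fd: "factor_degrees ks = ls"
    using l(3) by (metis ls_def properties_for_sort)
  have sum: "sum_list ks = m"
    using length_factor_degrees[of ks] l(1,2) assms unfolding fd by (simp add: ls_def cells_def distinct_card[symmetric])
  have "int (\<Sum>i<length ks. ks ! i * i) = (\<Sum>d\<leftarrow>ls. int d - 2)"
    using weight_factor_degrees[of ks] fd by simp
  also have "\<dots> = (\<Sum>d\<leftarrow>ls. int (d - 2))"
    using ls2 by (intro arg_cong[where f = sum_list] map_cong) (auto simp: of_nat_diff)
  also have "\<dots> = int (\<Sum>d\<leftarrow>ls. d - 2)"
    by (induction ls) simp_all
  also have "(\<Sum>d\<leftarrow>ls. d - 2) = w"
    using set_in_cells[OF l(2), of m w] assms by (simp add: l(1) ls_def)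
  finally have wt: "(\<Sum>i<length ks. ks ! i * i) = w" by (simp only: of_nat_eq_iff)
  have "coef n \<in> dual_hom (mdeg n)" for n
    by (auto simp: dual_hom_def linear_coef homogeneous_def coef_def in_keys_iff) (metis in_keys_iff)
  then have "list_all2 (\<lambda>z l. z \<in> dual_hom l) (map coef ?ns) (factor_degrees ks)"
    unfolding fd ls_def by (simp add: list_all2_conv_all_nth)
  then have "dual_monomial ?ns \<in> ext_block ks"
    unfolding ext_block_def dual_monomial_def by (intro span_base) blast
  then show ?thesis
    unfolding cochains_def using sum wt by (intro span_base) blast
qed

text \<open>Contraction with quadratic polynomials confines the support to degrees at least three; Cartan's
  formula translates the condition on the coboundary into invariance.\<close>

theorem rel_cochains_eq_invariants: "rel_cochains m w = horizontal.invariants m w"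
proof (intro equalityI subsetI)
  fix \<sigma> assume \<sigma>: "\<sigma> \<in> horizontal.invariants m w"
  then have H: "\<sigma> \<in> cochain_space (cells m w)" by (simp add: horizontal.invariants_def)
  then have ml: "multilinear \<sigma>" and alt: "alternating \<sigma>" by (auto simp: cochain_space_def)
  have "\<sigma> \<in> span ((\<lambda>A. dual_monomial (listing A)) ` cells m w)"
    using H cells.cochain_space_span by blast
  also have "\<dots> \<subseteq> cochains m w"
    using cells_cochains by (intro span_minimal) (auto simp: cochains_def)
  finally have "\<sigma> \<in> cochains m w" .
  moreover have "interior_product q \<sigma> = 0 \<and> interior_product q (coboundary \<sigma>) = 0" if q: "homogeneous 2 q" for q
  proof -
    have "derivation_act (bracket q) \<sigma> = 0"
      using invariants_iff[OF H] \<sigma> by (intro homogeneous_2_expand[OF q linear_derivation_act_bracket[OF ml]]) blast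
    then show ?thesis
      using cartan_formula[OF alt] cochain_space_horizontal[OF H q] by simp
  qed
  ultimately show "\<sigma> \<in> rel_cochains m w"
    unfolding rel_cochains_def using quadratic_iff_momentum by blast
next
  fix \<sigma> assume \<sigma>: "\<sigma> \<in> rel_cochains m w"
  then have props: "multilinear \<sigma>" "alternating \<sigma>" "has_weight (int w) \<sigma>" "has_degree m \<sigma>"
    using cochains_properties[of \<sigma> m w] by (auto simp: rel_cochains_def)
  have q: "interior_product q \<sigma> = 0" "interior_product q (coboundary \<sigma>) = 0" if "homogeneous 2 q" for q
    using \<sigma> that quadratic_iff_momentum by (auto simp: rel_cochains_def)
  have hom: "homogeneous 2 (mono_ham n)" if "mdeg n = 2" for n
    using homogeneous_mono_ham[of n] that by simp
  have "set ns \<in> cells m w" if ns: "monomials ns" and nz: "\<sigma> (map mono_ham ns) \<noteq> 0" for ns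
  proof -
    have dist: "distinct ns"
      using alternating_not_distinct[OF props(2), of "map mono_ham ns"] nz ns by (auto simp: distinct_map_mono_ham)
    have 3: "3 \<le> mdeg n" if n: "n \<in> set ns" for n
    proof (rule ccontr)
      assume "\<not> 3 \<le> mdeg n"
      then have "mdeg n = 2" using ns n by (force simp: monomials_def)
      from q(1)[OF hom[OF this]] have 0: "\<sigma> (mono_ham n # fs) = 0" for fs
        by (metis interior_product_def zero_fun_apply)
      obtain xs ys where "ns = xs @ n # ys" using n by (meson split_list)
      then show False
        using alternating_move[OF props(2) 0, of "map mono_ham xs" "map mono_ham ys"] nz by simp
    qed
    have len: "length ns = m"
      using props(4) nz unfolding has_degree_def by (metis length_map)
    have "list_all2 homogeneous (map mdeg ns) (map mono_ham ns)"
      using ns by (auto simp: list_all2_conv_all_nth monomials_def intro!: homogeneous_mono_ham)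
    then have "(\<Sum>l\<leftarrow>map mdeg ns. int l - 2) = int w"
      using props(3) nz unfolding has_weight_def by blast
    moreover have "(\<Sum>l\<leftarrow>map mdeg ns. int l - 2) = int (\<Sum>d\<leftarrow>map mdeg ns. d - 2)"
      using ns by (induction ns) (auto simp: monomials_def of_nat_diff)
    ultimately show ?thesis
      using 3 len by (simp add: set_in_cells[OF dist])
  qed
  then have H: "\<sigma> \<in> cochain_space (cells m w)"
    using props by (simp add: cochain_space_def)
  have "derivation_act (bracket (mono_ham (unit_exp a + unit_exp b))) \<sigma> = 0" for a b
    using cartan_formula[OF props(2) q(1)] q(2) hom[OF mdeg_two] by (metis neg_equal_0_iff_equal)
  then show "\<sigma> \<in> horizontal.invariants m w"
    using invariants_iff[OF H] by blast
qed

section \<open>Counting sets of monomials by weight\<close>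

text \<open>Entries are pairs of a cochain weight and a coded torus weight. The recursion decides for each
  entry whether it belongs to the subset; it specifies the counts but is too slow to
  evaluate.\<close>

primrec subset_count :: "(nat \<times> int) list \<Rightarrow> nat \<Rightarrow> nat \<Rightarrow> int \<Rightarrow> int" where
  "subset_count [] u m k = (if u = 0 \<and> m = 0 \<and> k = 0 then 1 else 0)"
| "subset_count (x # xs) u m k = subset_count xs u m k + (if fst x \<le> u \<and> 0 < m then subset_count xs (u - fst x) (m - 1) (k - snd x) else 0)"

lemma card_eq_subset_count:
  fixes f :: "'a \<Rightarrow> nat" and g :: "'a \<Rightarrow> int"
  assumes "distinct ns"
  shows "int (card {A. A \<subseteq> set ns \<and> card A = m \<and> sum f A = u \<and> sum g A = k}) = subset_count (map (\<lambda>n. (f n, g n)) ns) u m k"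
  using assms
proof (induction ns arbitrary: m u k)
  case Nil
  have "{A. A \<subseteq> set [] \<and> card A = m \<and> sum f A = u \<and> sum g A = k} = (if u = 0 \<and> m = 0 \<and> k = 0 then {{}} else {})"
    by auto
  then show ?case by simp
next
  case (Cons n ns)
  define S where "S m u k = {A. A \<subseteq> set ns \<and> card A = m \<and> sum f A = u \<and> sum g A = k}" for m u k
  have n: "n \<notin> A" if "A \<subseteq> set ns" for A
    using that Cons.prems by auto
  have fin: "finite A" if "A \<subseteq> set ns" for A
    using that finite_subset by blast
  define T where "T = (if f n \<le> u \<and> 0 < m then insert n ` S (m - 1) (u - f n) (k - g n) else {})"
  have "{A. A \<subseteq> set (n # ns) \<and> card A = m \<and> sum f A = u \<and> sum g A = k} = S m u k \<union> T"
  proof (intro equalityI subsetI)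
    fix A assume A: "A \<in> {A. A \<subseteq> set (n # ns) \<and> card A = m \<and> sum f A = u \<and> sum g A = k}"
    show "A \<in> S m u k \<union> T"
    proof (cases "n \<in> A")
      case True
      then obtain B where B: "A = insert n B" "n \<notin> B" by (meson Set.set_insert)
      then have sub: "B \<subseteq> set ns" using A by auto
      then show ?thesis
        using A B fin[OF sub] by (auto simp: T_def S_def)
    qed (use A in \<open>auto simp: S_def\<close>)
  next
    fix A assume "A \<in> S m u k \<union> T"
    then consider "A \<in> S m u k" | B where "f n \<le> u" "0 < m" "A = insert n B" "B \<in> S (m - 1) (u - f n) (k - g n)"
      by (auto simp: T_def split: if_splits)
    then show "A \<in> {A. A \<subseteq> set (n # ns) \<and> card A = m \<and> sum f A = u \<and> sum g A = k}"
    proof cases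
      case 2
      then have "B \<subseteq> set ns" by (simp add: S_def)
      then show ?thesis
        using 2 n[of B] fin[of B] by (auto simp: S_def)
    qed (auto simp: S_def)
  qed
  moreover have "card (S m u k \<union> T) = card (S m u k) + card T"
  proof (rule card_Un_disjoint)
    have S: "finite (S m u k)" for m u k
      by (rule finite_subset[of _ "Pow (set ns)"]) (auto simp: S_def)
    then show "finite (S m u k)" "finite T" by (simp_all add: T_def)
    show "S m u k \<inter> T = {}"
      using n by (auto simp: S_def T_def)
  qed
  moreover have "card T = (if f n \<le> u \<and> 0 < m then card (S (m - 1) (u - f n) (k - g n)) else 0)"
  proof -
    have "inj_on (insert n) (S m u k)" for m u k
      using n by (auto simp: inj_on_def S_def dest!: insert_ident[THEN iffD1, rotated 2])
    then show ?thesis by (simp add: T_def card_image)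
  qed
  ultimately show ?case
    using Cons.IH[of m u k] Cons.IH[of "m - 1" "u - f n" "k - g n"] Cons.prems by (simp add: S_def)
qed

text \<open>A Laurent polynomial in one variable, as a list of exponents with coefficients. The exponents
  code torus weights \<open>(p, q)\<close> as \<open>100 p + q\<close>.\<close>

type_synonym weight_series = "(int \<times> int) list"

fun merge_add :: "weight_series \<Rightarrow> weight_series \<Rightarrow> weight_series" where
  "merge_add [] ys = ys"
| "merge_add xs [] = xs"
| "merge_add ((k, a) # xs) ((l, b) # ys) =
    (if k < l then (k, a) # merge_add xs ((l, b) # ys)
     else if k = l then (k, a + b) # merge_add xs ys
     else (l, b) # merge_add ((k, a) # xs) ys)"

primrec shift :: "int \<Rightarrow> weight_series \<Rightarrow> weight_series" where
  "shift c [] = []"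
| "shift c (x # xs) = (c + fst x, snd x) # shift c xs"

text \<open>The codes of the eight weights in \<open>dim_invariants\<close>. At cochain weight \<open>6\<close> no further monomial
  can be added, so only these coefficients have to be kept.\<close>

definition target :: "int \<Rightarrow> bool" where
  "target k \<longleftrightarrow> k = 0 \<or> k = 2 \<or> k = 400 \<or> k = 402 \<or> k = 101 \<or> k = 301 \<or> k = 103 \<or> k = 303"

primrec shift_target :: "int \<Rightarrow> weight_series \<Rightarrow> weight_series" where
  "shift_target c [] = []"
| "shift_target c (x # xs) = (if target (c + fst x) then (c + fst x, snd x) # shift_target c xs else shift_target c xs)"

fun level_add :: "weight_series list \<Rightarrow> weight_series list \<Rightarrow> weight_series list" where
  "level_add [] ys = ys"
| "level_add xs [] = xs"
| "level_add (x # xs) (y # ys) = merge_add x y # level_add xs ys"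

type_synonym state = "weight_series list list \<times> weight_series list"

text \<open>A state holds, for each cochain weight \<open>u\<close> below \<open>6\<close> and each number \<open>m\<close> of monomials, the
  series of torus weights of the sets counted so far; the second component does so for cochain
  weight \<open>6\<close>, truncated to the target weights. Padding with \<open>v\<close> empty levels pairs level \<open>u\<close> with
  level \<open>u - v\<close>; the new empty series in front raises the number of monomials by one.\<close>

definition add_monom :: "nat \<times> int \<Rightarrow> state \<Rightarrow> state" where
  "add_monom = (\<lambda>(v, c) (rs, f).
     (map2 (\<lambda>r s. level_add r ([] # map (shift c) s)) rs (replicate v [] @ rs),
      level_add f ([] # map (shift_target c) (rs ! (6 - v)))))"

primrec weight_table :: "(nat \<times> int) list \<Rightarrow> state" where
  "weight_table [] = ([[[(0, 1)]], [], [], [], [], []], [])"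
| "weight_table (x # xs) = add_monom x (weight_table xs)"

definition exponents :: "nat \<Rightarrow> (nat \<times> nat \<times> nat \<times> nat) list" where
  "exponents l = concat (map (\<lambda>a. concat (map (\<lambda>b. map (\<lambda>c. (a, b, c, l - a - b - c)) [0..<Suc (l - a - b)]) [0..<Suc (l - a)])) [0..<Suc l])"

definition monom_key :: "nat \<times> nat \<times> nat \<times> nat \<Rightarrow> nat \<times> int" where
  "monom_key = (\<lambda>(a, b, c, d). (a + b + c + d - 2, 100 * (int a - int d) + (int b - int c)))"

text \<open>Reading off a coefficient adds up all entries with the given exponent. Hence correctness does
  not depend on the lists being sorted, which only keeps them short.\<close>

primrec coeff :: "weight_series \<Rightarrow> int \<Rightarrow> int" where
  "coeff [] k = 0"
| "coeff (x # xs) k = (if fst x = k then snd x else 0) + coeff xs k"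

lemma coeff_merge_add: "coeff (merge_add xs ys) k = coeff xs k + coeff ys k"
  by (induction xs ys rule: merge_add.induct) auto

lemma coeff_shift: "coeff (shift c xs) k = coeff xs (k - c)"
  by (induction xs) auto

lemma coeff_shift_target: "target k \<Longrightarrow> coeff (shift_target c xs) k = coeff xs (k - c)"
  by (induction xs) auto

primrec level_coeff :: "weight_series list \<Rightarrow> nat \<Rightarrow> int \<Rightarrow> int" where
  "level_coeff [] m k = 0"
| "level_coeff (x # xs) m k = (case m of 0 \<Rightarrow> coeff x k | Suc m' \<Rightarrow> level_coeff xs m' k)"

lemma level_coeff_add: "level_coeff (level_add xs ys) m k = level_coeff xs m k + level_coeff ys m k"
  by (induction xs ys arbitrary: m rule: level_add.induct) (auto simp: coeff_merge_add split: nat.splits)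

lemma level_coeff_shift:
  "level_coeff ([] # map (shift c) xs) m k = (if 0 < m then level_coeff xs (m - 1) (k - c) else 0)"
proof -
  have "level_coeff (map (shift c) xs) m k = level_coeff xs m (k - c)" for m
    by (induction xs arbitrary: m) (auto simp: coeff_shift split: nat.splits)
  then show ?thesis by (simp split: nat.splits)
qed

lemma level_coeff_shift_target:
  assumes "target k"
  shows "level_coeff ([] # map (shift_target c) xs) m k = (if 0 < m then level_coeff xs (m - 1) (k - c) else 0)"
proof -
  have "level_coeff (map (shift_target c) xs) m k = level_coeff xs m (k - c)" for m
    by (induction xs arbitrary: m) (auto simp: coeff_shift_target assms split: nat.splits)
  then show ?thesis by (simp split: nat.splits)
qed

lemma weight_table_correct:
  assumes "\<forall>x\<in>set xs. 0 < fst x \<and> fst x \<le> 6"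
  shows "length (fst (weight_table xs)) = 6" "u < 6 \<Longrightarrow> level_coeff (fst (weight_table xs) ! u) m k = subset_count xs u m k"
    "target k \<Longrightarrow> level_coeff (snd (weight_table xs)) m k = subset_count xs 6 m k"
proof -
  have "length (fst (weight_table xs)) = 6 \<and> (\<forall>u<6. \<forall>m k. level_coeff (fst (weight_table xs) ! u) m k = subset_count xs u m k)
      \<and> (\<forall>m k. target k \<longrightarrow> level_coeff (snd (weight_table xs)) m k = subset_count xs 6 m k)"
    using assms
  proof (induction xs)
    case Nil
    have "level_coeff ([[[(0, 1)]], [], [], [], [], []] ! u) m k = (if u = 0 \<and> m = 0 \<and> k = 0 then 1 else 0)" if "u < 6" for u m and k :: int
      using that by (auto simp: less_Suc_eq numeral_eq_Suc split: nat.splits)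
    then show ?case by simp
  next
    case (Cons x xs)
    obtain v c where x: "x = (v, c)" by fastforce
    obtain rs f where r: "weight_table xs = (rs, f)" by fastforce
    have v: "0 < v" "v \<le> 6" using Cons.prems x by auto
    from Cons r have IH: "length rs = 6" "\<And>u m k. u < 6 \<Longrightarrow> level_coeff (rs ! u) m k = subset_count xs u m k"
      "\<And>m k. target k \<Longrightarrow> level_coeff f m k = subset_count xs 6 m k"
      by auto
    have "level_coeff (fst (weight_table (x # xs)) ! u) m k = subset_count (x # xs) u m k" if u: "u < 6" for u m k
    proof -
      have "fst (weight_table (x # xs)) ! u = level_add (rs ! u) ([] # map (shift c) ((replicate v [] @ rs) ! u))"
        using u IH(1) by (simp add: add_monom_def x r)
      also have "(replicate v [] @ rs) ! u = (if u < v then [] else rs ! (u - v))"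
        by (simp add: nth_append)
      finally show ?thesis
        using u by (simp only: level_coeff_add level_coeff_shift) (simp add: IH x)
    qed
    moreover have "level_coeff (snd (weight_table (x # xs))) m k = subset_count (x # xs) 6 m k" if "target k" for m k
      using v by (simp add: add_monom_def x r level_coeff_add level_coeff_shift_target[OF that] IH that
          del: level_coeff.simps)
    ultimately show ?case
      using IH(1) by (simp add: add_monom_def x r)
  qed
  then show "length (fst (weight_table xs)) = 6" "u < 6 \<Longrightarrow> level_coeff (fst (weight_table xs) ! u) m k = subset_count xs u m k"
    "target k \<Longrightarrow> level_coeff (snd (weight_table xs)) m k = subset_count xs 6 m k"
    by blast+
qed

section \<open>Weights of the monomials of degrees three to eight\<close>

definition monom_of :: "nat \<times> nat \<times> nat \<times> nat \<Rightarrow> monom4" where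
  "monom_of = (\<lambda>(a, b, c, d). Poly_Mapping.single 1 a + Poly_Mapping.single 2 b + Poly_Mapping.single 3 c + Poly_Mapping.single 4 d)"

lemma lookup_monom_of: "Poly_Mapping.lookup (monom_of (a, b, c, d)) 1 = a" "Poly_Mapping.lookup (monom_of (a, b, c, d)) 2 = b"
  "Poly_Mapping.lookup (monom_of (a, b, c, d)) 3 = c" "Poly_Mapping.lookup (monom_of (a, b, c, d)) 4 = d"
  by (simp_all add: monom_of_def lookup_add lookup_single when_def)

lemma monom_of_lookup: "monom_of (Poly_Mapping.lookup n 1, Poly_Mapping.lookup n 2, Poly_Mapping.lookup n 3, Poly_Mapping.lookup n 4) = n"
proof (rule poly_mapping_eqI)
  have "\<forall>i. Poly_Mapping.lookup (monom_of (Poly_Mapping.lookup n 1, Poly_Mapping.lookup n 2, Poly_Mapping.lookup n 3, Poly_Mapping.lookup n 4)) i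
      = Poly_Mapping.lookup n i"
    unfolding forall_4 by (simp only: lookup_monom_of simp_thms)
  then show "Poly_Mapping.lookup (monom_of (Poly_Mapping.lookup n 1, Poly_Mapping.lookup n 2, Poly_Mapping.lookup n 3, Poly_Mapping.lookup n 4)) i
      = Poly_Mapping.lookup n i" for i ..
qed

lemma inj_monom_of: "inj monom_of"
proof (rule injI)
  fix s t assume "monom_of s = monom_of t"
  then show "s = t"
    by (cases s; cases t) (metis lookup_monom_of)
qed

lemma mdeg_monom_of: "mdeg (monom_of (a, b, c, d)) = a + b + c + d"
  by (simp only: mdeg_def sum_4 lookup_monom_of)

lemma distinct_concat_map:
  assumes "distinct xs" "\<And>x. x \<in> set xs \<Longrightarrow> distinct (f x)"
    "\<And>x y z. x \<in> set xs \<Longrightarrow> y \<in> set xs \<Longrightarrow> z \<in> set (f x) \<Longrightarrow> z \<in> set (f y) \<Longrightarrow> x = y"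
  shows "distinct (concat (map f xs))"
  using assms
proof (induction xs)
  case (Cons x xs)
  then have "distinct (concat (map f xs))" by auto
  moreover have "set (f x) \<inter> set (concat (map f xs)) = {}"
    using Cons.prems(1,3) by fastforce
  ultimately show ?case using Cons.prems(2) by simp
qed simp

lemma set_exponents: "set (exponents l) = {(a, b, c, d). a + b + c + d = l}"
proof -
  have "(a, b, c, d) \<in> set (exponents l) \<longleftrightarrow> a < Suc l \<and> b < Suc (l - a) \<and> c < Suc (l - a - b) \<and> d = l - a - b - c" for a b c d
    by (auto simp: exponents_def image_iff simp del: upt_Suc)
  moreover have "a < Suc l \<and> b < Suc (l - a) \<and> c < Suc (l - a - b) \<and> d = l - a - b - c \<longleftrightarrow> a + b + c + d = l" for a b c d
    by arith
  ultimately show ?thesis by auto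
qed

lemma distinct_exponents: "distinct (exponents l)"
  unfolding exponents_def
  by (intro distinct_concat_map) (auto simp: distinct_map inj_on_def simp del: upt_Suc)

text \<open>A list is processed from its end. The monomials of low degree come last, so that the short
  tables are built first and a monomial of degree \<open>8\<close> meets only the empty set.\<close>

definition all_exponents :: "(nat \<times> nat \<times> nat \<times> nat) list"
  where "all_exponents = concat (map exponents [8, 7, 6, 5, 4, 3])"

lemma distinct_all_exponents: "distinct all_exponents"
  unfolding all_exponents_def
  by (rule distinct_concat_map) (auto simp: distinct_exponents set_exponents)

lemma set_all_monomials: "set (map monom_of all_exponents) = {n. 3 \<le> mdeg n \<and> mdeg n \<le> 8}"
proof (intro equalityI subsetI)
  fix n assume "n \<in> {n. 3 \<le> mdeg n \<and> mdeg n \<le> 8}"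
  then have "mdeg n \<in> set [8, 7, 6, 5, 4, 3]" by auto
  moreover have "(Poly_Mapping.lookup n 1, Poly_Mapping.lookup n 2, Poly_Mapping.lookup n 3, Poly_Mapping.lookup n 4) \<in> set (exponents (mdeg n))"
    by (simp add: set_exponents mdeg_def sum_4)
  ultimately have "(Poly_Mapping.lookup n 1, Poly_Mapping.lookup n 2, Poly_Mapping.lookup n 3, Poly_Mapping.lookup n 4) \<in> set all_exponents"
    unfolding all_exponents_def set_concat set_map by blast
  then show "n \<in> set (map monom_of all_exponents)"
    using monom_of_lookup[of n] by (metis image_eqI set_map)
qed (auto simp: all_exponents_def set_exponents mdeg_monom_of)

lemma monom_key_eq: "monom_key t = (mdeg (monom_of t) - 2, 100 * wt1 (monom_of t) + wt2 (monom_of t))"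
proof -
  obtain a b c d where "t = (a, b, c, d)" by (cases t)
  then show ?thesis
    by (simp only: monom_key_def mdeg_monom_of wt1_def wt2_def lookup_monom_of prod.case)
qed

text \<open>Since \<open>mdeg n \<le> 3 (mdeg n - 2)\<close> for degree at least three, torus weights are too small for
  two of them to share the code \<open>100 p + q\<close>.\<close>

lemma weight_bound:
  assumes "A \<in> cells m w"
  shows "\<bar>\<Sum>n\<in>A. wt1 n\<bar> \<le> 3 * int w" "\<bar>\<Sum>n\<in>A. wt2 n\<bar> \<le> 3 * int w"
proof -
  have "\<bar>\<Sum>n\<in>A. f n\<bar> \<le> 3 * int w" if "\<And>n. \<bar>f n\<bar> \<le> int (mdeg n)" for f :: "monom4 \<Rightarrow> int"
  proof -
    have "\<bar>\<Sum>n\<in>A. f n\<bar> \<le> (\<Sum>n\<in>A. \<bar>f n\<bar>)" by (rule sum_abs)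
    also have "\<dots> \<le> (\<Sum>n\<in>A. 3 * int (mdeg n - 2))"
    proof (rule sum_mono)
      fix n assume "n \<in> A"
      then show "\<bar>f n\<bar> \<le> 3 * int (mdeg n - 2)"
        using that[of n] cells_mdeg(1)[OF assms] by fastforce
    qed
    also have "\<dots> = 3 * int w"
      using assms by (simp add: cells_def sum_distrib_left[symmetric] flip: of_nat_sum)
    finally show ?thesis .
  qed
  moreover have "\<bar>wt1 n\<bar> \<le> int (mdeg n)" "\<bar>wt2 n\<bar> \<le> int (mdeg n)" for n
    unfolding wt1_def wt2_def mdeg_def sum_4 by linarith+
  ultimately show "\<bar>\<Sum>n\<in>A. wt1 n\<bar> \<le> 3 * int w" "\<bar>\<Sum>n\<in>A. wt2 n\<bar> \<le> 3 * int w"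
    by blast+
qed

lemma card_wcells:
  assumes "0 \<le> p" "p \<le> 4" "0 \<le> q" "q \<le> 4" "target (100 * p + q)"
  shows "int (card (wcells m 6 p q)) = level_coeff (snd (weight_table (map monom_key all_exponents))) m (100 * p + q)"
proof -
  have "wcells m 6 p q = {A. A \<subseteq> set (map monom_of all_exponents) \<and> card A = m \<and> (\<Sum>n\<in>A. mdeg n - 2) = 6
      \<and> (\<Sum>n\<in>A. 100 * wt1 n + wt2 n) = 100 * p + q}"
  proof (intro equalityI subsetI)
    fix A assume A: "A \<in> wcells m 6 p q"
    then have "A \<subseteq> set (map monom_of all_exponents)"
      using cells_mdeg[of A m 6] unfolding set_all_monomials by (auto simp: wcells_def)
    then show "A \<in> {A. A \<subseteq> set (map monom_of all_exponents) \<and> card A = m \<and> (\<Sum>n\<in>A. mdeg n - 2) = 6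
        \<and> (\<Sum>n\<in>A. 100 * wt1 n + wt2 n) = 100 * p + q}"
      using A by (simp add: wcells_def cells_def sum.distrib sum_distrib_left[symmetric])
  next
    fix A assume A: "A \<in> {A. A \<subseteq> set (map monom_of all_exponents) \<and> card A = m \<and> (\<Sum>n\<in>A. mdeg n - 2) = 6
      \<and> (\<Sum>n\<in>A. 100 * wt1 n + wt2 n) = 100 * p + q}"
    then have "finite A" using finite_subset by blast
    with A have c: "A \<in> cells m 6"
      unfolding set_all_monomials by (auto simp: cells_def)
    have "100 * (\<Sum>n\<in>A. wt1 n) + (\<Sum>n\<in>A. wt2 n) = 100 * p + q"
      using A by (simp add: sum.distrib sum_distrib_left[symmetric])
    moreover from this have "(\<Sum>n\<in>A. wt1 n) = p"
      using weight_bound[OF c] assms(1-4) by linarith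
    ultimately have "(\<Sum>n\<in>A. wt1 n) = p \<and> (\<Sum>n\<in>A. wt2 n) = q"
      by simp
    then show "A \<in> wcells m 6 p q"
      using c by (simp add: wcells_def)
  qed
  moreover have "distinct (map monom_of all_exponents)"
    using distinct_all_exponents inj_on_subset[OF inj_monom_of] by (simp add: distinct_map)
  ultimately have "int (card (wcells m 6 p q)) = subset_count (map (\<lambda>n. (mdeg n - 2, 100 * wt1 n + wt2 n)) (map monom_of all_exponents)) 6 m (100 * p + q)"
    by (simp only: card_eq_subset_count)
  also have "map (\<lambda>n. (mdeg n - 2, 100 * wt1 n + wt2 n)) (map monom_of all_exponents) = map monom_key all_exponents"
    by (simp add: monom_key_eq)
  also have "subset_count (map monom_key all_exponents) 6 m (100 * p + q) = level_coeff (snd (weight_table (map monom_key all_exponents))) m (100 * p + q)"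
  proof (rule weight_table_correct(3)[symmetric, OF _ assms(5)])
    have "0 < fst (monom_key t) \<and> fst (monom_key t) \<le> 6" if "t \<in> set all_exponents" for t
    proof -
      have "monom_of t \<in> {n. 3 \<le> mdeg n \<and> mdeg n \<le> 8}"
        using that unfolding set_all_monomials[symmetric] by simp
      then have "3 \<le> mdeg (monom_of t)" "mdeg (monom_of t) \<le> 8" by simp_all
      then show ?thesis unfolding monom_key_eq fst_conv by linarith
    qed
    then show "\<forall>x\<in>set (map monom_key all_exponents). 0 < fst x \<and> fst x \<le> 6" by simp
  qed
  finally show ?thesis .
qed

text \<open>Row \<open>m\<close> lists the dimensions of the weight spaces in degree \<open>m\<close>. The evaluation is by
  rewriting with the defining equations.\<close>

lemma weight_multiplicities:
  "snd (weight_table (map monom_key all_exponents)) =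
    [[],
     [(0, 5), (2, 4), (101, 4), (103, 3), (301, 3), (303, 2), (400, 3), (402, 2)],
     [(0, 212), (2, 175), (101, 191), (103, 135), (301, 135), (303, 89), (400, 109), (402, 83)],
     [(0, 1849), (2, 1553), (101, 1694), (103, 1191), (301, 1191), (303, 808), (400, 922), (402, 747)],
     [(0, 5146), (2, 4346), (101, 4724), (103, 3342), (301, 3342), (303, 2313), (400, 2583), (402, 2136)],
     [(0, 4899), (2, 4130), (101, 4494), (103, 3188), (301, 3188), (303, 2226), (400, 2464), (402, 2043)],
     [(0, 1220), (2, 1006), (101, 1111), (103, 768), (301, 768), (303, 529), (400, 578), (402, 472)]]"
  by code_simp

lemma dim_rel_cochains:
  "int (dim (rel_cochains m 6)) = (let d = level_coeff (snd (weight_table (map monom_key all_exponents))) m in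
     d 0 - d 2 - d 400 + d 402 - d 101 + d 301 + d 103 - d 303)"
  using card_wcells[of 0 0 m] card_wcells[of 0 2 m] card_wcells[of 4 0 m] card_wcells[of 4 2 m]
    card_wcells[of 1 1 m] card_wcells[of 3 1 m] card_wcells[of 1 3 m] card_wcells[of 3 3 m]
  by (simp add: rel_cochains_eq_invariants horizontal.dim_invariants dim_weight_space target_def Let_def)

theorem proposition5:
  shows "dim (rel_cochains 0 6) = 0 \<and> dim (rel_cochains 1 6) = 0 \<and> dim (rel_cochains 2 6) = 1
    \<and> dim (rel_cochains 3 6) = 1 \<and> dim (rel_cochains 4 6) = 0 \<and> dim (rel_cochains 5 6) = 4
    \<and> dim (rel_cochains 6 6) = 4 \<and> euler_number 6 = 0"
proof -
  have dims: "dim (rel_cochains 0 6) = 0" "dim (rel_cochains 1 6) = 0" "dim (rel_cochains 2 6) = 1"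
    "dim (rel_cochains 3 6) = 1" "dim (rel_cochains 4 6) = 0" "dim (rel_cochains 5 6) = 4" "dim (rel_cochains 6 6) = 4"
    using dim_rel_cochains[of 0] dim_rel_cochains[of 1] dim_rel_cochains[of 2] dim_rel_cochains[of 3]
      dim_rel_cochains[of 4] dim_rel_cochains[of 5] dim_rel_cochains[of 6]
    by (simp_all add: weight_multiplicities Let_def numeral_eq_Suc)
  have "{..6::nat} = {0, 1, 2, 3, 4, 5, 6}" by auto
  then have "euler_number 6 = 0"
    by (simp add: euler_number_eq dims dims[unfolded One_nat_def])
  with dims show ?thesis by blast
qed

end
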